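(* Let $f:(\mathbb{C}^2,0)\to(\mathbb{C}^2,0)$ be a dominant semi-superattracting holomorphic germ. Then $f$ has a unique eigenvaluation $\nu_\star$, and $\nu_\star=\nu_C$ is a (possibly formal, i.e. possibly non-analytic) curve valuation with $m(C)=1$. Moreover exactly one of the following holds: (i) the only valuation fixed by $f_\bullet$ is $\nu_\star$, and there is exactly one contracted critical curve valuation $\nu_D$ for $f$, with $m(D)=1$; (ii) the set of valuations fixed by $f_\bullet$ consists of exactly two valuations, $\nu_\star$ and a curve valuation $\nu_D$, where $D$ is a (possibly formal) irreducible curve with $m(D)=1$. In both cases $C$ and $D$ intersect transversally, i.e. their intersection multiplicity is $C\cdot D=1$.
   Context: A dominant holomorphic germ $f:(\mathbb{C}^2,0)\to(\mathbb{C}^2,0)$ (i.e. $\det df$ not identically zero) is semi-superattracting if the eigenvalues of $df_0$ are $0$ and $\lambda$ with $\lambda\neq 0$. Valuative tree: let $R=\mathbb{C}[[x,y]]$ with maximal ideal $\mathfrak{m}$. A (centered, normalized) valuation is a map $\nu:R\to[0,+\infty]$ with $\nu(\phi\psi)=\nu(\phi)+\nu(\psi)$, $\nu(\phi+\psi)\ge\min\{\nu(\phi),\nu(\psi)\}$, $\nu(0)=+\infty$, $\nu(c)=0$ for $c\in\mathbb{C}^*$, and $\nu(\mathfrak{m}):=\min\{\nu(\phi):\phi\in\mathfrak{m}\}=1$. The set $\mathcal{V}$ of such valuations, ordered by $\nu\le\mu$ iff $\nu(\phi)\le\mu(\phi)$ for all $\phi$, is an $\mathbb{R}$-tree (the valuative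 tree of Favre–Jonsson) rooted at the multiplicity valuation $\nu_{\mathfrak m}(\phi)=\max\{n:\phi\in\mathfrak m^n\}$. For an irreducible formal curve germ $C=\{\psi=0\}$, $\psi\in\mathfrak m$ irreducible, with multiplicity $m(C)=\nu_{\mathfrak m}(\psi)$, the curve valuation is $\nu_C(\phi)=(C\cdot\{\phi=0\})/m(C)$, where $\cdot$ is the intersection multiplicity; it is analytic if $\psi$ may be taken convergent and formal/non-analytic otherwise. Curve valuations are ends (maximal elements) of $\mathcal V$. Action: write $f=(f_1,f_2)$ and $c(f,\nu)=\nu(f^*\mathfrak m)=\min\{\nu(f_1),\nu(f_2)\}$. A contracted critical curve valuation is $\nu_C$ with $C$ an irreducible curve germ such that $f(C)=\{0\}$ (equivalently $c(f,\nu_C)=\infty$); for other $\nu$ set $f_\bullet\nu(\phi)=\nu(\phi\circ f)/c(f,\nu)$, and for contracted critical curve valuations $f_\bullet\nu_C$ is defined as the limit of $f_\bullet\nu$ as $\nu$ increases to $\nu_C$ (it is a divisorial valuation). A fixed valuation is $\nu$ with $f_\bullet\nu=\nu$. An eigenvaluation is a fixed valuation $\nu_\star$ which is either quasimonomial (divisorial or irrational, i.e. a valuation that becomes monomial in suitable local coordinates at a point of some modification) or an end of $\mathcal V$ which is attracting, in the sense that there is $\nu_0<\nu_\star$ such that $f_\bullet$ maps the set $U=\{\nu\in\mathcal V:\nu\wedge\nu_\star>\nu_0\}$ strictly into itself and $f_\bullet^n\nu\to\nu_\star$ for all $\nu\in U$ ($\wedge$ denotes infimum in the tree). *)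

theory Defs
  imports "HOL-Analysis.Analysis" "HOL-Computational_Algebra.Formal_Power_Series"
    "HOL-Computational_Algebra.Factorial_Ring"
begin

text \<open>We model C[[x,y]] as C[[x]][[y]] (canonically isomorphic as rings):
  an element is a power series in y whose coefficients are power series in x.\<close>

type_synonym ps2 = "complex fps fps"

definition cf :: "ps2 \<Rightarrow> nat \<Rightarrow> nat \<Rightarrow> complex" where
  "cf \<phi> i j = fps_nth (fps_nth \<phi> j) i"

definition const2 :: "complex \<Rightarrow> ps2" where
  "const2 c = fps_const (fps_const c)"

definition X2 :: ps2 where "X2 = fps_const fps_X"
definition Y2 :: ps2 where "Y2 = fps_X"

definition mm :: "ps2 set" where
  "mm = {\<phi>. cf \<phi> 0 0 = 0}"

definition convergent2 :: "ps2 \<Rightarrow> bool" where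
  "convergent2 \<phi> \<longleftrightarrow> (\<exists>r>0. (\<lambda>(i,j). norm (cf \<phi> i j) * r ^ (i + j)) summable_on (UNIV :: (nat \<times> nat) set))"

text \<open>Substitution phi(g,h), for g, h in the maximal ideal (coefficient of x^i y^j only
  involves monomials a,b with a+b <= i+j).\<close>
definition pcomp :: "ps2 \<Rightarrow> ps2 \<Rightarrow> ps2 \<Rightarrow> ps2" where
  "pcomp \<phi> g h = Abs_fps (\<lambda>j. Abs_fps (\<lambda>i.
      \<Sum>a\<le>i+j. \<Sum>b\<le>i+j. cf \<phi> a b * cf (g ^ a * h ^ b) i j))"

definition dX :: "ps2 \<Rightarrow> ps2" where
  "dX \<phi> = Abs_fps (\<lambda>j. Abs_fps (\<lambda>i. of_nat (i + 1) * cf \<phi> (i + 1) j))"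
definition dY :: "ps2 \<Rightarrow> ps2" where
  "dY \<phi> = Abs_fps (\<lambda>j. Abs_fps (\<lambda>i. of_nat (j + 1) * cf \<phi> i (j + 1)))"

definition holo_germ :: "ps2 \<Rightarrow> ps2 \<Rightarrow> bool" where
  "holo_germ f1 f2 \<longleftrightarrow> f1 \<in> mm \<and> f2 \<in> mm \<and> convergent2 f1 \<and> convergent2 f2"

definition dominant :: "ps2 \<Rightarrow> ps2 \<Rightarrow> bool" where
  "dominant f1 f2 \<longleftrightarrow> dX f1 * dY f2 - dY f1 * dX f2 \<noteq> 0"

definition jac0 :: "ps2 \<Rightarrow> ps2 \<Rightarrow> complex^2^2" where
  "jac0 f1 f2 = (\<chi> i j. cf (if i = 1 then f1 else f2)
                          (if j = 1 then 1 else 0) (if j = 1 then 0 else 1))"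

definition semi_superattracting :: "ps2 \<Rightarrow> ps2 \<Rightarrow> bool" where
  "semi_superattracting f1 f2 \<longleftrightarrow>
     (\<exists>lam::complex. lam \<noteq> 0 \<and> (\<forall>t. det (mat t - jac0 f1 f2) = t * (t - lam)))"

type_synonym val = "ps2 \<Rightarrow> ennreal"

definition is_valuation :: "val \<Rightarrow> bool" where
  "is_valuation \<nu> \<longleftrightarrow>
     (\<forall>\<phi> \<psi>. \<nu> (\<phi> * \<psi>) = \<nu> \<phi> + \<nu> \<psi>) \<and>
     (\<forall>\<phi> \<psi>. min (\<nu> \<phi>) (\<nu> \<psi>) \<le> \<nu> (\<phi> + \<psi>)) \<and>
     \<nu> 0 = (top::ennreal) \<and>
     (\<forall>c. c \<noteq> 0 \<longrightarrow> \<nu> (const2 c) = 0) \<and>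
     (\<forall>\<phi>\<in>mm. 1 \<le> \<nu> \<phi>) \<and> (\<exists>\<phi>\<in>mm. \<nu> \<phi> = 1)"

definition VT :: "val set" where
  "VT = {\<nu>. is_valuation \<nu>}"

definition vinf :: "val \<Rightarrow> val \<Rightarrow> val" where
  "vinf \<nu> \<mu> = (THE \<rho>. \<rho> \<in> VT \<and> \<rho> \<le> \<nu> \<and> \<rho> \<le> \<mu> \<and>
                    (\<forall>\<sigma>\<in>VT. \<sigma> \<le> \<nu> \<and> \<sigma> \<le> \<mu> \<longrightarrow> \<sigma> \<le> \<rho>))"

definition is_end :: "val \<Rightarrow> bool" where
  "is_end \<nu> \<longleftrightarrow> \<nu> \<in> VT \<and> \<not> (\<exists>\<mu>\<in>VT. \<nu> < \<mu>)"

text \<open>m(C) = max{n. psi in m^n} = lowest total degree of a nonzero monomial.\<close>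
definition mult2 :: "ps2 \<Rightarrow> nat" where
  "mult2 \<psi> = (LEAST n. \<exists>i j. i + j = n \<and> cf \<psi> i j \<noteq> 0)"

definition ideal2 :: "ps2 \<Rightarrow> ps2 \<Rightarrow> ps2 set" where
  "ideal2 \<psi> \<phi> = {a * \<psi> + b * \<phi> | a b. True}"

definition indep_mod :: "ps2 \<Rightarrow> ps2 \<Rightarrow> ps2 list \<Rightarrow> bool" where
  "indep_mod \<psi> \<phi> vs \<longleftrightarrow>
     (\<forall>cs. length cs = length vs \<and>
        (\<Sum>k<length vs. const2 (cs ! k) * vs ! k) \<in> ideal2 \<psi> \<phi> \<longrightarrow>
        (\<forall>k<length cs. cs ! k = 0))"

text \<open>Intersection multiplicity: dim_C of R/(psi,phi) (possibly infinite).\<close>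
definition imult :: "ps2 \<Rightarrow> ps2 \<Rightarrow> ennreal" where
  "imult \<psi> \<phi> = (SUP n \<in> {n. \<exists>vs. length vs = n \<and> indep_mod \<psi> \<phi> vs}. of_nat n)"

definition is_curve :: "ps2 \<Rightarrow> bool" where
  "is_curve \<psi> \<longleftrightarrow> \<psi> \<in> mm \<and> irreducible \<psi>"

definition curve_val :: "ps2 \<Rightarrow> val" where
  "curve_val \<psi> = (\<lambda>\<phi>. imult \<psi> \<phi> / of_nat (mult2 \<psi>))"

definition is_curve_val :: "val \<Rightarrow> bool" where
  "is_curve_val \<nu> \<longleftrightarrow> (\<exists>\<psi>. is_curve \<psi> \<and> \<nu> = curve_val \<psi>)"

definition cfv :: "ps2 \<Rightarrow> ps2 \<Rightarrow> val \<Rightarrow> ennreal" where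
  "cfv f1 f2 \<nu> = min (\<nu> f1) (\<nu> f2)"

definition contracted :: "ps2 \<Rightarrow> ps2 \<Rightarrow> val \<Rightarrow> bool" where
  "contracted f1 f2 \<nu> \<longleftrightarrow> is_curve_val \<nu> \<and> cfv f1 f2 \<nu> = (top::ennreal)"

definition seg_filter :: "val \<Rightarrow> val filter" where
  "seg_filter \<nu>C = (INF \<nu>0 \<in> {\<nu> \<in> VT. \<nu> < \<nu>C}. principal {\<nu> \<in> VT. \<nu>0 \<le> \<nu> \<and> \<nu> < \<nu>C})"

definition fpush0 :: "ps2 \<Rightarrow> ps2 \<Rightarrow> val \<Rightarrow> val" where
  "fpush0 f1 f2 \<nu> = (\<lambda>\<phi>. \<nu> (pcomp \<phi> f1 f2) / cfv f1 f2 \<nu>)"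

definition fpush :: "ps2 \<Rightarrow> ps2 \<Rightarrow> val \<Rightarrow> val" where
  "fpush f1 f2 \<nu> =
     (if cfv f1 f2 \<nu> < (top::ennreal) then fpush0 f1 f2 \<nu>
      else (THE \<mu>. \<forall>\<phi>. ((\<lambda>\<nu>'. fpush0 f1 f2 \<nu>' \<phi>) \<longlongrightarrow> \<mu> \<phi>) (seg_filter \<nu>)))"

definition fixed_val :: "ps2 \<Rightarrow> ps2 \<Rightarrow> val \<Rightarrow> bool" where
  "fixed_val f1 f2 \<nu> \<longleftrightarrow> \<nu> \<in> VT \<and> fpush f1 f2 \<nu> = \<nu>"

text \<open>Local charts at points of modifications (finite compositions of point blow-ups):
  pairs (P,Q) expressing x = P(u,v), y = Q(u,v) in local formal coordinates (u,v)
  at a point of the modification. Generated by formal changes of coordinates and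
  the blow-up chart (u,v) -> (u,uv).\<close>
inductive_set modif :: "(ps2 \<times> ps2) set" where
  modif_id: "(X2, Y2) \<in> modif"
| modif_aut: "(P, Q) \<in> modif \<Longrightarrow> g1 \<in> mm \<Longrightarrow> g2 \<in> mm \<Longrightarrow>
     cf g1 1 0 * cf g2 0 1 - cf g1 0 1 * cf g2 1 0 \<noteq> 0 \<Longrightarrow>
     (pcomp P g1 g2, pcomp Q g1 g2) \<in> modif"
| modif_blow: "(P, Q) \<in> modif \<Longrightarrow>
     (pcomp P X2 (X2 * Y2), pcomp Q X2 (X2 * Y2)) \<in> modif"

definition monoval :: "real \<Rightarrow> real \<Rightarrow> ps2 \<Rightarrow> ennreal" where
  "monoval s t \<psi> = (INF p \<in> {(i, j). cf \<psi> i j \<noteq> 0}.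
                       ennreal (s * real (fst p) + t * real (snd p)))"

definition quasimonomial :: "val \<Rightarrow> bool" where
  "quasimonomial \<nu> \<longleftrightarrow> \<nu> \<in> VT \<and>
     (\<exists>P\<in>modif. \<exists>s t. s \<ge> 0 \<and> t \<ge> 0 \<and> s + t > 0 \<and>
        (\<forall>\<phi>. \<nu> \<phi> = monoval s t (pcomp \<phi> (fst P) (snd P))))"

definition attracting_end :: "ps2 \<Rightarrow> ps2 \<Rightarrow> val \<Rightarrow> bool" where
  "attracting_end f1 f2 \<nu> \<longleftrightarrow> is_end \<nu> \<and>
     (\<exists>\<nu>0\<in>VT. \<nu>0 < \<nu> \<and>
        (let U = {\<mu> \<in> VT. \<nu>0 < vinf \<mu> \<nu>} in
          fpush f1 f2 ` U \<subset> U \<and>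
          (\<forall>\<mu>\<in>U. \<forall>\<phi>. ((\<lambda>n. (fpush f1 f2 ^^ n) \<mu> \<phi>) \<longlongrightarrow> \<nu> \<phi>) sequentially)))"

definition eigenval :: "ps2 \<Rightarrow> ps2 \<Rightarrow> val \<Rightarrow> bool" where
  "eigenval f1 f2 \<nu> \<longleftrightarrow> fixed_val f1 f2 \<nu> \<and> (quasimonomial \<nu> \<or> attracting_end f1 f2 \<nu>)"

end

theory Submission
  imports Defs "HOL-Computational_Algebra.Fundamental_Theorem_Algebra"
begin

text \<open>
  A semi-superattracting germ has two formal invariant smooth curves, \<open>\<beta> = 0\<close> tangent to the
  \<open>\<lambda>\<close>-eigenvector and \<open>\<alpha> = 0\<close> transverse to it; both are fixed points of contractions of
  \<open>\<complex>[[x,y]]\<close>. In the formal coordinates \<open>(\<alpha>, \<beta>)\<close> the germ reads \<open>\<alpha> \<mapsto> \<alpha> u\<close>, \<open>\<beta> \<mapsto> \<beta> w\<close> with \<open>u\<close> a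
  unit and \<open>w\<close> a non-unit. Hence \<open>c(f, \<nu>) = min (\<nu> \<alpha>) (\<nu> \<beta> + \<nu> w)\<close>, and comparing the values at
  \<open>\<alpha>\<close> and \<open>\<beta>\<close> shows that a fixed valuation is infinite at one of them, which determines it.
  The valuation of \<open>\<beta>\<close> is always fixed and attracts \<open>{\<nu>. \<nu> \<beta> > 1}\<close>, since each step raises
  \<open>\<nu> \<beta>\<close> by at least \<open>1\<close>. The valuation of \<open>\<alpha>\<close> is contracted if \<open>\<alpha>\<close> divides \<open>w\<close> and is fixed
  and not attracting otherwise. The infimum of a valuation \<open>\<mu>\<close> with the valuation of \<open>\<beta>\<close> is the
  monomial valuation of weights \<open>(1, \<mu> \<beta>)\<close>, because the monomial valuations are the only ones
  below a smooth curve valuation.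
\<close>

subsection \<open>Coefficients\<close>

text \<open>The two curves are in general only formal, so every change of coordinates lives in the
  power series ring, with limits taken for the filtration \<open>mpow\<close>. A fixed
  \<open>\<nu>\<close> satisfies \<open>\<nu> \<alpha> = \<nu> \<alpha> / c\<close>, so
  \<open>\<nu> \<alpha>\<close> is infinite or \<open>c = 1\<close>; in the second case
  \<open>\<nu> \<beta> = \<nu> \<beta> + \<nu> w\<close> with \<open>\<nu> w\<close> at least 1
  leaves only \<open>\<nu> \<beta> = top\<close>. An infinite value determines \<open>\<nu>\<close>
  because a series not divisible by one coordinate is, modulo it, a power of the other times a unit.
  The curve valuation of \<open>\<alpha>\<close> cannot attract, since division by \<open>c\<close>,
  which is at least 1, never raises the value at \<open>\<alpha>\<close>. The main obstacle is
  \<open>vinf\<close>, a definite description over all valuations: the greatest lower bound must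
  beat arbitrary competitors, not only monomial ones. The upper bound for such competitors is where
  algebraic closedness enters, through the splitting of binary forms. The same classification turns
  the limit in \<open>fpush\<close> at a contracted curve into a limit in one real
  parameter.\<close>

lemma ps2_eqI: "(\<And>i j. cf \<phi> i j = cf \<psi> i j) \<Longrightarrow> \<phi> = \<psi>"
  by (auto simp: cf_def fps_eq_iff)

lemma cf_zero [simp]: "cf 0 i j = 0"
  and cf_add [simp]: "cf (\<phi> + \<psi>) i j = cf \<phi> i j + cf \<psi> i j"
  and cf_diff [simp]: "cf (\<phi> - \<psi>) i j = cf \<phi> i j - cf \<psi> i j"
  and cf_uminus [simp]: "cf (- \<phi>) i j = - cf \<phi> i j"
  by (simp_all add: cf_def)

lemma cf_sum [simp]: "cf (sum F A) i j = (\<Sum>x\<in>A. cf (F x) i j)"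
  by (induction A rule: infinite_finite_induct) auto

lemma cf_mult: "cf (\<phi> * \<psi>) i j = (\<Sum>p\<le>i. \<Sum>q\<le>j. cf \<phi> p q * cf \<psi> (i - p) (j - q))"
  unfolding cf_def
  by (simp add: fps_mult_nth fps_sum_nth atMost_atLeast0, rule sum.swap)

lemma cf_const2 [simp]: "cf (const2 c) i j = (if i = 0 \<and> j = 0 then c else 0)"
  by (auto simp: cf_def const2_def)

lemma const2_0 [simp]: "const2 0 = 0"
  and const2_1 [simp]: "const2 1 = 1"
  by (simp_all add: const2_def)

lemma const2_mult: "const2 (a * b) = const2 a * const2 b"
  by (simp add: const2_def)

lemma const2_diff: "const2 (a - b) = const2 a - const2 b"
  by (rule ps2_eqI) auto

lemma cf_1: "cf 1 i j = (if i = 0 \<and> j = 0 then 1 else 0)"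
  using cf_const2[of 1 i j] by simp

lemma cf_const2_mult [simp]: "cf (const2 c * \<phi>) i j = c * cf \<phi> i j"
  by (simp add: cf_def const2_def)

lemma cf_X2_mult: "cf (X2 * \<phi>) i j = (if i = 0 then 0 else cf \<phi> (i - 1) j)"
  by (simp add: cf_def X2_def)

lemma cf_Y2_mult: "cf (Y2 * \<phi>) i j = (if j = 0 then 0 else cf \<phi> i (j - 1))"
  by (simp add: cf_def Y2_def)

lemma cf_X2_power_mult: "cf (X2 ^ n * \<phi>) i j = (if i < n then 0 else cf \<phi> (i - n) j)"
  by (induction n arbitrary: i) (auto simp: cf_X2_mult mult.assoc)

lemma cf_Y2_power_mult: "cf (Y2 ^ n * \<phi>) i j = (if j < n then 0 else cf \<phi> i (j - n))"
  by (induction n arbitrary: j) (auto simp: cf_Y2_mult mult.assoc)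

lemma cf_monomial: "cf (X2 ^ a * Y2 ^ b) i j = (if i = a \<and> j = b then 1 else 0)"
proof -
  have "cf (X2 ^ a * (Y2 ^ b * 1)) i j = (if i = a \<and> j = b then 1 else 0)"
    unfolding cf_X2_power_mult cf_Y2_power_mult cf_1 by auto
  thus ?thesis by simp
qed

lemma cf_X2: "cf X2 i j = (if i = 1 \<and> j = 0 then 1 else 0)"
  and cf_Y2: "cf Y2 i j = (if i = 0 \<and> j = 1 then 1 else 0)"
  using cf_monomial[of 1 0 i j] cf_monomial[of 0 1 i j] by simp_all

subsection \<open>Powers of the maximal ideal\<close>

text \<open>The powers of the maximal ideal, encoded by vanishing coefficients so that orders can be
  checked degree by degree.\<close>

definition mpow :: "nat \<Rightarrow> ps2 set" where
  "mpow n = {\<phi>. \<forall>i j. i + j < n \<longrightarrow> cf \<phi> i j = 0}"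

lemma mm_eq_mpow: "mm = mpow 1"
  by (auto simp: mm_def mpow_def)

lemma mpow_antimono: "m \<le> n \<Longrightarrow> mpow n \<subseteq> mpow m"
  by (auto simp: mpow_def)

lemma mpow_mono: "\<phi> \<in> mpow n \<Longrightarrow> m \<le> n \<Longrightarrow> \<phi> \<in> mpow m"
  using mpow_antimono by blast

lemma mem_mpow_0 [simp]: "\<phi> \<in> mpow 0"
  by (simp add: mpow_def)

lemma mpow_zero [simp]: "0 \<in> mpow n"
  and mpow_add: "\<phi> \<in> mpow n \<Longrightarrow> \<psi> \<in> mpow n \<Longrightarrow> \<phi> + \<psi> \<in> mpow n"
  and mpow_diff: "\<phi> \<in> mpow n \<Longrightarrow> \<psi> \<in> mpow n \<Longrightarrow> \<phi> - \<psi> \<in> mpow n"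
  and mpow_uminus: "\<phi> \<in> mpow n \<Longrightarrow> - \<phi> \<in> mpow n"
  and mpow_const2_mult: "\<phi> \<in> mpow n \<Longrightarrow> const2 c * \<phi> \<in> mpow n"
  by (auto simp: mpow_def)

lemma mpow_mult:
  assumes "\<phi> \<in> mpow m" "\<psi> \<in> mpow n"
  shows "\<phi> * \<psi> \<in> mpow (m + n)"
  unfolding mpow_def
proof (intro CollectI allI impI)
  fix i j :: nat
  assume ij: "i + j < m + n"
  have "cf \<phi> p q * cf \<psi> (i - p) (j - q) = 0" if "p \<le> i" "q \<le> j" for p q
  proof (cases "p + q < m")
    case True
    thus ?thesis using assms by (simp add: mpow_def)
  next
    case False
    hence "(i - p) + (j - q) < n" using ij that by linarith
    thus ?thesis using assms by (simp add: mpow_def)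
  qed
  thus "cf (\<phi> * \<psi>) i j = 0"
    unfolding cf_mult by (intro sum.neutral ballI) auto
qed

lemma mpow_mult_left: "\<psi> \<in> mpow n \<Longrightarrow> \<phi> * \<psi> \<in> mpow n"
  using mpow_mult[of \<phi> 0 \<psi> n] by simp

lemma mpow_mult_right: "\<psi> \<in> mpow n \<Longrightarrow> \<psi> * \<phi> \<in> mpow n"
  using mpow_mult_left[of \<psi> n \<phi>] by (simp add: mult.commute)

lemma mpow_power: "\<phi> \<in> mm \<Longrightarrow> \<phi> ^ n \<in> mpow n"
proof (induction n)
  case (Suc n)
  thus ?case using mpow_mult[of \<phi> 1 "\<phi> ^ n" n] by (simp add: mm_eq_mpow)
qed simp

lemma mpow_power_mult: "g \<in> mm \<Longrightarrow> h \<in> mm \<Longrightarrow> g ^ a * h ^ b \<in> mpow (a + b)"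
  by (intro mpow_mult mpow_power)

lemma mm_X2 [simp]: "X2 \<in> mm" and mm_Y2 [simp]: "Y2 \<in> mm"
  by (auto simp: mm_def cf_X2 cf_Y2)

text \<open>The filtration is separated. Identities between series can therefore be proved modulo
  each \<open>mpow n\<close>, where polynomials may replace series.\<close>

lemma mpow_imp_eq:
  assumes "\<And>n. \<phi> - \<psi> \<in> mpow n"
  shows "\<phi> = \<psi>"
proof (rule ps2_eqI)
  fix i j
  show "cf \<phi> i j = cf \<psi> i j"
    using assms[of "Suc (i + j)"] by (auto simp: mpow_def)
qed

lemma mpow_trans: "\<phi> - \<psi> \<in> mpow n \<Longrightarrow> \<psi> - \<rho> \<in> mpow n \<Longrightarrow> \<phi> - \<rho> \<in> mpow n"
  using mpow_add[of "\<phi> - \<psi>" n "\<psi> - \<rho>"] by simp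

lemma mpow_sym: "\<phi> - \<psi> \<in> mpow n \<Longrightarrow> \<psi> - \<phi> \<in> mpow n"
  using mpow_uminus[of "\<phi> - \<psi>" n] by simp

lemma mpow_mult_cong:
  assumes "\<phi> - \<phi>' \<in> mpow n" "\<psi> - \<psi>' \<in> mpow n"
  shows "\<phi> * \<psi> - \<phi>' * \<psi>' \<in> mpow n"
proof -
  have "\<phi> * \<psi> - \<phi>' * \<psi>' = (\<phi> - \<phi>') * \<psi> + \<phi>' * (\<psi> - \<psi>')"
    by (simp add: algebra_simps)
  thus ?thesis using assms by (auto intro: mpow_add mpow_mult_left mpow_mult_right)
qed

text \<open>Telescoping replaces one factor of order 1 by a difference of order \<open>r\<close>,
  which accounts for \<open>m - 1 + r\<close>. For \<open>m = 2\<close> one order is gained; all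
  contraction estimates below rest on this gain.\<close>

lemma mpow_monomial_diff:
  assumes "g \<in> mm" "g' \<in> mm" "h \<in> mm" "h' \<in> mm"
    and "g - g' \<in> mpow r" "h - h' \<in> mpow r" and "m \<le> a + b" "r \<ge> 1"
  shows "g ^ a * h ^ b - g' ^ a * h' ^ b \<in> mpow (m - 1 + r)"
proof -
  have pw: "p ^ a - p' ^ a \<in> mpow (a - 1 + r)"
    if "p \<in> mm" "p' \<in> mm" "p - p' \<in> mpow r" for p p' and a :: nat
  proof (induction a)
    case (Suc a)
    have e: "p ^ Suc a - p' ^ Suc a = (p - p') * p ^ a + p' * (p ^ a - p' ^ a)"
      by (simp add: algebra_simps)
    have 1: "(p - p') * p ^ a \<in> mpow (r + a)"
      using that by (intro mpow_mult mpow_power)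
    have 2: "p' * (p ^ a - p' ^ a) \<in> mpow (r + a)"
    proof (cases a)
      case (Suc b)
      show ?thesis using mpow_mult[OF that(2)[unfolded mm_eq_mpow] Suc.IH] Suc by (auto simp: ac_simps)
    qed simp
    show ?case unfolding e using mpow_add[OF 1 2] by (simp add: add.commute)
  qed simp
  have e: "g ^ a * h ^ b - g' ^ a * h' ^ b = (g ^ a - g' ^ a) * h ^ b + g' ^ a * (h ^ b - h' ^ b)"
    by (simp add: algebra_simps)
  have 1: "(g ^ a - g' ^ a) * h ^ b \<in> mpow (m - 1 + r)"
  proof (cases a)
    case (Suc k)
    show ?thesis
      using mpow_mult[OF pw[of g g' a] mpow_power[of h b]] assms Suc
      by (auto intro: mpow_mono)
  qed simp
  have 2: "g' ^ a * (h ^ b - h' ^ b) \<in> mpow (m - 1 + r)"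
  proof (cases b)
    case (Suc k)
    show ?thesis
      using mpow_mult[OF mpow_power[of g' a] pw[of h h' b]] assms Suc
      by (auto intro: mpow_mono)
  qed simp
  show ?thesis unfolding e by (rule mpow_add[OF 1 2])
qed

subsection \<open>Substitution\<close>

lemma cf_pcomp: "cf (pcomp \<phi> g h) i j = (\<Sum>a\<le>i+j. \<Sum>b\<le>i+j. cf \<phi> a b * cf (g ^ a * h ^ b) i j)"
  by (simp add: pcomp_def cf_def)

lemma pcomp_add: "pcomp (\<phi> + \<psi>) g h = pcomp \<phi> g h + pcomp \<psi> g h"
  by (rule ps2_eqI) (simp add: cf_pcomp algebra_simps sum.distrib)

lemma pcomp_uminus: "pcomp (- \<phi>) g h = - pcomp \<phi> g h"
  by (rule ps2_eqI) (simp add: cf_pcomp sum_negf)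

lemma pcomp_diff: "pcomp (\<phi> - \<psi>) g h = pcomp \<phi> g h - pcomp \<psi> g h"
  using pcomp_add[of \<phi> "- \<psi>" g h] by (simp add: pcomp_uminus)

lemma pcomp_0 [simp]: "pcomp 0 g h = 0"
  by (rule ps2_eqI) (simp add: cf_pcomp)

lemma pcomp_sum: "pcomp (sum F A) g h = (\<Sum>x\<in>A. pcomp (F x) g h)"
  by (induction A rule: infinite_finite_induct) (auto simp: pcomp_add)

lemma pcomp_const2_mult_left: "pcomp (const2 c * \<phi>) g h = const2 c * pcomp \<phi> g h"
  by (rule ps2_eqI) (simp add: cf_pcomp sum_distrib_left mult.assoc)

lemma pcomp_monomial:
  assumes "g \<in> mm" "h \<in> mm"
  shows "pcomp (X2 ^ a * Y2 ^ b) g h = g ^ a * h ^ b"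
proof (rule ps2_eqI)
  fix i j
  have "cf (pcomp (X2 ^ a * Y2 ^ b) g h) i j =
      (\<Sum>a'\<le>i+j. \<Sum>b'\<le>i+j. if a' = a \<and> b' = b then cf (g ^ a * h ^ b) i j else 0)"
    unfolding cf_pcomp cf_monomial by (intro sum.cong) auto
  also have "\<dots> = (\<Sum>a'\<le>i+j. if a' = a then (if b \<le> i + j then cf (g ^ a * h ^ b) i j else 0) else 0)"
    by (intro sum.cong) auto
  also have "\<dots> = (if a \<le> i + j \<and> b \<le> i + j then cf (g ^ a * h ^ b) i j else 0)"
    by auto
  \<comment> \<open>The cutoffs in \<open>pcomp\<close> lose nothing: a power of total degree above
    \<open>i + j\<close> has no coefficient at \<open>(i, j)\<close>.\<close>
  also have "\<dots> = cf (g ^ a * h ^ b) i j"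
    using mpow_power_mult[OF assms, of a b] by (auto simp: mpow_def)
  finally show "cf (pcomp (X2 ^ a * Y2 ^ b) g h) i j = cf (g ^ a * h ^ b) i j" .
qed

lemma pcomp_mpow:
  assumes "g \<in> mm" "h \<in> mm" "\<phi> \<in> mpow n"
  shows "pcomp \<phi> g h \<in> mpow n"
  unfolding mpow_def
proof (intro CollectI allI impI)
  fix i j :: nat
  assume ij: "i + j < n"
  have "cf \<phi> a b * cf (g ^ a * h ^ b) i j = 0" for a b
  proof (cases "a + b < n")
    case True
    thus ?thesis using assms(3) by (auto simp: mpow_def)
  next
    case False
    thus ?thesis using mpow_power_mult[OF assms(1,2), of a b] ij by (auto simp: mpow_def)
  qed
  thus "cf (pcomp \<phi> g h) i j = 0" unfolding cf_pcomp by (intro sum.neutral ballI)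
qed

lemma pcomp_mm: "g \<in> mm \<Longrightarrow> h \<in> mm \<Longrightarrow> \<phi> \<in> mm \<Longrightarrow> pcomp \<phi> g h \<in> mm"
  using pcomp_mpow[of g h \<phi> 1] by (simp add: mm_eq_mpow)

text \<open>Substitution is Lipschitz for the filtration and gains \<open>m - 1\<close> orders when
  the outer series has order \<open>m\<close>. The case \<open>m = 1\<close> only preserves
  closeness, \<open>m = 2\<close> contracts.\<close>

lemma pcomp_cong_mpow:
  assumes "g \<in> mm" "g' \<in> mm" "h \<in> mm" "h' \<in> mm"
    and "g - g' \<in> mpow r" "h - h' \<in> mpow r" and "\<phi> \<in> mpow m" "r \<ge> 1"
  shows "pcomp \<phi> g h - pcomp \<phi> g' h' \<in> mpow (m - 1 + r)"
  unfolding mpow_def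
proof (intro CollectI allI impI)
  fix i j :: nat
  assume ij: "i + j < m - 1 + r"
  have z: "cf \<phi> a b * cf (g ^ a * h ^ b) i j = cf \<phi> a b * cf (g' ^ a * h' ^ b) i j" for a b
  proof (cases "a + b < m")
    case True
    thus ?thesis using assms(7) by (auto simp: mpow_def)
  next
    case False
    hence "g ^ a * h ^ b - g' ^ a * h' ^ b \<in> mpow (m - 1 + r)"
      using mpow_monomial_diff[of g g' h h' r m a b] assms by auto
    thus ?thesis using ij by (auto simp: mpow_def)
  qed
  show "cf (pcomp \<phi> g h - pcomp \<phi> g' h') i j = 0" by (simp add: cf_pcomp z)
qed

section \<open>Polynomial truncation; substitution as a ring homomorphism\<close>

definition trunc2 :: "nat \<Rightarrow> ps2 \<Rightarrow> ps2" where
  "trunc2 n \<phi> = (\<Sum>a<n. \<Sum>b<n. const2 (cf \<phi> a b) * (X2 ^ a * Y2 ^ b))"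

lemma cf_trunc2: "cf (trunc2 n \<phi>) i j = (if i < n \<and> j < n then cf \<phi> i j else 0)"
proof -
  have "cf (trunc2 n \<phi>) i j = (\<Sum>a<n. \<Sum>b<n. if a = i \<and> b = j then cf \<phi> i j else 0)"
    unfolding trunc2_def cf_sum cf_const2_mult cf_monomial by (intro sum.cong) auto
  also have "\<dots> = (\<Sum>a<n. if a = i then (if j < n then cf \<phi> i j else 0) else 0)"
    by (intro sum.cong) auto
  also have "\<dots> = (if i < n \<and> j < n then cf \<phi> i j else 0)" by auto
  finally show ?thesis .
qed

text \<open>The truncation keeps a square of exponents, so that it is a plain double sum; every
  exponent outside the square still has total degree at least \<open>n\<close>.\<close>

lemma trunc2_mpow: "\<phi> - trunc2 n \<phi> \<in> mpow n"
  by (auto simp: mpow_def cf_trunc2)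

lemma pcomp_trunc2_mpow:
  assumes "g \<in> mm" "h \<in> mm"
  shows "pcomp \<phi> g h - pcomp (trunc2 n \<phi>) g h \<in> mpow n"
  using pcomp_mpow[OF assms trunc2_mpow, of \<phi> n] by (simp add: pcomp_diff)

lemma pcomp_trunc2:
  assumes "g \<in> mm" "h \<in> mm"
  shows "pcomp (trunc2 n \<phi>) g h = (\<Sum>a<n. \<Sum>b<n. const2 (cf \<phi> a b) * (g ^ a * h ^ b))"
  unfolding trunc2_def pcomp_sum pcomp_const2_mult_left pcomp_monomial[OF assms] ..

text \<open>Multiplicativity is immediate on monomials and extends bilinearly to truncations; both
  sides differ from their truncated versions by an element of \<open>mpow n\<close>.\<close>

lemma pcomp_mult:
  assumes "g \<in> mm" "h \<in> mm"
  shows "pcomp (\<phi> * \<psi>) g h = pcomp \<phi> g h * pcomp \<psi> g h"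
proof (rule mpow_imp_eq)
  fix n
  have mono: "pcomp (const2 c * (X2 ^ a * Y2 ^ b) * (const2 d * (X2 ^ k * Y2 ^ l))) g h =
      const2 c * (g ^ a * h ^ b) * (const2 d * (g ^ k * h ^ l))" for c d a b k l
  proof -
    have e: "const2 c * (X2 ^ a * Y2 ^ b) * (const2 d * (X2 ^ k * Y2 ^ l)) =
        const2 (c * d) * (X2 ^ (a + k) * Y2 ^ (b + l))"
      by (simp add: const2_mult power_add)
    show ?thesis
      unfolding e pcomp_const2_mult_left pcomp_monomial[OF assms]
      by (simp add: const2_mult power_add)
  qed
  have tr: "pcomp (trunc2 n \<phi> * trunc2 n \<psi>) g h =
      pcomp (trunc2 n \<phi>) g h * pcomp (trunc2 n \<psi>) g h"
    unfolding pcomp_trunc2[OF assms] unfolding trunc2_def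
    by (simp only: sum_product sum_distrib_left sum_distrib_right pcomp_sum mono)
  have "\<phi> * \<psi> - trunc2 n \<phi> * trunc2 n \<psi> \<in> mpow n"
    by (intro mpow_mult_cong trunc2_mpow)
  hence 1: "pcomp (\<phi> * \<psi>) g h - pcomp (trunc2 n \<phi> * trunc2 n \<psi>) g h \<in> mpow n"
    using pcomp_mpow[OF assms] by (simp add: pcomp_diff[symmetric])
  have 2: "pcomp \<phi> g h * pcomp \<psi> g h - pcomp (trunc2 n \<phi>) g h * pcomp (trunc2 n \<psi>) g h \<in> mpow n"
    by (intro mpow_mult_cong pcomp_trunc2_mpow assms)
  show "pcomp (\<phi> * \<psi>) g h - pcomp \<phi> g h * pcomp \<psi> g h \<in> mpow n"
    using mpow_trans[OF 1[unfolded tr] mpow_sym[OF 2]] .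
qed

lemma pcomp_const2:
  assumes "g \<in> mm" "h \<in> mm"
  shows "pcomp (const2 c) g h = const2 c"
  using pcomp_const2_mult_left[of c "X2 ^ 0 * Y2 ^ 0" g h] pcomp_monomial[OF assms, of 0 0] by simp

lemma pcomp_1:
  assumes "g \<in> mm" "h \<in> mm"
  shows "pcomp 1 g h = 1"
  using pcomp_const2[OF assms, of 1] by simp

lemma pcomp_X2: "g \<in> mm \<Longrightarrow> h \<in> mm \<Longrightarrow> pcomp X2 g h = g"
  and pcomp_Y2: "g \<in> mm \<Longrightarrow> h \<in> mm \<Longrightarrow> pcomp Y2 g h = h"
  using pcomp_monomial[of g h 1 0] pcomp_monomial[of g h 0 1] by simp_all

lemma pcomp_power:
  assumes "g \<in> mm" "h \<in> mm"
  shows "pcomp (\<phi> ^ n) g h = pcomp \<phi> g h ^ n"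
  by (induction n) (simp_all add: pcomp_1[OF assms] pcomp_mult[OF assms])

lemma pcomp_id: "pcomp \<phi> X2 Y2 = \<phi>"
proof (rule mpow_imp_eq)
  fix n
  have "pcomp (trunc2 n \<phi>) X2 Y2 = trunc2 n \<phi>"
    by (simp add: pcomp_trunc2) (simp add: trunc2_def)
  thus "pcomp \<phi> X2 Y2 - \<phi> \<in> mpow n"
    using mpow_trans[OF pcomp_trunc2_mpow[OF mm_X2 mm_Y2, of \<phi> n]] mpow_sym[OF trunc2_mpow[of \<phi> n]]
    by simp
qed

lemma pcomp_assoc:
  assumes "g \<in> mm" "h \<in> mm" "p \<in> mm" "q \<in> mm"
  shows "pcomp (pcomp \<phi> g h) p q = pcomp \<phi> (pcomp g p q) (pcomp h p q)"
proof (rule mpow_imp_eq)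
  fix n
  have m: "pcomp g p q \<in> mm" "pcomp h p q \<in> mm"
    using assms by (auto intro: pcomp_mm)
  have 1: "pcomp (pcomp \<phi> g h) p q - pcomp (pcomp (trunc2 n \<phi>) g h) p q \<in> mpow n"
    using pcomp_mpow[OF assms(3,4) pcomp_trunc2_mpow[OF assms(1,2)]] by (simp add: pcomp_diff)
  have 2: "pcomp (pcomp (trunc2 n \<phi>) g h) p q = pcomp (trunc2 n \<phi>) (pcomp g p q) (pcomp h p q)"
    by (simp add: pcomp_trunc2 assms m pcomp_sum pcomp_const2_mult_left pcomp_mult pcomp_power)
  show "pcomp (pcomp \<phi> g h) p q - pcomp \<phi> (pcomp g p q) (pcomp h p q) \<in> mpow n"
    using mpow_trans[OF 1[unfolded 2] mpow_sym[OF pcomp_trunc2_mpow[OF m]]] .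
qed

section \<open>Fixed points of contractions for the filtration\<close>

lemma mm_0 [simp]: "0 \<in> mm"
  by (simp add: mm_def)

lemma mpow2_mm: "\<phi> \<in> mpow 2 \<Longrightarrow> \<phi> \<in> mm"
  unfolding mm_eq_mpow by (erule mpow_mono) simp

lemma pcomp_zero_zero:
  assumes "\<phi> \<in> mm"
  shows "pcomp \<phi> 0 0 = 0"
proof (rule ps2_eqI)
  fix i j
  have "cf \<phi> a b * cf (0 ^ a * 0 ^ b) i j = 0" for a b
    using assms by (cases "a = 0 \<and> b = 0") (auto simp: mm_def power_0_left)
  thus "cf (pcomp \<phi> 0 0) i j = cf 0 i j" unfolding cf_pcomp by (auto intro!: sum.neutral)
qed

text \<open>Banach's argument in the complete ultrametric given by \<open>mpow\<close>. The index
  type allows systems: \<open>bool\<close> serves for the pair of series in an inverse map,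
  \<open>unit\<close> for a single curve.\<close>

lemma mpow_fixpoint:
  fixes \<Phi> :: "('i \<Rightarrow> ps2) \<Rightarrow> 'i \<Rightarrow> ps2"
  assumes self: "\<And>z t. (\<forall>s. z s \<in> mpow m) \<Longrightarrow> \<Phi> z t \<in> mpow m"
    and contr: "\<And>z z' n t. (\<forall>s. z s \<in> mpow m) \<Longrightarrow> (\<forall>s. z' s \<in> mpow m) \<Longrightarrow> m \<le> n \<Longrightarrow>
      (\<forall>s. z s - z' s \<in> mpow n) \<Longrightarrow> \<Phi> z t - \<Phi> z' t \<in> mpow (Suc n)"
  shows "\<exists>z. (\<forall>s. z s \<in> mpow m) \<and> \<Phi> z = z"
proof -
  define Z where "Z n = (\<Phi> ^^ n) (\<lambda>_. 0)" for n
  have Z_Suc: "Z (Suc n) = \<Phi> (Z n)" for n by (simp add: Z_def)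
  have Zm: "\<forall>s. Z n s \<in> mpow m" for n
    by (induction n) (auto simp: Z_Suc self, simp add: Z_def)
  have step: "\<forall>s. Z n s - Z (Suc n) s \<in> mpow (m + n)" for n
  proof (induction n)
    case 0
    show ?case using mpow_diff Zm by simp
  next
    case (Suc n)
    have "\<Phi> (Z n) s - \<Phi> (Z (Suc n)) s \<in> mpow (Suc (m + n))" for s
      using contr[OF Zm Zm _ Suc] by simp
    thus ?case by (simp add: Z_Suc)
  qed
  have cauchy: "Z n s - Z (n + k) s \<in> mpow (m + n)" for n k s
  proof (induction k)
    case (Suc k)
    have "Z (n + k) s - Z (n + Suc k) s \<in> mpow (m + n)"
      using step[of "n + k"] by (auto intro: mpow_mono)
    thus ?case using Suc mpow_trans by blast
  qed simp
  \<comment> \<open>The coefficient at \<open>(i, j)\<close> no longer changes from iterate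
    \<open>i + j + 1\<close> on, so the limit can be read off there.\<close>
  define z where "z s = Abs_fps (\<lambda>j. Abs_fps (\<lambda>i. cf (Z (Suc (i + j)) s) i j))" for s
  have cfz: "cf (z s) i j = cf (Z (Suc (i + j)) s) i j" for s i j
    by (simp add: z_def cf_def)
  have lim: "z s - Z n s \<in> mpow (m + n)" for s n
    unfolding mpow_def
  proof (intro CollectI allI impI)
    fix i j :: nat assume ij: "i + j < m + n"
    show "cf (z s - Z n s) i j = 0"
    proof (cases "Suc (i + j) \<le> n")
      case True
      then obtain k where "n = Suc (i + j) + k" using le_iff_add by blast
      thus ?thesis using cauchy[of "Suc (i + j)" s k] by (auto simp: mpow_def cfz)
    next
      case False
      then obtain k where k: "Suc (i + j) = n + k" using le_iff_add by (meson nat_le_linear)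
      have "cf (Z n s - Z (Suc (i + j)) s) i j = 0"
        using cauchy[of n s k] ij unfolding k mpow_def by blast
      thus ?thesis by (simp add: cfz)
    qed
  qed
  have zm: "\<forall>s. z s \<in> mpow m"
  proof
    fix s
    have "z s - Z 0 s \<in> mpow m" using lim[of s 0] by simp
    from mpow_add[OF this Zm[rule_format, of 0 s]] show "z s \<in> mpow m" by simp
  qed
  have "\<Phi> z = z"
  proof
    fix s
    show "\<Phi> z s = z s"
    proof (rule mpow_imp_eq)
      fix n
      have "\<Phi> z s - \<Phi> (Z n) s \<in> mpow (Suc (m + n))"
        using contr[OF zm Zm, of "m + n"] lim by simp
      hence 1: "\<Phi> z s - Z (Suc n) s \<in> mpow n"
        by (auto simp: Z_Suc intro: mpow_mono)
      have 2: "z s - Z (Suc n) s \<in> mpow n" using lim[of s "Suc n"] by (auto intro: mpow_mono)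
      show "\<Phi> z s - z s \<in> mpow n" using mpow_trans[OF 1 mpow_sym[OF 2]] .
    qed
  qed
  thus ?thesis using zm by blast
qed

subsection \<open>Formal coordinates\<close>

definition coords :: "ps2 \<Rightarrow> ps2 \<Rightarrow> bool" where
  "coords a b \<longleftrightarrow> a \<in> mm \<and> b \<in> mm \<and> cf a 1 0 * cf b 0 1 - cf a 0 1 * cf b 1 0 \<noteq> 0"

lemma coords_mm: "coords a b \<Longrightarrow> a \<in> mm" "coords a b \<Longrightarrow> b \<in> mm"
  by (auto simp: coords_def)

lemma coords_swap: "coords a b \<Longrightarrow> coords b a"
  by (auto simp: coords_def algebra_simps)

text \<open>Formal inverse function theorem. With \<open>N\<close> and \<open>M\<close> the parts of
  order 2, Cramer's rule rewrites the two equations as a fixed point problem for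
  \<open>(p, q)\<close>, and \<open>N\<close>, \<open>M\<close> make it contracting.\<close>

lemma coords_right_inverse:
  assumes "coords a b"
  shows "\<exists>p q. coords p q \<and> pcomp a p q = X2 \<and> pcomp b p q = Y2"
proof -
  define a1 a2 b1 b2 where "a1 = cf a 1 0" and "a2 = cf a 0 1" and "b1 = cf b 1 0" and "b2 = cf b 0 1"
  define d where "d = a1 * b2 - a2 * b1"
  have d: "d \<noteq> 0" using assms by (simp add: coords_def d_def a1_def a2_def b1_def b2_def)
  define N M where "N = a - (const2 a1 * X2 + const2 a2 * Y2)" and
    "M = b - (const2 b1 * X2 + const2 b2 * Y2)"
  have eq2: "i + j < 2 \<longleftrightarrow> (i = 0 \<and> j = 0 \<or> i = 1 \<and> j = 0 \<or> i = 0 \<and> j = 1)" for i j :: nat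
    by auto
  have NM: "N \<in> mpow 2" "M \<in> mpow 2"
    using assms
    by (auto simp: mpow_def eq2 N_def M_def cf_X2 cf_Y2 coords_def mm_def a1_def a2_def b1_def b2_def)
  define \<Phi> where "\<Phi> z t = (if t
      then const2 (1 / d) * (const2 b2 * (X2 - pcomp N (z True) (z False)) -
             const2 a2 * (Y2 - pcomp M (z True) (z False)))
      else const2 (1 / d) * (const2 a1 * (Y2 - pcomp M (z True) (z False)) -
             const2 b1 * (X2 - pcomp N (z True) (z False))))" for z :: "bool \<Rightarrow> ps2" and t
  have XY: "X2 \<in> mpow 1" "Y2 \<in> mpow 1"
    using mm_X2 mm_Y2 by (simp_all only: mm_eq_mpow)
  have "\<exists>z. (\<forall>s. z s \<in> mpow 1) \<and> \<Phi> z = z"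
  proof (rule mpow_fixpoint)
    fix z :: "bool \<Rightarrow> ps2" and t
    assume "\<forall>s. z s \<in> mpow 1"
    hence z: "z s \<in> mm" for s by (simp add: mm_eq_mpow)
    have "pcomp N (z True) (z False) \<in> mpow 1" "pcomp M (z True) (z False) \<in> mpow 1"
      using mpow2_mm[OF pcomp_mpow[OF z z NM(1)]] mpow2_mm[OF pcomp_mpow[OF z z NM(2)]]
      by (simp_all only: mm_eq_mpow)
    thus "\<Phi> z t \<in> mpow 1"
      unfolding \<Phi>_def using XY by (auto intro!: mpow_diff mpow_const2_mult simp del: One_nat_def)
  next
    fix z z' :: "bool \<Rightarrow> ps2" and n t
    assume "\<forall>s. z s \<in> mpow 1" "\<forall>s. z' s \<in> mpow 1" and n: "1 \<le> n" and zz: "\<forall>s. z s - z' s \<in> mpow n"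
    hence z: "z s \<in> mm" "z' s \<in> mm" for s by (simp_all add: mm_eq_mpow)
    have D: "pcomp K (z True) (z False) - pcomp K (z' True) (z' False) \<in> mpow (Suc n)"
      if "K \<in> mpow 2" for K
      using pcomp_cong_mpow[of "z True" "z' True" "z False" "z' False" n K 2] z zz n that by simp
    let ?N = "pcomp N (z' True) (z' False) - pcomp N (z True) (z False)"
    let ?M = "pcomp M (z' True) (z' False) - pcomp M (z True) (z False)"
    have D': "?N \<in> mpow (Suc n)" "?M \<in> mpow (Suc n)"
      using mpow_sym[OF D] NM by blast+
    have e: "\<Phi> z t - \<Phi> z' t = (if t then const2 (1 / d) * (const2 b2 * ?N - const2 a2 * ?M)
        else const2 (1 / d) * (const2 a1 * ?M - const2 b1 * ?N))"
      by (simp add: \<Phi>_def algebra_simps)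
    show "\<Phi> z t - \<Phi> z' t \<in> mpow (Suc n)"
      unfolding e using D' by (auto intro!: mpow_diff mpow_const2_mult)
  qed
  then obtain z where "\<forall>s. z s \<in> mpow 1" and fixz: "\<Phi> z = z" by blast
  define p q where "p = z True" and "q = z False"
  have pq: "p \<in> mm" "q \<in> mm" using \<open>\<forall>s. z s \<in> mpow 1\<close> by (auto simp: p_def q_def mm_eq_mpow)
  have pe: "p = const2 (1 / d) * (const2 b2 * (X2 - pcomp N p q) - const2 a2 * (Y2 - pcomp M p q))"
    using fun_cong[OF fixz, of True] by (simp add: \<Phi>_def p_def q_def)
  have qe: "q = const2 (1 / d) * (const2 a1 * (Y2 - pcomp M p q) - const2 b1 * (X2 - pcomp N p q))"
    using fun_cong[OF fixz, of False] by (simp add: \<Phi>_def p_def q_def)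
  have cp: "cf p i j = (1 / d) * (b2 * (cf X2 i j - cf (pcomp N p q) i j) - a2 * (cf Y2 i j - cf (pcomp M p q) i j))"
    for i j by (subst pe) simp
  have cq: "cf q i j = (1 / d) * (a1 * (cf Y2 i j - cf (pcomp M p q) i j) - b1 * (cf X2 i j - cf (pcomp N p q) i j))"
    for i j by (subst qe) simp
  have lin: "pcomp (const2 c1 * X2 + const2 c2 * Y2) p q = const2 c1 * p + const2 c2 * q" for c1 c2
    by (simp add: pcomp_add pcomp_const2_mult_left pcomp_X2 pcomp_Y2 pq)
  have ap: "pcomp a p q = const2 a1 * p + const2 a2 * q + pcomp N p q"
    and bp: "pcomp b p q = const2 b1 * p + const2 b2 * q + pcomp M p q"
    using lin by (simp_all add: N_def M_def pcomp_diff)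
  have cramer: "a1 * (1 / d * (b2 * x - a2 * y)) + a2 * (1 / d * (a1 * y - b1 * x)) = x"
    "b1 * (1 / d * (b2 * x - a2 * y)) + b2 * (1 / d * (a1 * y - b1 * x)) = y" for x y
  proof -
    have "a1 * (1 / d * (b2 * x - a2 * y)) + a2 * (1 / d * (a1 * y - b1 * x)) = d * x / d"
      "b1 * (1 / d * (b2 * x - a2 * y)) + b2 * (1 / d * (a1 * y - b1 * x)) = d * y / d"
      unfolding d_def by (simp_all add: algebra_simps add_divide_distrib[symmetric] diff_divide_distrib[symmetric])
    thus "a1 * (1 / d * (b2 * x - a2 * y)) + a2 * (1 / d * (a1 * y - b1 * x)) = x"
      "b1 * (1 / d * (b2 * x - a2 * y)) + b2 * (1 / d * (a1 * y - b1 * x)) = y"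
      using d by simp_all
  qed
  have "pcomp a p q = X2"
    unfolding ap by (rule ps2_eqI) (simp only: cf_add cf_const2_mult cp cq cramer, simp)
  moreover have "pcomp b p q = Y2"
    unfolding bp by (rule ps2_eqI) (simp only: cf_add cf_const2_mult cp cq cramer, simp)
  \<comment> \<open>The linear part of \<open>(p, q)\<close> is the inverse matrix, with determinant
    \<open>1 / d\<close>.\<close>
  moreover have "coords p q"
  proof -
    have z: "cf (pcomp N p q) 1 0 = 0" "cf (pcomp N p q) 0 1 = 0"
      "cf (pcomp M p q) 1 0 = 0" "cf (pcomp M p q) 0 1 = 0"
      using pcomp_mpow[OF pq NM(1)] pcomp_mpow[OF pq NM(2)] by (auto simp: mpow_def)
    have "cf p 1 0 = b2 / d" "cf p 0 1 = - a2 / d" "cf q 1 0 = - b1 / d" "cf q 0 1 = a1 / d"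
      unfolding cp cq z by (simp_all add: cf_X2 cf_Y2)
    hence "cf p 1 0 * cf q 0 1 - cf p 0 1 * cf q 1 0 = (a1 * b2 - a2 * b1) / (d * d)"
      by (simp add: diff_divide_distrib mult.commute)
    thus ?thesis using d pq by (simp add: coords_def d_def)
  qed
  ultimately show ?thesis by blast
qed

text \<open>The right inverse is again a coordinate pair and has a right inverse of its own; by
  associativity the latter is \<open>(a, b)\<close>, so inverses are two-sided.\<close>

lemma coords_inverse:
  assumes "coords a b"
  obtains p q where "coords p q" "pcomp a p q = X2" "pcomp b p q = Y2"
    "pcomp p a b = X2" "pcomp q a b = Y2"
proof -
  obtain p q where pq: "coords p q" "pcomp a p q = X2" "pcomp b p q = Y2"
    using coords_right_inverse[OF assms] by blast
  obtain r s where rs: "coords r s" "pcomp p r s = X2" "pcomp q r s = Y2"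
    using coords_right_inverse[OF pq(1)] by blast
  note mm = coords_mm[OF assms] coords_mm[OF pq(1)] coords_mm[OF rs(1)]
  have "r = pcomp (pcomp a p q) r s" using pq(2) mm by (simp add: pcomp_X2)
  also have "\<dots> = a" using rs mm by (simp add: pcomp_assoc pcomp_id)
  finally have r: "r = a" .
  have "s = pcomp (pcomp b p q) r s" using pq(3) mm by (simp add: pcomp_Y2)
  also have "\<dots> = b" using rs mm by (simp add: pcomp_assoc pcomp_id)
  finally have s: "s = b" .
  show ?thesis using that pq rs r s by blast
qed

lemma pcomp_inverse:
  assumes "a \<in> mm" "b \<in> mm" "p \<in> mm" "q \<in> mm" "pcomp a p q = X2" "pcomp b p q = Y2"
  shows "pcomp (pcomp \<phi> a b) p q = \<phi>"
  using assms by (simp add: pcomp_assoc pcomp_id)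

lemma ps2_split_X2: "\<exists>\<psi>. \<phi> = pcomp \<phi> 0 Y2 + X2 * \<psi>"
proof -
  have z: "(0::ps2) \<in> mm" by (simp add: mm_def)
  \<comment> \<open>Since \<open>0 ^ 0 = 1\<close>, substituting 0 for \<open>X2\<close> keeps
    exactly the terms without \<open>X2\<close>.\<close>
  have c0: "cf (0 ^ a * Y2 ^ b) i j = (if a = 0 \<and> i = 0 \<and> j = b then 1 else 0)" for a b i j
    using cf_monomial[of 0 b i j] by (auto simp: power_0_left)
  have c: "cf (pcomp \<phi> 0 Y2) i j = (if i = 0 then cf \<phi> 0 j else 0)" for i j
  proof -
    have "cf (pcomp \<phi> 0 Y2) i j =
       (\<Sum>a\<le>i+j. \<Sum>b\<le>i+j. if a = 0 then (if b = j then (if i = 0 then cf \<phi> 0 j else 0) else 0) else 0)"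
      unfolding cf_pcomp c0 by (intro sum.cong) auto
    also have "\<dots> = (\<Sum>a\<le>i+j. if a = 0 then (if i = 0 then cf \<phi> 0 j else 0) else 0)"
      by (intro sum.cong) auto
    finally show ?thesis by simp
  qed
  define \<psi> where "\<psi> = Abs_fps (\<lambda>j. Abs_fps (\<lambda>i. cf \<phi> (Suc i) j))"
  have "cf \<psi> i j = cf \<phi> (Suc i) j" for i j by (simp add: \<psi>_def cf_def)
  hence "\<phi> = pcomp \<phi> 0 Y2 + X2 * \<psi>"
    by (intro ps2_eqI) (auto simp: c cf_X2_mult)
  thus ?thesis ..
qed

text \<open>The pair \<open>(p, q)\<close> parametrises the curve \<open>a = 0\<close>, and
  vanishing along it means vanishing for \<open>X2 = 0\<close> in the coordinates
  \<open>(a, b)\<close>. Both variables are set to the one parameter \<open>Y2\<close>, so that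
  graphs over either axis are covered.\<close>

lemma coord_dvd_if_vanishes:
  assumes "coords a b" "p \<in> mm" "q \<in> mm" "pcomp a p q = 0" "pcomp (pcomp b p q) Y2 Y2 = Y2"
    and "pcomp \<phi> p q = 0"
  shows "a dvd \<phi>"
proof -
  obtain r s where rs: "coords r s" "pcomp a r s = X2" "pcomp b r s = Y2"
    "pcomp r a b = X2" "pcomp s a b = Y2"
    using coords_inverse[OF assms(1)] .
  note mm = coords_mm[OF assms(1)] coords_mm[OF rs(1)] assms(2,3)
  have z: "(0::ps2) \<in> mm" by (simp add: mm_def)
  define \<phi>' where "\<phi>' = pcomp \<phi> r s"
  have \<phi>: "\<phi> = pcomp \<phi>' a b"
    unfolding \<phi>'_def using pcomp_inverse[of r s a b] mm rs by simp
  obtain \<psi> where \<psi>: "\<phi>' = pcomp \<phi>' 0 Y2 + X2 * \<psi>" using ps2_split_X2 by blast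
  have "0 = pcomp (pcomp (pcomp \<phi>' a b) p q) Y2 Y2" using assms(6) \<phi> by simp
  also have "\<dots> = pcomp \<phi>' 0 Y2"
    using assms(4,5) mm z by (simp add: pcomp_assoc pcomp_mm)
  finally have "\<phi>' = X2 * \<psi>" using \<psi> by simp
  hence "\<phi> = a * pcomp \<psi> a b" using \<phi> mm by (simp add: pcomp_mult pcomp_X2)
  thus ?thesis by simp
qed

lemma coords_cong_mpow2:
  assumes "coords a b" "a' - a \<in> mpow 2" "b' - b \<in> mpow 2"
  shows "coords a' b'"
proof -
  have "cf a' i j = cf a i j" "cf b' i j = cf b i j" if "i + j < 2" for i j
    using assms that by (auto simp: mpow_def)
  thus ?thesis using assms(1) by (auto simp: coords_def mm_def)
qed

lemma coords_X2_Y2: "coords X2 Y2"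
  by (simp add: coords_def cf_X2 cf_Y2)

subsection \<open>Invariant curves\<close>

text \<open>The curve is sought as a graph \<open>x = k(y)\<close>. Invariance reads
  \<open>lam k(y) = k(f2(k(y), y)) - N(k(y), y)\<close>, and the right side contracts in
  \<open>k\<close> because \<open>f2\<close> and \<open>N\<close> have order 2.\<close>

lemma semi_superattracting_transverse_curve:
  assumes f: "f1 - const2 lam * X2 \<in> mpow 2" "f2 \<in> mpow 2" and lam: "lam \<noteq> 0"
  shows "\<exists>a u. a - X2 \<in> mpow 2 \<and> cf u 0 0 = lam \<and> pcomp a f1 f2 = a * u"
proof -
  define N where "N = f1 - const2 lam * X2"
  have N: "N \<in> mpow 2" using f by (simp add: N_def)
  have f1e: "f1 = const2 lam * X2 + N" by (simp add: N_def)
  have lX: "const2 lam * X2 \<in> mm" by (simp add: mm_def cf_X2)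
  have fm: "f1 \<in> mm" "f2 \<in> mm"
    using mpow2_mm[OF N] lX mpow2_mm[OF f(2)] by (auto simp: f1e mm_def)
  define \<Phi> where "\<Phi> z = (\<lambda>_::unit. const2 (1 / lam) *
      (pcomp (z ()) 0 (pcomp f2 (z ()) Y2) - pcomp N (z ()) Y2))" for z
  have self: "pcomp k 0 (pcomp f2 k Y2) - pcomp N k Y2 \<in> mpow 2" if "k \<in> mm" for k
  proof -
    have F: "pcomp f2 k Y2 \<in> mpow 2" using that f pcomp_mpow by simp
    have "pcomp k 0 (pcomp f2 k Y2) - pcomp k 0 0 \<in> mpow (1 - 1 + 2)"
      using F that mpow2_mm[OF F] by (intro pcomp_cong_mpow) (auto simp: mm_eq_mpow)
    hence "pcomp k 0 (pcomp f2 k Y2) \<in> mpow 2" using pcomp_zero_zero[OF that] by (simp add: numeral_2_eq_2)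
    moreover have "pcomp N k Y2 \<in> mpow 2" using that N pcomp_mpow by simp
    ultimately show ?thesis by (rule mpow_diff)
  qed
  have "\<exists>z. (\<forall>s. z s \<in> mpow 1) \<and> \<Phi> z = z"
  proof (rule mpow_fixpoint)
    fix z :: "unit \<Rightarrow> ps2" and t
    assume "\<forall>s. z s \<in> mpow 1"
    hence "z () \<in> mm" by (simp add: mm_eq_mpow)
    from self[OF this] show "\<Phi> z t \<in> mpow 1"
      unfolding \<Phi>_def by (auto intro!: mpow_const2_mult intro: mpow_mono)
  next
    fix z z' :: "unit \<Rightarrow> ps2" and n t
    assume "\<forall>s. z s \<in> mpow 1" "\<forall>s. z' s \<in> mpow 1" and n: "1 \<le> n" and zz: "\<forall>s. z s - z' s \<in> mpow n"
    define k k' where "k = z ()" and "k' = z' ()"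
    have k: "k \<in> mm" "k' \<in> mm"
      using \<open>\<forall>s. z s \<in> mpow 1\<close> \<open>\<forall>s. z' s \<in> mpow 1\<close> by (simp_all add: mm_eq_mpow k_def k'_def)
    have kk: "k - k' \<in> mpow n" using zz by (simp add: k_def k'_def)
    have D: "pcomp K k Y2 - pcomp K k' Y2 \<in> mpow (Suc n)" if "K \<in> mpow 2" for K
      using pcomp_cong_mpow[of k k' Y2 Y2 n K 2] k kk n that by simp
    define F F' where "F = pcomp f2 k Y2" and "F' = pcomp f2 k' Y2"
    have F: "F \<in> mpow 2" "F' \<in> mpow 2" using k f pcomp_mpow by (simp_all add: F_def F'_def)
    have Fm: "F \<in> mm" "F' \<in> mm" using F mpow2_mm by auto
    \<comment> \<open>The difference vanishes at the origin and \<open>F\<close> has order 2, so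
      evaluating it at \<open>(0, F)\<close> raises its order \<open>n\<close> by at least
      one.\<close>
    have 1: "pcomp (k - k') 0 F - pcomp (k - k') 0 0 \<in> mpow (Suc n)"
      using pcomp_cong_mpow[of 0 0 F 0 2 "k - k'" n] kk n F Fm by (simp add: Suc_diff_le)
    have "pcomp (k - k') 0 0 = 0" using k by (simp add: pcomp_diff pcomp_zero_zero)
    with 1 have 1: "pcomp (k - k') 0 F \<in> mpow (Suc n)" by simp
    have "F - F' \<in> mpow (Suc n)" using D[OF f(2)] by (simp add: F_def F'_def)
    hence 2: "pcomp k' 0 F - pcomp k' 0 F' \<in> mpow (Suc n)"
      using pcomp_cong_mpow[of 0 0 F F' "Suc n" k' 1] k Fm by (simp add: mm_eq_mpow)
    have e: "\<Phi> z t - \<Phi> z' t = const2 (1 / lam) * (pcomp (k - k') 0 F + (pcomp k' 0 F - pcomp k' 0 F')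
         - (pcomp N k Y2 - pcomp N k' Y2))"
      by (simp add: \<Phi>_def pcomp_diff k_def[symmetric] k'_def[symmetric] F_def[symmetric]
          F'_def[symmetric] algebra_simps)
    show "\<Phi> z t - \<Phi> z' t \<in> mpow (Suc n)"
      unfolding e by (intro mpow_const2_mult mpow_diff mpow_add 1 2 D N mpow_diff[of _ "Suc n"])
  qed
  then obtain z where "\<forall>s. z s \<in> mpow 1" and fixz: "\<Phi> z = z" by blast
  define k0 where "k0 = z ()"
  have k0: "k0 \<in> mm" using \<open>\<forall>s. z s \<in> mpow 1\<close> by (simp add: k0_def mm_eq_mpow)
  have k0e: "k0 = const2 (1 / lam) * (pcomp k0 0 (pcomp f2 k0 Y2) - pcomp N k0 Y2)"
    using fun_cong[OF fixz, of "()"] by (simp add: \<Phi>_def k0_def)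
  have k02: "k0 \<in> mpow 2" by (subst k0e) (intro mpow_const2_mult self k0)
  have "const2 lam * k0 = pcomp k0 0 (pcomp f2 k0 Y2) - pcomp N k0 Y2"
    by (subst k0e) (simp add: mult.assoc[symmetric] const2_mult[symmetric] lam)
  hence eq0: "pcomp f1 k0 Y2 = pcomp k0 0 (pcomp f2 k0 Y2)"
    using k0 by (simp add: f1e pcomp_add pcomp_const2_mult_left pcomp_X2)
  \<comment> \<open>The fixed point is a series in two variables; setting \<open>X2\<close> to 0
    gives a genuine function of \<open>Y2\<close> that still solves the equation.\<close>
  define k where "k = pcomp k0 0 Y2"
  have k: "k \<in> mpow 2" unfolding k_def by (intro pcomp_mpow k02) simp_all
  have km: "k \<in> mm" using k by (rule mpow2_mm)
  have kc: "pcomp k g h = pcomp k0 0 h" if "g \<in> mm" "h \<in> mm" for g h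
    unfolding k_def using that by (simp add: pcomp_assoc pcomp_Y2 pcomp_0 k0)
  have "pcomp (pcomp f1 k0 Y2) 0 Y2 = pcomp (pcomp k0 0 (pcomp f2 k0 Y2)) 0 Y2" using eq0 by simp
  hence eq: "pcomp f1 k Y2 = pcomp k0 0 (pcomp f2 k Y2)"
    using k0 fm by (simp add: pcomp_assoc pcomp_mm pcomp_Y2 k_def[symmetric])
  define a where "a = X2 - k"
  have a2: "a - X2 \<in> mpow 2" using mpow_uminus[OF k] by (simp add: a_def)
  have co: "coords a Y2" using coords_cong_mpow2[OF coords_X2_Y2 a2] by simp
  have "a dvd pcomp a f1 f2"
  proof (rule coord_dvd_if_vanishes[OF co km mm_Y2])
    show "pcomp a k Y2 = 0"
      using km kc[OF km mm_Y2] by (simp add: a_def pcomp_diff pcomp_X2 k_def)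
    show "pcomp (pcomp Y2 k Y2) Y2 Y2 = Y2" using km by (simp add: pcomp_Y2)
    show "pcomp (pcomp a f1 f2) k Y2 = 0"
      using fm km eq by (simp add: a_def pcomp_diff pcomp_X2 kc pcomp_assoc pcomp_mm)
  qed
  then obtain u where u: "pcomp a f1 f2 = a * u" by (auto elim: dvdE)
  \<comment> \<open>Comparing coefficients of \<open>X2\<close> identifies the constant term of
    \<open>u\<close>: \<open>k\<close> has order 2, so only \<open>f1\<close> contributes on the
    left.\<close>
  have "pcomp a f1 f2 = f1 - pcomp k f1 f2" using fm by (simp add: a_def pcomp_diff pcomp_X2)
  hence "cf (pcomp a f1 f2) 1 0 = lam"
    using pcomp_mpow[OF fm k] N by (simp add: f1e cf_X2 mpow_def)
  moreover have "cf (a * u) 1 0 = cf u 0 0"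
  proof -
    have "cf a 0 0 = 0" "cf a 1 0 = 1" using k by (auto simp: a_def cf_X2 mpow_def)
    thus ?thesis by (simp add: cf_mult)
  qed
  ultimately have "cf u 0 0 = lam" using u by simp
  thus ?thesis using a2 u by blast
qed

text \<open>The curve is sought as a graph \<open>y = h(x)\<close>, with
  \<open>h(f1(x, h)) = f2(x, h)\<close>. The operator sending \<open>h\<close> to
  \<open>h(f1(x, h))\<close> does not contract, since its leading part is \<open>h(lam x)\<close>;
  \<open>G\<close> subtracts that part and \<open>\<Phi>\<close> undoes the scaling by
  \<open>lam\<close>. Order 2 for \<open>h\<close> is needed to gain an order when the inner series
  varies.\<close>

lemma semi_superattracting_tangent_curve:
  assumes f: "f1 - const2 lam * X2 \<in> mpow 2" "f2 \<in> mpow 2" and lam: "lam \<noteq> 0"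
  shows "\<exists>b w. b - Y2 \<in> mpow 2 \<and> cf w 0 0 = 0 \<and> pcomp b f1 f2 = b * w"
proof -
  define N where "N = f1 - const2 lam * X2"
  have N: "N \<in> mpow 2" using f by (simp add: N_def)
  have f1e: "f1 = const2 lam * X2 + N" by (simp add: N_def)
  have lX: "const2 c * X2 \<in> mm" for c by (simp add: mm_def cf_X2)
  have fm: "f1 \<in> mm" "f2 \<in> mm"
    using mpow2_mm[OF N] lX mpow2_mm[OF f(2)] by (auto simp: f1e mm_def)
  define G where "G h = pcomp f2 X2 h - pcomp h (pcomp f1 X2 h) 0 + pcomp h (const2 lam * X2) 0" for h
  define \<Phi> where "\<Phi> z = (\<lambda>_::unit. pcomp (G (z ())) (const2 (1 / lam) * X2) 0)" for z
  have "\<exists>z. (\<forall>s. z s \<in> mpow 2) \<and> \<Phi> z = z"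
  proof (rule mpow_fixpoint)
    fix z :: "unit \<Rightarrow> ps2" and t
    assume "\<forall>s. z s \<in> mpow 2"
    hence h: "z () \<in> mpow 2" by simp
    have hm: "z () \<in> mm" using h by (rule mpow2_mm)
    show "\<Phi> z t \<in> mpow 2"
      unfolding \<Phi>_def G_def
      by (intro pcomp_mpow mpow_add mpow_diff f h hm lX fm pcomp_mm) simp_all
  next
    fix z z' :: "unit \<Rightarrow> ps2" and n t
    assume zm: "\<forall>s. z s \<in> mpow 2" "\<forall>s. z' s \<in> mpow 2" and n: "2 \<le> n"
      and zz: "\<forall>s. z s - z' s \<in> mpow n"
    define h h' where "h = z ()" and "h' = z' ()"
    have h: "h \<in> mpow 2" "h' \<in> mpow 2" using zm by (simp_all add: h_def h'_def)
    have hm: "h \<in> mm" "h' \<in> mm" using h mpow2_mm by auto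
    have hh: "h - h' \<in> mpow n" using zz by (simp add: h_def h'_def)
    define F F' where "F = pcomp f1 X2 h" and "F' = pcomp f1 X2 h'"
    have Fm: "F \<in> mm" "F' \<in> mm" using hm fm by (auto simp: F_def F'_def pcomp_mm)
    have 1: "pcomp f2 X2 h - pcomp f2 X2 h' \<in> mpow (Suc n)"
      using pcomp_cong_mpow[of X2 X2 h h' n f2 2] hm hh n f by simp
    have FF: "F - F' \<in> mpow n"
      using pcomp_cong_mpow[of X2 X2 h h' n f1 1] hm hh n fm(1)[unfolded mm_eq_mpow] by (simp add: F_def F'_def)
    have 2: "pcomp h' F 0 - pcomp h' F' 0 \<in> mpow (Suc n)"
      using pcomp_cong_mpow[of F F' 0 0 n h' 2] h FF n Fm by simp
    have "F - const2 lam * X2 = pcomp N X2 h"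
      using hm by (simp add: F_def f1e pcomp_add pcomp_const2_mult_left pcomp_X2)
    also have "\<dots> \<in> mpow 2" using N hm pcomp_mpow by simp
    finally have 3: "pcomp (h - h') F 0 - pcomp (h - h') (const2 lam * X2) 0 \<in> mpow (Suc n)"
      using pcomp_cong_mpow[of F "const2 lam * X2" 0 0 2 "h - h'" n] hh n Fm lX
      by (simp add: Suc_diff_le)
    \<comment> \<open>The three sources of change are separated: the argument of \<open>f2\<close>,
      the inner series under a fixed outer one, and the outer series, whose leading part cancels
      against \<open>h(lam x)\<close>.\<close>
    have "G h - G h' = (pcomp f2 X2 h - pcomp f2 X2 h') - (pcomp h' F 0 - pcomp h' F' 0)
        - (pcomp (h - h') F 0 - pcomp (h - h') (const2 lam * X2) 0)"
      by (simp add: G_def pcomp_diff F_def F'_def algebra_simps)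
    hence "G h - G h' \<in> mpow (Suc n)" using mpow_diff[OF mpow_diff[OF 1 2] 3] by simp
    thus "\<Phi> z t - \<Phi> z' t \<in> mpow (Suc n)"
      unfolding \<Phi>_def pcomp_diff[symmetric] h_def h'_def by (intro pcomp_mpow lX) simp_all
  qed
  then obtain z where zm: "\<forall>s. z s \<in> mpow 2" and fixz: "\<Phi> z = z" by blast
  define h where "h = z ()"
  have h: "h \<in> mpow 2" using zm by (simp add: h_def)
  have hm: "h \<in> mm" using h by (rule mpow2_mm)
  have he: "h = pcomp (G h) (const2 (1 / lam) * X2) 0"
    using fun_cong[OF fixz, of "()"] by (simp add: \<Phi>_def h_def)
  \<comment> \<open>The fixed point equation substitutes 0 for \<open>Y2\<close> on its right side,
    so \<open>h\<close> depends on its first variable only.\<close>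
  have hc: "pcomp h g q = pcomp h g 0" if "g \<in> mm" "q \<in> mm" for g q
    using that by (subst (1 2) he) (simp add: pcomp_assoc lX pcomp_const2_mult_left pcomp_X2)
  have hX: "pcomp h X2 0 = h" using hc[OF mm_X2 mm_Y2] by (simp add: pcomp_id)
  have "pcomp h (const2 lam * X2) 0 = pcomp (G h) X2 0"
    by (subst he) (simp add: pcomp_assoc lX pcomp_const2_mult_left pcomp_X2
        mult.assoc[symmetric] const2_mult[symmetric] lam)
  also have "\<dots> = pcomp f2 X2 h - pcomp h (pcomp f1 X2 h) 0 + pcomp h (const2 lam * X2) 0"
    unfolding G_def using hm fm
    by (simp add: pcomp_add pcomp_diff pcomp_assoc lX hX pcomp_const2_mult_left pcomp_X2 pcomp_mm)
  finally have eq: "pcomp f2 X2 h = pcomp h (pcomp f1 X2 h) 0" by simp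
  define b where "b = Y2 - h"
  have b2: "b - Y2 \<in> mpow 2" using mpow_uminus[OF h] by (simp add: b_def)
  have co: "coords b X2" using coords_swap[OF coords_cong_mpow2[OF coords_X2_Y2 _ b2, of X2]] by simp
  have "b dvd pcomp b f1 f2"
  proof (rule coord_dvd_if_vanishes[OF co mm_X2 hm])
    show "pcomp b X2 h = 0"
      using hm hc[OF mm_X2 hm] by (simp add: b_def pcomp_diff pcomp_Y2 hX)
    show "pcomp (pcomp X2 X2 h) Y2 Y2 = Y2" using hm by (simp add: pcomp_X2)
    show "pcomp (pcomp b f1 f2) X2 h = 0"
      using fm hm eq hc[of "pcomp f1 X2 h" "pcomp f2 X2 h"]
      by (simp add: b_def pcomp_diff pcomp_Y2 pcomp_assoc pcomp_mm)
  qed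
  then obtain w where w: "pcomp b f1 f2 = b * w" by (auto elim: dvdE)
  have "pcomp b f1 f2 = f2 - pcomp h f1 f2" using fm by (simp add: b_def pcomp_diff pcomp_Y2)
  hence "cf (pcomp b f1 f2) 0 1 = 0"
    using pcomp_mpow[OF fm h] f by (simp add: mpow_def)
  moreover have "cf (b * w) 0 1 = cf w 0 0"
  proof -
    have "cf b 0 0 = 0" "cf b 0 1 = 1" using h by (auto simp: b_def cf_Y2 mpow_def)
    thus ?thesis by (simp add: cf_mult)
  qed
  ultimately have "cf w 0 0 = 0" using w by simp
  thus ?thesis using b2 w by blast
qed

text \<open>The linear forms \<open>a\<close> and \<open>b\<close> are left eigenvectors of the
  Jacobian matrix, because pulling back a linear form multiplies its row vector by that
  matrix.\<close>

lemma semi_superattracting_linear_part: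
  assumes "f1 \<in> mm" "f2 \<in> mm" "semi_superattracting f1 f2"
  shows "\<exists>a b lam. lam \<noteq> 0 \<and> coords a b \<and> pcomp a f1 f2 - const2 lam * a \<in> mpow 2 \<and>
    pcomp b f1 f2 \<in> mpow 2"
proof -
  define j11 j12 j21 j22 where "j11 = cf f1 1 0" and "j12 = cf f1 0 1"
    and "j21 = cf f2 1 0" and "j22 = cf f2 0 1"
  note j_def = j11_def j12_def j21_def j22_def
  obtain lam where lam: "lam \<noteq> 0" and ch: "\<And>t. det (mat t - jac0 f1 f2) = t * (t - lam)"
    using assms(3) unfolding semi_superattracting_def by blast
  have ch': "(t - j11) * (t - j22) - j12 * j21 = t * (t - lam)" for t
    using ch[of t] by (simp add: det_2 jac0_def mat_def j_def)
  \<comment> \<open>Evaluating the characteristic polynomial at 0 and 1 gives determinant 0 and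
    trace \<open>lam\<close>.\<close>
  have dt: "j11 * j22 = j12 * j21" using ch'[of 0] by simp
  have tr: "lam = j11 + j22" using ch'[of 1] dt by (simp add: algebra_simps)
  obtain p q r s where pq: "p * j11 + q * j21 = lam * p" "p * j12 + q * j22 = lam * q"
    and rs: "r * j11 + s * j21 = 0" "r * j12 + s * j22 = 0" and ind: "p * s - q * r \<noteq> 0"
  \<comment> \<open>In a matrix of rank one each nonzero row is a left eigenvector for the trace.
    The first row is taken if \<open>j11\<close> is nonzero, otherwise the second, whose entry
    \<open>j22\<close> is then \<open>lam\<close>.\<close>
  proof (cases "j11 = 0")
    case False
    show ?thesis
    proof (rule that[of j11 j12 j21 "- j11"])
      have "j11 * - j11 - j12 * j21 = - (j11 * lam)" using dt tr by (simp add: algebra_simps)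
      thus "j11 * - j11 - j12 * j21 \<noteq> 0" using False lam by simp
    qed (use dt tr in \<open>simp_all add: algebra_simps\<close>)
  next
    case True
    hence "j22 \<noteq> 0" using tr lam by simp
    show ?thesis
    proof (rule that[of j21 j22 "- j22" j12])
      have "j21 * j12 - j22 * - j22 = j22 * lam" using dt tr by (simp add: algebra_simps)
      thus "j21 * j12 - j22 * - j22 \<noteq> 0" using \<open>j22 \<noteq> 0\<close> lam by simp
    qed (use dt tr in \<open>simp_all add: algebra_simps\<close>)
  qed
  define a b where "a = const2 p * X2 + const2 q * Y2" and "b = const2 r * X2 + const2 s * Y2"
  have co: "coords a b"
    using ind by (simp add: coords_def a_def b_def mm_def cf_X2 cf_Y2)
  have pa: "pcomp a f1 f2 = const2 p * f1 + const2 q * f2"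
    and pb: "pcomp b f1 f2 = const2 r * f1 + const2 s * f2"
    using assms by (simp_all add: a_def b_def pcomp_add pcomp_const2_mult_left pcomp_X2 pcomp_Y2)
  have eq2: "i + j < 2 \<longleftrightarrow> (i = 0 \<and> j = 0 \<or> i = 1 \<and> j = 0 \<or> i = 0 \<and> j = 1)" for i j :: nat
    by auto
  have "pcomp a f1 f2 - const2 lam * a \<in> mpow 2"
    unfolding pa mpow_def eq2 using assms(1,2) pq
    by (auto simp: a_def cf_X2 cf_Y2 mm_def j_def)
  moreover have "pcomp b f1 f2 \<in> mpow 2"
    unfolding pb mpow_def eq2 using assms(1,2) rs
    by (auto simp: mm_def j_def)
  ultimately show ?thesis using lam co by blast
qed

text \<open>Conjugation by the linear coordinates \<open>(a, b)\<close> produces a germ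
  \<open>(g1, g2)\<close> with diagonal linear part; its two invariant curves are carried back by
  substituting \<open>(a, b)\<close>.\<close>

lemma semi_superattracting_normal_form:
  assumes "f1 \<in> mm" "f2 \<in> mm" "semi_superattracting f1 f2"
  shows "\<exists>\<alpha> \<beta> u w. coords \<alpha> \<beta> \<and> pcomp \<alpha> f1 f2 = \<alpha> * u \<and> cf u 0 0 \<noteq> 0 \<and>
    pcomp \<beta> f1 f2 = \<beta> * w \<and> w \<in> mm"
proof -
  obtain a b lam where lam: "lam \<noteq> 0" and co: "coords a b"
    and fa: "pcomp a f1 f2 - const2 lam * a \<in> mpow 2" and fb: "pcomp b f1 f2 \<in> mpow 2"
    using semi_superattracting_linear_part[OF assms] by blast
  obtain p q where pq: "coords p q" "pcomp a p q = X2" "pcomp b p q = Y2"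
    "pcomp p a b = X2" "pcomp q a b = Y2"
    using coords_inverse[OF co] .
  note mm = coords_mm[OF co] coords_mm[OF pq(1)] assms(1,2)
  define g1 g2 where "g1 = pcomp (pcomp a f1 f2) p q" and "g2 = pcomp (pcomp b f1 f2) p q"
  have gm: "g1 \<in> mm" "g2 \<in> mm" using mm by (simp_all add: g1_def g2_def pcomp_mm)
  have conj: "pcomp (pcomp \<phi> a b) f1 f2 = pcomp (pcomp \<phi> g1 g2) a b" for \<phi>
  proof -
    have "pcomp g1 a b = pcomp a f1 f2" "pcomp g2 a b = pcomp b f1 f2"
      unfolding g1_def g2_def using mm pq by (simp_all add: pcomp_inverse)
    thus ?thesis using mm gm by (simp add: pcomp_assoc)
  qed
  have g1: "g1 - const2 lam * X2 \<in> mpow 2"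
    using pcomp_mpow[OF mm(3,4) fa] pq(2)
    by (simp add: g1_def pcomp_diff pcomp_const2_mult_left)
  have g2: "g2 \<in> mpow 2" unfolding g2_def by (intro pcomp_mpow mm fb)
  obtain a' u' where a': "a' - X2 \<in> mpow 2" "cf u' 0 0 = lam" "pcomp a' g1 g2 = a' * u'"
    using semi_superattracting_transverse_curve[OF g1 g2 lam] by blast
  obtain b' w' where b': "b' - Y2 \<in> mpow 2" "cf w' 0 0 = 0" "pcomp b' g1 g2 = b' * w'"
    using semi_superattracting_tangent_curve[OF g1 g2 lam] by blast
  have c00: "cf (pcomp \<phi> a b) 0 0 = cf \<phi> 0 0" for \<phi> by (simp add: cf_pcomp cf_1)
  have "pcomp a' a b - a \<in> mpow 2"
    using pcomp_mpow[OF mm(1,2) a'(1)] mm by (simp add: pcomp_diff pcomp_X2)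
  moreover have "pcomp b' a b - b \<in> mpow 2"
    using pcomp_mpow[OF mm(1,2) b'(1)] mm by (simp add: pcomp_diff pcomp_Y2)
  ultimately have "coords (pcomp a' a b) (pcomp b' a b)"
    by (rule coords_cong_mpow2[OF co])
  moreover have "pcomp (pcomp a' a b) f1 f2 = pcomp a' a b * pcomp u' a b"
    "pcomp (pcomp b' a b) f1 f2 = pcomp b' a b * pcomp w' a b"
    using a' b' mm by (simp_all add: conj pcomp_mult)
  moreover have "cf (pcomp u' a b) 0 0 \<noteq> 0" "pcomp w' a b \<in> mm"
    using a' b' lam by (simp_all add: c00 mm_def)
  ultimately show ?thesis by blast
qed

section \<open>Units and generators of the powers of the maximal ideal\<close>

lemma ps2_is_unit:
  assumes "cf u 0 0 \<noteq> 0"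
  shows "u dvd 1"
proof -
  have "fps_nth u 0 * inverse (fps_nth u 0) = 1"
    using assms by (simp add: cf_def inverse_mult_eq_1')
  hence "u * fps_right_inverse u (inverse (fps_nth u 0)) = 1" by (rule fps_right_inverse)
  thus ?thesis by (metis dvd_triv_left)
qed

lemma ps2_unit_iff: "u dvd 1 \<longleftrightarrow> cf u 0 0 \<noteq> 0"
proof
  assume "u dvd 1"
  then obtain v where "1 = u * v" by (elim dvdE)
  hence "cf u 0 0 * cf v 0 0 = 1" using cf_mult[of u v 0 0] by (simp add: cf_1)
  thus "cf u 0 0 \<noteq> 0" by auto
qed (rule ps2_is_unit)

text \<open>All monomials containing \<open>X2\<close> go into \<open>p\<close>, the pure powers of
  \<open>Y2\<close> into \<open>q\<close>. By induction this bounds any valuation on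
  \<open>mpow n\<close> below by \<open>n\<close>.\<close>

lemma ps2_split_X2_Y2:
  assumes "\<phi> \<in> mpow (Suc n)"
  obtains p q where "p \<in> mpow n" "q \<in> mpow n" "\<phi> = X2 * p + Y2 * q"
proof
  define p where "p = Abs_fps (\<lambda>j. Abs_fps (\<lambda>i. cf \<phi> (Suc i) j))"
  define q where "q = Abs_fps (\<lambda>j. Abs_fps (\<lambda>i. if i = 0 then cf \<phi> 0 (Suc j) else 0))"
  have cp: "cf p i j = cf \<phi> (Suc i) j" for i j by (simp add: p_def cf_def)
  have cq: "cf q i j = (if i = 0 then cf \<phi> 0 (Suc j) else 0)" for i j by (simp add: q_def cf_def)
  show "p \<in> mpow n" "q \<in> mpow n" using assms by (auto simp: mpow_def cp cq)
  have "cf \<phi> 0 0 = 0" using assms by (auto simp: mpow_def)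
  thus "\<phi> = X2 * p + Y2 * q"
    by (intro ps2_eqI) (auto simp: cf_X2_mult cf_Y2_mult cp cq gr0_conv_Suc)
qed

subsection \<open>Elementary properties of valuations\<close>

lemma val_mult: "\<nu> \<in> VT \<Longrightarrow> \<nu> (\<phi> * \<psi>) = \<nu> \<phi> + \<nu> \<psi>"
  and val_add: "\<nu> \<in> VT \<Longrightarrow> min (\<nu> \<phi>) (\<nu> \<psi>) \<le> \<nu> (\<phi> + \<psi>)"
  and val_zero: "\<nu> \<in> VT \<Longrightarrow> \<nu> 0 = top"
  and val_const: "\<nu> \<in> VT \<Longrightarrow> c \<noteq> 0 \<Longrightarrow> \<nu> (const2 c) = 0"
  and val_mm: "\<nu> \<in> VT \<Longrightarrow> \<phi> \<in> mm \<Longrightarrow> 1 \<le> \<nu> \<phi>"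
  by (auto simp: VT_def is_valuation_def)

lemma val_one: "\<nu> \<in> VT \<Longrightarrow> \<nu> 1 = 0"
  using val_const[of \<nu> 1] by simp

lemma val_unit:
  assumes "\<nu> \<in> VT" "v dvd 1"
  shows "\<nu> v = 0"
proof -
  obtain w where "1 = v * w" using assms(2) by (elim dvdE)
  hence "\<nu> v + \<nu> w = 0" using val_mult[OF assms(1), of v w] val_one[OF assms(1)] by simp
  thus ?thesis by simp
qed

lemma val_uminus: "\<nu> \<in> VT \<Longrightarrow> \<nu> (- \<phi>) = \<nu> \<phi>"
  using val_mult[of \<nu> "- 1" \<phi>] val_unit[of \<nu> "- 1"] by simp

lemma val_diff: "\<nu> \<in> VT \<Longrightarrow> min (\<nu> \<phi>) (\<nu> \<psi>) \<le> \<nu> (\<phi> - \<psi>)"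
  using val_add[of \<nu> \<phi> "- \<psi>"] by (simp add: val_uminus)

lemma val_add_eq:
  assumes "\<nu> \<in> VT" "\<nu> \<phi> < \<nu> \<psi>"
  shows "\<nu> (\<phi> + \<psi>) = \<nu> \<phi>"
proof (rule antisym)
  show "\<nu> \<phi> \<le> \<nu> (\<phi> + \<psi>)" using val_add[OF assms(1), of \<phi> \<psi>] assms(2) by (simp add: min_def split: if_splits)
  have "min (\<nu> (\<phi> + \<psi>)) (\<nu> \<psi>) \<le> \<nu> \<phi>" using val_diff[OF assms(1), of "\<phi> + \<psi>" \<psi>] by simp
  thus "\<nu> (\<phi> + \<psi>) \<le> \<nu> \<phi>" using assms(2) by (auto simp: min_def split: if_splits)
qed

lemma val_power: "\<nu> \<in> VT \<Longrightarrow> \<nu> (\<phi> ^ n) = of_nat n * \<nu> \<phi>"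
  by (induction n) (simp_all add: val_one val_mult algebra_simps)

lemma val_dvd: "\<nu> \<in> VT \<Longrightarrow> \<phi> dvd \<psi> \<Longrightarrow> \<nu> \<phi> \<le> \<nu> \<psi>"
  by (auto elim!: dvdE simp: val_mult)

lemma val_sum_ge:
  assumes "\<nu> \<in> VT" "\<And>x. x \<in> A \<Longrightarrow> c \<le> \<nu> (F x)"
  shows "c \<le> \<nu> (sum F A)"
  using assms(2)
proof (induction A rule: infinite_finite_induct)
  case (insert x A)
  have "c \<le> min (\<nu> (F x)) (\<nu> (sum F A))" using insert by auto
  also have "\<dots> \<le> \<nu> (F x + sum F A)" by (rule val_add[OF assms(1)])
  finally show ?case using insert by simp
qed (simp_all add: val_zero[OF assms(1)])

lemma val_mpow:
  assumes "\<nu> \<in> VT"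
  shows "\<phi> \<in> mpow n \<Longrightarrow> of_nat n \<le> \<nu> \<phi>"
proof (induction n arbitrary: \<phi>)
  case (Suc n)
  obtain p q where pq: "p \<in> mpow n" "q \<in> mpow n" "\<phi> = X2 * p + Y2 * q"
    using ps2_split_X2_Y2[OF Suc.prems] .
  have "of_nat (Suc n) \<le> \<nu> (X2 * p)" "of_nat (Suc n) \<le> \<nu> (Y2 * q)"
    using add_mono[OF val_mm[OF assms mm_X2] Suc.IH[OF pq(1)]]
      add_mono[OF val_mm[OF assms mm_Y2] Suc.IH[OF pq(2)]] by (simp_all add: val_mult[OF assms])
  thus ?case unfolding pq(3) using val_add[OF assms, of "X2 * p" "Y2 * q"] by (meson min.boundedI order_trans)
qed simp

lemma val_monomial: "\<nu> \<in> VT \<Longrightarrow> c \<noteq> 0 \<Longrightarrow>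
    \<nu> (const2 c * (X2 ^ i * Y2 ^ j)) = \<nu> X2 * of_nat i + \<nu> Y2 * of_nat j"
  by (simp add: val_mult val_const val_power mult.commute)

text \<open>The inverse coordinates serve only the normalisation: they carry an element of value 1
  to one for the transported valuation.\<close>

lemma val_pcomp_VT:
  assumes "\<nu> \<in> VT" "coords a b"
  shows "(\<lambda>\<phi>. \<nu> (pcomp \<phi> a b)) \<in> VT"
proof -
  obtain p q where pq: "coords p q" "pcomp p a b = X2" "pcomp q a b = Y2"
    using coords_inverse[OF assms(2)] by metis
  note mm = coords_mm[OF assms(2)] coords_mm[OF pq(1)]
  have inv: "pcomp (pcomp \<phi> p q) a b = \<phi>" for \<phi>
    using pcomp_inverse[of p q a b] pq mm by blast
  have ex: "\<exists>\<phi>\<in>mm. \<nu> \<phi> = 1" using assms(1) by (simp add: VT_def is_valuation_def)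
  then obtain \<phi> where \<phi>: "\<phi> \<in> mm" "\<nu> \<phi> = 1" by blast
  have "\<exists>\<phi>\<in>mm. \<nu> (pcomp \<phi> a b) = 1"
    using \<phi> inv[of \<phi>] mm by (intro bexI[of _ "pcomp \<phi> p q"]) (auto intro: pcomp_mm)
  thus ?thesis
    unfolding VT_def is_valuation_def
    using mm val_mult[OF assms(1)] val_add[OF assms(1)] val_zero[OF assms(1)] val_const[OF assms(1)]
      val_mm[OF assms(1)]
    by (simp add: pcomp_mult pcomp_add pcomp_const2 pcomp_mm)
qed

subsection \<open>Monomial valuations\<close>

text \<open>Infinite weights are allowed: \<open>mv 1 top\<close> is the curve valuation of \<open>Y2\<close>, using
  the convention \<open>top * 0 = 0\<close>.\<close>

definition mv :: "ennreal \<Rightarrow> ennreal \<Rightarrow> val" where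
  "mv a b \<phi> = (INF p \<in> {(i, j). cf \<phi> i j \<noteq> 0}. a * of_nat (fst p) + b * of_nat (snd p))"

lemma mv_le: "cf \<phi> i j \<noteq> 0 \<Longrightarrow> mv a b \<phi> \<le> a * of_nat i + b * of_nat j"
  unfolding mv_def by (rule INF_lower2[of "(i, j)"]) auto

lemma mv_ge: "(\<And>i j. cf \<phi> i j \<noteq> 0 \<Longrightarrow> c \<le> a * of_nat i + b * of_nat j) \<Longrightarrow> c \<le> mv a b \<phi>"
  unfolding mv_def by (rule INF_greatest) auto

lemma mv_mono: "a \<le> a' \<Longrightarrow> b \<le> b' \<Longrightarrow> mv a b \<phi> \<le> mv a' b' \<phi>"
proof (rule mv_ge)
  fix i j assume ab: "a \<le> a'" "b \<le> b'" and "cf \<phi> i j \<noteq> 0"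
  have "mv a b \<phi> \<le> a * of_nat i + b * of_nat j" by (rule mv_le) fact
  also have "\<dots> \<le> a' * of_nat i + b' * of_nat j" using ab by (intro add_mono mult_right_mono) auto
  finally show "mv a b \<phi> \<le> a' * of_nat i + b' * of_nat j" .
qed

text \<open>Weights of at least 1 dominate the total degree, so only finitely many exponents lie
  below a finite bound. The argument also covers infinite weights.\<close>

lemma mv_attained:
  assumes ab: "1 \<le> a" "1 \<le> b" and fin: "mv a b \<phi> < top"
  obtains i j where "cf \<phi> i j \<noteq> 0" "mv a b \<phi> = a * of_nat i + b * of_nat j"
    and "finite {(i', j'). cf \<phi> i' j' \<noteq> 0 \<and> a * of_nat i' + b * of_nat j' = mv a b \<phi>}"
proof -
  let ?w = "\<lambda>p. a * of_nat (fst p) + b * of_nat (snd p)"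
  obtain p0 where p0: "cf \<phi> (fst p0) (snd p0) \<noteq> 0" "?w p0 < top"
    using fin unfolding mv_def INF_less_iff by (metis (mono_tags, lifting) case_prod_beta mem_Collect_eq)
  obtain K where K: "?w p0 < of_nat K"
    using ennreal_Ex_less_of_nat p0(2) by (metis less_top)
  define A where "A = {p. cf \<phi> (fst p) (snd p) \<noteq> 0 \<and> ?w p \<le> ?w p0}"
  have "A \<subseteq> {..K} \<times> {..K}"
  proof
    fix p assume "p \<in> A"
    have "of_nat (fst p + snd p) \<le> ?w p"
      using add_mono[OF mult_right_mono[OF ab(1), of "of_nat (fst p)"] mult_right_mono[OF ab(2), of "of_nat (snd p)"]]
      by simp
    also have "\<dots> < of_nat K" using \<open>p \<in> A\<close> K by (auto simp: A_def)
    finally have "fst p + snd p < K" by (simp only: of_nat_less_iff)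
    thus "p \<in> {..K} \<times> {..K}" by (cases p) auto
  qed
  hence finA: "finite A" by (rule finite_subset) auto
  have "p0 \<in> A" using p0 by (simp add: A_def)
  hence "Min (?w ` A) \<in> ?w ` A" using finA by (intro Min_in) auto
  then obtain p where p: "p \<in> A" "Min (?w ` A) = ?w p" by auto
  have le: "?w p \<le> ?w p'" if "p' \<in> A" for p' unfolding p(2)[symmetric] using that finA by (intro Min_le) auto
  have "?w p \<le> mv a b \<phi>"
  proof (rule mv_ge)
    fix i j assume "cf \<phi> i j \<noteq> 0"
    thus "?w p \<le> a * of_nat i + b * of_nat j"
      using le[of "(i, j)"] le[OF \<open>p0 \<in> A\<close>] by (cases "?w (i, j) \<le> ?w p0") (auto simp: A_def)
  qed
  hence e: "mv a b \<phi> = ?w p" using p(1) by (intro antisym mv_le) (auto simp: A_def)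
  have "{(i', j'). cf \<phi> i' j' \<noteq> 0 \<and> a * of_nat i' + b * of_nat j' = mv a b \<phi>} \<subseteq> A"
    using le[OF \<open>p0 \<in> A\<close>] e by (auto simp: A_def)
  hence "finite {(i', j'). cf \<phi> i' j' \<noteq> 0 \<and> a * of_nat i' + b * of_nat j' = mv a b \<phi>}"
    using finA finite_subset by blast
  thus ?thesis using that[of "fst p" "snd p"] e p(1) by (auto simp: A_def)
qed

lemma mv_add: "min (mv a b \<phi>) (mv a b \<psi>) \<le> mv a b (\<phi> + \<psi>)"
proof (rule mv_ge)
  fix i j assume "cf (\<phi> + \<psi>) i j \<noteq> 0"
  hence "cf \<phi> i j \<noteq> 0 \<or> cf \<psi> i j \<noteq> 0" by auto
  thus "min (mv a b \<phi>) (mv a b \<psi>) \<le> a * of_nat i + b * of_nat j"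
    using mv_le min.coboundedI1 min.coboundedI2 by blast
qed

lemma mv_mult_ge: "mv a b \<phi> + mv a b \<psi> \<le> mv a b (\<phi> * \<psi>)"
proof (rule mv_ge)
  fix i j assume "cf (\<phi> * \<psi>) i j \<noteq> 0"
  then obtain p q where pq: "p \<le> i" "q \<le> j" "cf \<phi> p q * cf \<psi> (i - p) (j - q) \<noteq> 0"
    unfolding cf_mult by (meson atMost_iff sum.not_neutral_contains_not_neutral)
  have "mv a b \<phi> + mv a b \<psi> \<le> (a * of_nat p + b * of_nat q) + (a * of_nat (i - p) + b * of_nat (j - q))"
    using pq by (intro add_mono mv_le) auto
  also have "\<dots> = a * (of_nat (p + (i - p))) + b * of_nat (q + (j - q))"
    by (simp only: of_nat_add distrib_left ac_simps)
  finally show "mv a b \<phi> + mv a b \<psi> \<le> a * of_nat i + b * of_nat j" using pq by simp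
qed

text \<open>As in Gauss's lemma, lexicographically least exponents among those of minimal weight are
  chosen in both factors; at their sum a single product of coefficients survives.\<close>

lemma mv_mult:
  assumes ab: "1 \<le> a" "1 \<le> b"
  shows "mv a b (\<phi> * \<psi>) = mv a b \<phi> + mv a b \<psi>"
proof (rule antisym[OF _ mv_mult_ge])
  show "mv a b (\<phi> * \<psi>) \<le> mv a b \<phi> + mv a b \<psi>"
  proof (cases "mv a b \<phi> < top \<and> mv a b \<psi> < top")
    case True
    let ?w = "\<lambda>i j. a * of_nat i + b * of_nat j"
    have least: "\<exists>i j. cf \<rho> i j \<noteq> 0 \<and> ?w i j = mv a b \<rho> \<and>
        (\<forall>i' j'. cf \<rho> i' j' \<noteq> 0 \<and> ?w i' j' = mv a b \<rho> \<longrightarrow> i \<le> i' \<and> (i' = i \<longrightarrow> j \<le> j'))"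
      if "mv a b \<rho> < top" for \<rho>
    proof -
      define Q where "Q i j \<longleftrightarrow> cf \<rho> i j \<noteq> 0 \<and> ?w i j = mv a b \<rho>" for i j
      have ex: "\<exists>i. \<exists>j. Q i j"
        by (rule mv_attained[OF ab that]) (auto simp: Q_def)
      define i where "i = (LEAST i. \<exists>j. Q i j)"
      have exj: "\<exists>j. Q i j" using LeastI_ex[OF ex] by (simp add: i_def)
      define j where "j = (LEAST j. Q i j)"
      have "Q i j" using LeastI_ex[OF exj] by (simp add: j_def)
      moreover have "i \<le> i'" if "Q i' j'" for i' j' unfolding i_def by (rule Least_le) (use that in blast)
      moreover have "j \<le> j'" if "Q i j'" for j' unfolding j_def by (rule Least_le) (use that in blast)
      ultimately show ?thesis unfolding Q_def by blast
    qed
    obtain i j where ij: "cf \<phi> i j \<noteq> 0" "?w i j = mv a b \<phi>"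
      and ij_min: "\<And>i' j'. cf \<phi> i' j' \<noteq> 0 \<Longrightarrow> ?w i' j' = mv a b \<phi> \<Longrightarrow> i \<le> i' \<and> (i' = i \<longrightarrow> j \<le> j')"
      using least[OF conjunct1[OF True]] by metis
    obtain k l where kl: "cf \<psi> k l \<noteq> 0" "?w k l = mv a b \<psi>"
      and kl_min: "\<And>i' j'. cf \<psi> i' j' \<noteq> 0 \<Longrightarrow> ?w i' j' = mv a b \<psi> \<Longrightarrow> k \<le> i' \<and> (i' = k \<longrightarrow> l \<le> j')"
      using least[OF conjunct2[OF True]] by metis
    \<comment> \<open>A nonzero term forces minimal weight in both factors, as neither value is
      infinite and cancellation applies; the lexicographic choice then leaves one pair of
      exponents.\<close>
    have zero: "cf \<phi> p q * cf \<psi> (i + k - p) (j + l - q) = 0"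
      if pq: "p \<le> i + k" "q \<le> j + l" and ne: "(p, q) \<noteq> (i, j)" for p q
    proof (rule ccontr)
      assume "\<not> ?thesis"
      hence nz: "cf \<phi> p q \<noteq> 0" "cf \<psi> (i + k - p) (j + l - q) \<noteq> 0" by auto
      have "?w p q + ?w (i + k - p) (j + l - q) = a * of_nat (p + (i + k - p)) + b * of_nat (q + (j + l - q))"
        by (simp only: of_nat_add distrib_left ac_simps)
      also have "\<dots> = mv a b \<phi> + mv a b \<psi>"
        using pq by (simp add: ij(2)[symmetric] kl(2)[symmetric] distrib_left ac_simps)
      finally have s: "?w p q + ?w (i + k - p) (j + l - q) = mv a b \<phi> + mv a b \<psi>" .
      have le: "mv a b \<phi> \<le> ?w p q" "mv a b \<psi> \<le> ?w (i + k - p) (j + l - q)"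
        using nz by (auto intro: mv_le)
      have "?w p q = mv a b \<phi>"
      proof (rule ccontr)
        assume "?w p q \<noteq> mv a b \<phi>"
        hence "mv a b \<phi> < ?w p q" using le by simp
        hence "mv a b \<psi> + mv a b \<phi> < mv a b \<psi> + ?w p q"
          using True by (auto simp: ennreal_add_left_cancel_less)
        also have "\<dots> \<le> ?w p q + ?w (i + k - p) (j + l - q)"
          using add_right_mono[OF le(2), of "?w p q"] by (simp only: add.commute)
        finally show False unfolding s by (simp only: add.commute less_irrefl)
      qed
      moreover from this have "?w (i + k - p) (j + l - q) = mv a b \<psi>"
        using s True by (auto simp: ennreal_add_left_cancel)
      ultimately have m: "i \<le> p \<and> (p = i \<longrightarrow> j \<le> q)"
        "k \<le> i + k - p \<and> (i + k - p = k \<longrightarrow> l \<le> j + l - q)"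
        using ij_min[OF nz(1)] kl_min[OF nz(2)] by blast+
      have p: "p = i" using m pq by linarith
      hence "q = j" using m pq by simp
      thus False using p ne by simp
    qed
    have "cf (\<phi> * \<psi>) (i + k) (j + l) =
        (\<Sum>x\<in>{..i+k} \<times> {..j+l}. cf \<phi> (fst x) (snd x) * cf \<psi> (i + k - fst x) (j + l - snd x))"
      unfolding cf_mult sum.cartesian_product by (simp add: case_prod_beta)
    also have "\<dots> = (\<Sum>x\<in>{(i, j)}. cf \<phi> (fst x) (snd x) * cf \<psi> (i + k - fst x) (j + l - snd x))"
    proof (intro sum.mono_neutral_right ballI)
      fix x assume "x \<in> {..i+k} \<times> {..j+l} - {(i, j)}"
      thus "cf \<phi> (fst x) (snd x) * cf \<psi> (i + k - fst x) (j + l - snd x) = 0"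
        by (intro zero) auto
    qed auto
    finally have "cf (\<phi> * \<psi>) (i + k) (j + l) \<noteq> 0" using ij(1) kl(1) by simp
    from mv_le[OF this, of a b] show ?thesis
      by (simp add: ij(2)[symmetric] kl(2)[symmetric] distrib_left ac_simps)
  next
    case False
    thus ?thesis by (auto simp: less_top[symmetric])
  qed
qed

lemma mv_X2: "mv a b X2 = a" and mv_Y2: "mv a b Y2 = b"
proof -
  have "{(i, j). cf X2 i j \<noteq> 0} = {(1, 0)}" "{(i, j). cf Y2 i j \<noteq> 0} = {(0, 1)}"
    by (auto simp: cf_X2 cf_Y2)
  thus "mv a b X2 = a" "mv a b Y2 = b" by (simp_all add: mv_def)
qed

lemma mv_VT:
  assumes "1 \<le> b"
  shows "mv 1 b \<in> VT"
proof -
  have "mv 1 b 0 = top" by (simp add: mv_def)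
  moreover have "mv 1 b (const2 c) = 0" if "c \<noteq> 0" for c
    using mv_le[of "const2 c" 0 0 1 b] that by simp
  moreover have "1 \<le> mv 1 b \<phi>" if "\<phi> \<in> mm" for \<phi>
  proof (rule mv_ge)
    fix i j assume "cf \<phi> i j \<noteq> 0"
    hence "(1::nat) \<le> i + j" using that by (cases "i + j") (auto simp: mm_def)
    hence "(1::ennreal) \<le> of_nat (i + j)" by (metis of_nat_1 of_nat_le_iff)
    also have "\<dots> \<le> 1 * of_nat i + b * of_nat j"
      using mult_right_mono[OF assms, of "of_nat j"] by (simp add: add_left_mono)
    finally show "1 \<le> 1 * of_nat i + b * of_nat j" .
  qed
  moreover have "\<exists>\<phi>\<in>mm. mv 1 b \<phi> = 1" using mv_X2 mm_X2 by blast
  ultimately show ?thesis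
    unfolding VT_def is_valuation_def using mv_mult[OF _ assms, of 1] mv_add by simp
qed

text \<open>The ultrametric inequality handles only finite sums, so the series is truncated at some
  \<open>n\<close> above \<open>\<nu> \<phi>\<close>; the tail then has value too large to
  matter.\<close>

lemma mv_le_val:
  assumes "\<nu> \<in> VT"
  shows "mv (\<nu> X2) (\<nu> Y2) \<phi> \<le> \<nu> \<phi>"
proof (cases "\<nu> \<phi> = top")
  case False
  then obtain n where n: "\<nu> \<phi> < of_nat n" using ennreal_Ex_less_of_nat by (metis less_top)
  have "mv (\<nu> X2) (\<nu> Y2) \<phi> \<le> \<nu> (const2 (cf \<phi> i j) * (X2 ^ i * Y2 ^ j))" for i j
    by (cases "cf \<phi> i j = 0") (simp_all add: val_zero assms val_monomial mv_le)
  hence 1: "mv (\<nu> X2) (\<nu> Y2) \<phi> \<le> \<nu> (trunc2 n \<phi>)"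
    unfolding trunc2_def by (intro val_sum_ge[OF assms])
  have 2: "of_nat n \<le> \<nu> (\<phi> - trunc2 n \<phi>)" by (rule val_mpow[OF assms trunc2_mpow])
  have "min (\<nu> (trunc2 n \<phi>)) (\<nu> (\<phi> - trunc2 n \<phi>)) \<le> \<nu> \<phi>"
    using val_add[OF assms, of "trunc2 n \<phi>" "\<phi> - trunc2 n \<phi>"] by simp
  thus ?thesis using 1 2 n by (auto simp: min_def split: if_splits)
qed simp

text \<open>The sum is the homogenisation of \<open>P\<close> in degree \<open>degree P\<close>, so
  over the complex numbers it is a constant times a product of factors \<open>B - t A\<close>. The
  induction splits off one root at a time.\<close>

lemma val_binary_form:
  fixes P :: "complex poly"
  assumes \<nu>: "\<nu> \<in> VT" and lin: "\<And>t. \<nu> (B - const2 t * A) = e" and "P \<noteq> 0"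
  shows "\<nu> (\<Sum>k\<le>degree P. const2 (coeff P k) * (A ^ (degree P - k) * B ^ k)) = of_nat (degree P) * e"
  using \<open>P \<noteq> 0\<close>
proof (induction "degree P" arbitrary: P)
  case 0
  then obtain c where "P = [:c:]" using degree_eq_zeroE by metis
  thus ?case using 0 val_const[OF \<nu>, of c] by simp
next
  case (Suc n)
  have "\<not> constant (poly P)" using Suc.hyps(2) by (simp add: constant_degree)
  then obtain t where "poly P t = 0" using fundamental_theorem_of_algebra by blast
  then obtain Q where PQ: "P = [:- t, 1:] * Q" using poly_eq_0_iff_dvd by (metis dvdE)
  have Q0: "Q \<noteq> 0" using PQ Suc.prems by auto
  have dQ: "degree Q = n"
    using Suc.hyps(2) Q0 degree_mult_eq[of "[:- t, 1:]" Q] unfolding PQ by simp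
  have cP: "coeff P k = (if k = 0 then 0 else coeff Q (k - 1)) - t * coeff Q k" for k
    unfolding PQ by (cases k) (simp_all add: coeff_pCons)
  let ?H = "\<Sum>k\<le>n. const2 (coeff Q k) * (A ^ (n - k) * B ^ k)"
  have AH: "const2 t * A * ?H = (\<Sum>k\<le>Suc n. const2 (t * coeff Q k) * (A ^ (Suc n - k) * B ^ k))"
  proof -
    have "coeff Q (Suc n) = 0" using dQ by (simp add: coeff_eq_0)
    hence "(\<Sum>k\<le>Suc n. const2 (t * coeff Q k) * (A ^ (Suc n - k) * B ^ k)) =
        (\<Sum>k\<le>n. const2 (t * coeff Q k) * (A ^ (Suc n - k) * B ^ k))" by simp
    also have "\<dots> = const2 t * A * ?H"
      unfolding sum_distrib_left by (intro sum.cong) (auto simp: const2_mult Suc_diff_le)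
    finally show ?thesis by simp
  qed
  have BH: "B * ?H = (\<Sum>k\<le>Suc n. const2 (if k = 0 then 0 else coeff Q (k - 1)) * (A ^ (Suc n - k) * B ^ k))"
    unfolding sum.atMost_Suc_shift sum_distrib_left
    by (simp add: mult.left_commute)
  have "(\<Sum>k\<le>Suc n. const2 (coeff P k) * (A ^ (Suc n - k) * B ^ k)) = B * ?H - const2 t * A * ?H"
    unfolding AH BH cP const2_diff left_diff_distrib sum_subtractf ..
  also have "\<dots> = (B - const2 t * A) * ?H" by (simp add: left_diff_distrib)
  also have "\<nu> \<dots> = e + of_nat n * e"
    unfolding val_mult[OF \<nu>] lin using Suc.hyps(1)[OF dQ[symmetric] Q0] dQ by simp
  finally show ?case unfolding Suc.hyps(2)[symmetric] by (simp add: distrib_right)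
qed

text \<open>Suppose that an initial form had value larger than its weight. Being a binary form in
  \<open>X2 ^ p\<close> and \<open>Y2 ^ q\<close>, it splits over \<open>\<complex>\<close> into factors \<open>Y2 ^ q - t X2 ^ p\<close>, and one of them would
  have a value larger than \<open>p\<close>, which is what \<open>mv 1 top\<close> allows.\<close>

lemma val_le_mv:
  assumes \<nu>: "\<nu> \<in> VT" and le: "\<nu> \<le> mv 1 top"
  shows "\<nu> \<phi> \<le> mv 1 (\<nu> Y2) \<phi>"
proof (cases "\<nu> Y2 = top")
  case True
  thus ?thesis using le by (simp add: le_fun_def)
next
  case False
  define b where "b = \<nu> Y2"
  define r where "r = enn2real b"
  have br: "b = ennreal r" using False ennreal_enn2real[of b] by (simp add: b_def r_def less_top)
  have r1: "1 \<le> b" using val_mm[OF \<nu> mm_Y2] by (simp add: b_def)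
  have r0: "r \<ge> 1" using r1 unfolding br by simp
  have X1: "\<nu> X2 = 1"
    using le_funD[OF le, of X2] val_mm[OF \<nu> mm_X2] by (simp add: mv_X2)
  have wr: "of_nat i + b * of_nat j = ennreal (real i + r * real j)" for i j
    using r0 by (simp add: br ennreal_mult' ennreal_of_nat_eq_real_of_nat)
  have mvle: "mv 1 b \<psi> \<le> \<nu> \<psi>" for \<psi>
    using mv_le_val[OF \<nu>, of \<psi>] by (simp add: X1 b_def)
  show ?thesis
  proof (rule ccontr)
    assume "\<not> ?thesis"
    hence gt: "mv 1 b \<phi> < \<nu> \<phi>" by (simp add: b_def)
    define m where "m = mv 1 b \<phi>"
    have mtop: "m < top" using gt by (simp add: m_def less_top order_less_le_trans)
    define S where "S = {(i, j). cf \<phi> i j \<noteq> 0 \<and> of_nat i + b * of_nat j = m}"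
    obtain i0 j0 where "cf \<phi> i0 j0 \<noteq> 0" "m = 1 * of_nat i0 + b * of_nat j0"
      and fin: "finite {(i, j). cf \<phi> i j \<noteq> 0 \<and> 1 * of_nat i + b * of_nat j = m}"
      using mv_attained[OF order_refl r1 mtop[unfolded m_def]] unfolding m_def .
    hence "(i0, j0) \<in> S" by (simp add: S_def)
    hence ne: "S \<noteq> {}" by blast
    have fin: "finite S" using fin by (simp add: S_def)
    \<comment> \<open>The initial form: the part of \<open>\<phi>\<close> of minimal weight. The
      rest has larger weight, so \<open>\<psi>\<close> inherits the excessive value of
      \<open>\<phi>\<close>.\<close>
    define \<psi> where "\<psi> = (\<Sum>p\<in>S. const2 (cf \<phi> (fst p) (snd p)) * (X2 ^ fst p * Y2 ^ snd p))"
    have c\<psi>: "cf \<psi> i j = (if (i, j) \<in> S then cf \<phi> i j else 0)" for i j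
    proof -
      have "cf \<psi> i j = (\<Sum>p\<in>S. if p = (i, j) then cf \<phi> i j else 0)"
        unfolding \<psi>_def cf_sum cf_const2_mult cf_monomial by (intro sum.cong) auto
      thus ?thesis using fin by simp
    qed
    have "m < mv 1 b (\<phi> - \<psi>)"
    proof (cases "mv 1 b (\<phi> - \<psi>) < top")
      case True
      obtain i j where ij: "cf (\<phi> - \<psi>) i j \<noteq> 0" "mv 1 b (\<phi> - \<psi>) = 1 * of_nat i + b * of_nat j"
        using mv_attained[OF order_refl r1 True] .
      have "(i, j) \<notin> S" "cf \<phi> i j \<noteq> 0" using ij(1) by (auto simp: c\<psi> split: if_splits)
      moreover have "m \<le> 1 * of_nat i + b * of_nat j" unfolding m_def by (rule mv_le) fact
      ultimately show ?thesis unfolding ij(2) by (auto simp: S_def)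
    qed (use mtop in \<open>simp add: less_top\<close>)
    hence "m < \<nu> (\<phi> - \<psi>)" using mvle order_less_le_trans by blast
    hence "m < min (\<nu> \<phi>) (\<nu> (\<phi> - \<psi>))" using gt by (simp add: m_def)
    also have "\<dots> \<le> \<nu> \<psi>" using val_diff[OF \<nu>, of \<phi> "\<phi> - \<psi>"] by simp
    finally have \<psi>gt: "m < \<nu> \<psi>" .
    \<comment> \<open>The exponent \<open>(I, J)\<close> is the end of the segment of minimal weight
      with the least power of \<open>Y2\<close>.\<close>
    define J where "J = Min (snd ` S)"
    have "J \<in> snd ` S" unfolding J_def using fin ne by (intro Min_in) auto
    then obtain I where IJ: "(I, J) \<in> S" by force
    have Jle: "J \<le> j" if "(i, j) \<in> S" for i j
      unfolding J_def using fin that by (intro Min_le) (auto intro: rev_image_eqI)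
    have mIJ: "m = of_nat I + b * of_nat J" using IJ by (simp add: S_def)
    have weq: "real i + r * real j = real I + r * real J" if "(i, j) \<in> S" for i j
    proof -
      have "of_nat i + b * of_nat j = of_nat I + b * of_nat J" using that IJ by (simp add: S_def)
      thus ?thesis unfolding wr using r0 by (subst (asm) ennreal_inj) auto
    qed
    show False
    proof (cases "S = {(I, J)}")
      case True
      have "cf \<phi> I J \<noteq> 0" using IJ by (simp add: S_def)
      hence "\<nu> \<psi> = of_nat I + b * of_nat J"
        unfolding \<psi>_def True by (simp add: val_monomial[OF \<nu>] X1 b_def)
      thus False using \<psi>gt mIJ by simp
    next
      case False
      then obtain i1 j1 where ij1: "(i1, j1) \<in> S" "(i1, j1) \<noteq> (I, J)" using IJ by force
      \<comment> \<open>Two distinct exponents of equal weight express \<open>r\<close> as a slope,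
        hence as a rational \<open>p / q\<close> in lowest terms.\<close>
      have "j1 \<noteq> J" using weq[OF ij1(1)] ij1(2) by auto
      hence "r = (real I - real i1) / (real j1 - real J)"
        using weq[OF ij1(1)] by (simp add: field_simps)
      hence "r \<in> \<rat>" by simp
      then obtain p q where q0: "q \<noteq> 0" and rpq: "\<bar>r\<bar> = real p / real q" and cop: "coprime p q"
        by (rule Rats_abs_nat_div_natE)
      have rpq: "r * real q = real p" using rpq r0 q0 by (simp add: field_simps)
      have p0: "p > 0" using rpq r0 q0 by (cases p) auto
      \<comment> \<open>Coprimality of \<open>p\<close> and \<open>q\<close> makes every exponent on
        the segment an integral number \<open>k\<close> of steps \<open>(-p, q)\<close> away from
        \<open>(I, J)\<close>.\<close>
      have param: "\<exists>k. j = J + q * k \<and> I = i + p * k" if ij: "(i, j) \<in> S" for i j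
      proof -
        obtain d where d: "j = J + d" using Jle[OF ij] le_iff_add by blast
        have "real I = real i + r * real d" using weq[OF ij] by (simp add: d algebra_simps)
        hence "real I * real q = real i * real q + real d * (r * real q)"
          by (simp add: algebra_simps)
        hence "real (I * q) = real (i * q + d * p)" by (simp add: rpq)
        hence Iq: "I * q = i * q + d * p" by (simp only: of_nat_eq_iff)
        hence "q dvd d * p" by (metis dvd_add_right_iff dvd_triv_right)
        hence "q dvd d" using cop by (simp add: coprime_dvd_mult_left_iff coprime_commute)
        then obtain k where k: "d = q * k" by (elim dvdE)
        have "I * q = (i + p * k) * q" using Iq by (simp add: k algebra_simps)
        hence "I = i + p * k" using q0 by simp
        thus ?thesis using d k by blast
      qed
      \<comment> \<open>Coefficients along the segment, indexed by the number of steps; the guard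
        excludes truncated subtraction.\<close>
      define c where "c k = (if p * k \<le> I then cf \<psi> (I - p * k) (J + q * k) else 0)" for k
      have cS: "c k \<noteq> 0 \<longleftrightarrow> p * k \<le> I \<and> (I - p * k, J + q * k) \<in> S" for k
        by (auto simp: c_def c\<psi> S_def)
      define P where "P = (\<Sum>k\<le>I. monom (c k) k)"
      have kI: "k \<le> I" if "p * k \<le> I" for k
        using that p0 by (metis One_nat_def Suc_leI le_trans mult_le_mono1 nat_mult_1)
      have coP: "coeff P k = c k" for k
      proof -
        have "coeff P k = (if k \<le> I then c k else 0)" by (simp add: P_def coeff_sum)
        thus ?thesis using kI cS by auto
      qed
      have "coeff P 0 \<noteq> 0" unfolding coP cS using IJ by simp
      hence P0: "P \<noteq> 0" by auto
      define K where "K = degree P"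
      have "c K \<noteq> 0" using P0 by (metis coP K_def leading_coeff_neq_0)
      hence pK: "p * K \<le> I" using cS by blast
      have lin: "\<nu> (Y2 ^ q - const2 t * X2 ^ p) = of_nat p" for t
      proof -
        have "b * of_nat q = of_nat p"
          using rpq r0 by (simp add: br ennreal_mult'[symmetric] ennreal_of_nat_eq_real_of_nat)
        hence Yq: "\<nu> (Y2 ^ q) = of_nat p" by (simp add: val_power[OF \<nu>] b_def mult.commute)
        show ?thesis
        proof (cases "t = 0")
          case True
          thus ?thesis by (simp add: Yq)
        next
          case False
          have Xp: "\<nu> (const2 t * X2 ^ p) = of_nat p"
            using False by (simp add: val_mult[OF \<nu>] val_const[OF \<nu>] val_power[OF \<nu>] X1)
          \<comment> \<open>The pure power of \<open>X2\<close> survives because \<open>q\<close> is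
            positive; it caps the value at \<open>p\<close> through the hypothesis on
            \<open>mv 1 top\<close>.\<close>
          have "cf (Y2 ^ q - const2 t * X2 ^ p) p 0 = - t"
            using q0 cf_monomial[of 0 q p 0] cf_monomial[of p 0 p 0] by simp
          hence "mv 1 top (Y2 ^ q - const2 t * X2 ^ p) \<le> of_nat p"
            using mv_le[of "Y2 ^ q - const2 t * X2 ^ p" p 0 1 top] False by simp
          hence "\<nu> (Y2 ^ q - const2 t * X2 ^ p) \<le> of_nat p"
            using le_funD[OF le] order_trans by blast
          moreover have "of_nat p \<le> \<nu> (Y2 ^ q - const2 t * X2 ^ p)"
            using val_diff[OF \<nu>, of "Y2 ^ q" "const2 t * X2 ^ p"] by (simp add: Yq Xp)
          ultimately show ?thesis by (rule antisym)
        qed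
      qed
      define H where "H = (\<Sum>k\<le>K. const2 (c k) * ((X2 ^ p) ^ (K - k) * (Y2 ^ q) ^ k))"
      have H: "\<nu> H = of_nat K * of_nat p"
        using val_binary_form[OF \<nu> lin P0] by (simp add: H_def K_def coP)
      define g where "g k = (I - p * k, J + q * k)" for k
      \<comment> \<open>After the common monomial factor is removed, what remains is the binary form
        \<open>H\<close> in \<open>X2 ^ p\<close> and \<open>Y2 ^ q\<close>.\<close>
      have "\<psi> = X2 ^ (I - p * K) * Y2 ^ J * H"
      proof -
        have t: "X2 ^ (I - p * K) * Y2 ^ J * (const2 (c k) * ((X2 ^ p) ^ (K - k) * (Y2 ^ q) ^ k)) =
            const2 (c k) * (X2 ^ fst (g k) * Y2 ^ snd (g k))" if "k \<le> K" for k
        proof -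
          have "p * K = p * k + p * (K - k)" using that by (simp add: distrib_left[symmetric])
          hence "(I - p * K) + p * (K - k) = I - p * k" using pK by linarith
          hence "X2 ^ (I - p * k) = X2 ^ (I - p * K) * (X2 ^ p) ^ (K - k)"
            by (metis power_add power_mult)
          moreover have "Y2 ^ (J + q * k) = Y2 ^ J * (Y2 ^ q) ^ k" by (simp only: power_add power_mult)
          ultimately show ?thesis unfolding g_def fst_conv snd_conv by (simp only: ac_simps)
        qed
        let ?T = "{k. k \<le> K \<and> c k \<noteq> 0}"
        have inj: "inj_on g ?T" using q0 by (auto simp: inj_on_def g_def)
        have img: "g ` ?T = S"
        proof (intro equalityI subsetI)
          fix x assume "x \<in> g ` ?T"
          thus "x \<in> S" using cS by (auto simp: g_def)
        next
          fix x assume x: "x \<in> S"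
          obtain i j where xij: "x = (i, j)" by (cases x)
          obtain k where k: "j = J + q * k" "I = i + p * k" using param x xij by blast
          have ck: "c k \<noteq> 0" using cS x xij k by simp
          have "k \<le> K" unfolding K_def by (rule le_degree) (simp add: coP ck)
          thus "x \<in> g ` ?T" using ck k xij by (intro image_eqI[of _ _ k]) (auto simp: g_def)
        qed
        have "\<psi> = (\<Sum>k\<in>?T. const2 (cf \<phi> (fst (g k)) (snd (g k))) * (X2 ^ fst (g k) * Y2 ^ snd (g k)))"
          unfolding \<psi>_def img[symmetric] by (simp add: sum.reindex[OF inj])
        also have "\<dots> = (\<Sum>k\<in>?T. const2 (c k) * (X2 ^ fst (g k) * Y2 ^ snd (g k)))"
        proof (intro sum.cong refl)
          fix k assume "k \<in> ?T"
          hence "p * k \<le> I" "(I - p * k, J + q * k) \<in> S" using cS by auto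
          hence "c k = cf \<phi> (fst (g k)) (snd (g k))" by (simp add: c_def c\<psi> g_def)
          thus "const2 (cf \<phi> (fst (g k)) (snd (g k))) * (X2 ^ fst (g k) * Y2 ^ snd (g k)) =
              const2 (c k) * (X2 ^ fst (g k) * Y2 ^ snd (g k))" by simp
        qed
        also have "\<dots> = (\<Sum>k\<le>K. const2 (c k) * (X2 ^ fst (g k) * Y2 ^ snd (g k)))"
          by (intro sum.mono_neutral_left) auto
        also have "\<dots> = X2 ^ (I - p * K) * Y2 ^ J * H"
          unfolding H_def sum_distrib_left by (intro sum.cong refl) (simp add: t)
        finally show ?thesis .
      qed
      hence "\<nu> \<psi> = of_nat (I - p * K) + of_nat J * b + of_nat K * of_nat p"
        by (simp add: val_mult[OF \<nu>] val_power[OF \<nu>] X1 H b_def)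
      also have "\<dots> = of_nat (I - p * K + p * K) + b * of_nat J"
        by (simp only: of_nat_add of_nat_mult ac_simps)
      also have "\<dots> = m" using pK mIJ by simp
      finally show False using \<psi>gt by simp
    qed
  qed
qed

subsection \<open>Curve valuations of smooth curves\<close>

text \<open>Gaussian elimination on the first \<open>k\<close> coordinates. It bounds the dimension
  of a quotient ring from above.\<close>

lemma nontrivial_linear_relation:
  fixes v :: "'i \<Rightarrow> nat \<Rightarrow> complex"
  assumes "finite I" "k < card I"
  shows "\<exists>c. (\<exists>i\<in>I. c i \<noteq> 0) \<and> (\<forall>j<k. (\<Sum>i\<in>I. c i * v i j) = 0)"
  using assms
proof (induction k arbitrary: I v)
  case 0
  hence "I \<noteq> {}" by auto
  thus ?case by (intro exI[of _ "\<lambda>_. 1"]) auto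
next
  case (Suc k)
  show ?case
  proof (cases "\<forall>i\<in>I. v i k = 0")
    case True
    obtain c where c: "\<exists>i\<in>I. c i \<noteq> 0" "\<And>j. j < k \<Longrightarrow> (\<Sum>i\<in>I. c i * v i j) = 0"
      using Suc.IH[of I v] Suc.prems by auto
    have "(\<Sum>i\<in>I. c i * v i j) = 0" if "j < Suc k" for j
      using c(2) True that by (cases "j = k") auto
    thus ?thesis using c(1) by blast
  next
    case False
    then obtain p where p: "p \<in> I" "v p k \<noteq> 0" by blast
    \<comment> \<open>The vector \<open>v p\<close> is the pivot used to clear coordinate
      \<open>k\<close> from the other vectors.\<close>
    define v' where "v' i j = v i j - v i k / v p k * v p j" for i j
    have "k < card (I - {p})" using Suc.prems p by simp
    then obtain c where c: "\<exists>i\<in>I - {p}. c i \<noteq> 0"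
      and c0: "\<And>j. j < k \<Longrightarrow> (\<Sum>i\<in>I - {p}. c i * v' i j) = 0"
      using Suc.IH[of "I - {p}" v'] Suc.prems(1) by auto
    define d where "d i = (if i = p then - (\<Sum>i\<in>I - {p}. c i * v i k / v p k) else c i)" for i
    have s: "(\<Sum>i\<in>I. d i * v i j) = (\<Sum>i\<in>I - {p}. c i * v' i j)" for j
    proof -
      have "(\<Sum>i\<in>I. d i * v i j) = d p * v p j + (\<Sum>i\<in>I - {p}. d i * v i j)"
        using p Suc.prems(1) by (simp add: sum.remove)
      also have "(\<Sum>i\<in>I - {p}. d i * v i j) = (\<Sum>i\<in>I - {p}. c i * v i j)"
        by (intro sum.cong) (auto simp: d_def)
      also have "d p * v p j = - (\<Sum>i\<in>I - {p}. c i * v i k / v p k * v p j)"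
        by (simp add: d_def sum_distrib_right)
      finally show ?thesis
        by (simp add: v'_def right_diff_distrib sum_subtractf mult.assoc)
    qed
    have "(\<Sum>i\<in>I. d i * v i j) = 0" if "j < Suc k" for j
      using c0 that p unfolding s by (cases "j = k") (auto simp: v'_def)
    moreover have "\<exists>i\<in>I. d i \<noteq> 0" using c by (auto simp: d_def)
    ultimately show ?thesis by blast
  qed
qed

lemma ps2_split_Y2:
  assumes "\<And>i. i < k \<Longrightarrow> cf \<phi> i 0 = 0"
  obtains v g where "\<phi> = X2 ^ k * v + Y2 * g" "cf v 0 0 = cf \<phi> k 0"
proof
  define v where "v = Abs_fps (\<lambda>j. Abs_fps (\<lambda>i. if j = 0 then cf \<phi> (i + k) 0 else 0))"
  define g where "g = Abs_fps (\<lambda>j. Abs_fps (\<lambda>i. cf \<phi> i (Suc j)))"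
  have cv: "cf v i j = (if j = 0 then cf \<phi> (i + k) 0 else 0)" for i j by (simp add: v_def cf_def)
  have cg: "cf g i j = cf \<phi> i (Suc j)" for i j by (simp add: g_def cf_def)
  show "\<phi> = X2 ^ k * v + Y2 * g"
    by (rule ps2_eqI) (use assms in \<open>auto simp: cf_X2_power_mult cf_Y2_mult cv cg\<close>)
  show "cf v 0 0 = cf \<phi> k 0" by (simp add: cv)
qed

lemma Y2_dvd_iff: "Y2 dvd \<phi> \<longleftrightarrow> (\<forall>i. cf \<phi> i 0 = 0)"
proof
  assume *: "\<forall>i. cf \<phi> i 0 = 0"
  define g where "g = Abs_fps (\<lambda>j. Abs_fps (\<lambda>i. cf \<phi> i (Suc j)))"
  have "cf g i j = cf \<phi> i (Suc j)" for i j by (simp add: g_def cf_def)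
  hence "\<phi> = Y2 * g" using * by (intro ps2_eqI) (auto simp: cf_Y2_mult)
  thus "Y2 dvd \<phi>" by simp
qed (auto elim!: dvdE simp: cf_Y2_mult)

text \<open>Modulo \<open>Y2\<close> the ring is that of power series in \<open>X2\<close>, where
  every nonzero element is a power of \<open>X2\<close> times a unit.\<close>

lemma ps2_mod_Y2:
  assumes "\<not> Y2 dvd \<phi>"
  obtains k v g where "v dvd 1" "\<phi> = X2 ^ k * v + Y2 * g"
proof -
  define k where "k = (LEAST i. cf \<phi> i 0 \<noteq> 0)"
  have ex: "\<exists>i. cf \<phi> i 0 \<noteq> 0" using assms by (simp add: Y2_dvd_iff)
  have k: "cf \<phi> k 0 \<noteq> 0" unfolding k_def by (rule LeastI_ex[OF ex])
  have "cf \<phi> i 0 = 0" if "i < k" for i using not_less_Least[OF that[unfolded k_def]] by simp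
  then obtain v g where "\<phi> = X2 ^ k * v + Y2 * g" "cf v 0 0 = cf \<phi> k 0"
    using ps2_split_Y2[of k \<phi>] by blast
  thus ?thesis using that[of v k g] k ps2_is_unit[of v] by simp
qed

text \<open>The value at \<open>\<beta>\<close> need not be infinite; exceeding \<open>k\<close>
  suffices. The same computation thus applies to curve valuations and to far iterates in the basin
  of attraction.\<close>

lemma val_mod_curve:
  assumes "\<nu> \<in> VT" "\<nu> \<alpha> = 1" "of_nat k < \<nu> \<beta>" "v dvd 1"
  shows "\<nu> (\<alpha> ^ k * v + \<beta> * g) = of_nat k"
proof -
  have e: "\<nu> (\<alpha> ^ k * v) = of_nat k"
    using assms by (simp add: val_mult val_power val_unit)
  have "of_nat k < \<nu> (\<beta> * g)" using assms(3) by (simp add: val_mult[OF assms(1)] less_le_trans)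
  thus ?thesis using val_add_eq[OF assms(1), of "\<alpha> ^ k * v" "\<beta> * g"] e by simp
qed

lemma mv_top_cases:
  obtains "mv 1 top \<phi> = top" "Y2 dvd \<phi>"
  | k v g where "mv 1 top \<phi> = of_nat k" "v dvd 1" "\<phi> = X2 ^ k * v + Y2 * g"
proof (cases "Y2 dvd \<phi>")
  case True
  have "top \<le> mv 1 top \<phi>"
    using val_dvd[OF mv_VT True, of top] by (simp add: mv_Y2)
  thus ?thesis using that(1) True by (simp add: top_unique)
next
  case False
  then obtain k v g where kvg: "v dvd 1" "\<phi> = X2 ^ k * v + Y2 * g" by (rule ps2_mod_Y2)
  have "mv 1 top \<phi> = of_nat k"
    unfolding kvg(2) using kvg(1)
    by (intro val_mod_curve[of "mv 1 top" X2 k Y2 v g]) (simp_all add: mv_VT mv_X2 mv_Y2 of_nat_less_top)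
  thus ?thesis using that(2) kvg by blast
qed

text \<open>Membership becomes a condition on the restriction to \<open>Y2 = 0\<close>, whose order
  must reach that of \<open>\<phi>\<close>. For the converse, the unit \<open>v\<close> is inverted
  to express \<open>X2 ^ k\<close> by \<open>\<phi>\<close> modulo \<open>Y2\<close>.\<close>

lemma ideal2_Y2: "ideal2 Y2 \<phi> = {z. \<forall>i. of_nat i < mv 1 top \<phi> \<longrightarrow> cf z i 0 = 0}"
proof (intro equalityI subsetI CollectI allI impI)
  fix z i assume "z \<in> ideal2 Y2 \<phi>" and i: "of_nat i < mv 1 top \<phi>"
  then obtain a b where z: "z = a * Y2 + b * \<phi>" by (auto simp: ideal2_def)
  have "cf \<phi> i' 0 = 0" if "i' \<le> i" for i'
  proof (rule ccontr)
    assume "cf \<phi> i' 0 \<noteq> 0"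
    hence "mv 1 top \<phi> \<le> of_nat i'" using mv_le[of \<phi> i' 0 1 top] by simp
    also have "\<dots> \<le> of_nat i" using that by simp
    finally show False using i by simp
  qed
  hence "cf (b * \<phi>) i 0 = 0" by (simp add: cf_mult)
  thus "cf z i 0 = 0" by (simp add: z mult.commute[of a] cf_Y2_mult)
next
  fix z assume "z \<in> {z. \<forall>i. of_nat i < mv 1 top \<phi> \<longrightarrow> cf z i 0 = 0}"
  hence z: "\<And>i. of_nat i < mv 1 top \<phi> \<Longrightarrow> cf z i 0 = 0" by blast
  show "z \<in> ideal2 Y2 \<phi>"
  proof (cases rule: mv_top_cases[of \<phi>])
    case 1
    hence "Y2 dvd z" using z by (simp add: Y2_dvd_iff of_nat_less_top)
    then obtain g where "z = Y2 * g" by (elim dvdE)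
    hence "z = g * Y2 + 0 * \<phi>" by (simp add: mult.commute)
    thus ?thesis unfolding ideal2_def by blast
  next
    case (2 k v g)
    have "cf z i 0 = 0" if "i < k" for i using z[of i] 2(1) that by simp
    then obtain v' g' where z': "z = X2 ^ k * v' + Y2 * g'" and "cf v' 0 0 = cf z k 0"
      by (rule ps2_split_Y2)
    obtain w where w: "1 = v * w" using 2(2) by (elim dvdE)
    have "v' * w * \<phi> = X2 ^ k * v' * (v * w) + Y2 * (v' * w * g)"
      unfolding 2(3) by (simp only: distrib_left ac_simps)
    hence "z = (g' - v' * w * g) * Y2 + v' * w * \<phi>"
      unfolding z' w[symmetric] by (simp add: algebra_simps)
    thus ?thesis unfolding ideal2_def by blast
  qed
qed

text \<open>The powers of \<open>X2\<close> below the order of the restriction are independent, and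
  more than that many series satisfy a relation by counting coefficients. Infinite order allows
  arbitrarily long independent lists.\<close>

lemma imult_Y2: "imult Y2 \<phi> = mv 1 top \<phi>"
proof (rule antisym)
  show "imult Y2 \<phi> \<le> mv 1 top \<phi>"
    unfolding imult_def
  proof (rule SUP_least)
    fix n assume "n \<in> {n. \<exists>vs. length vs = n \<and> indep_mod Y2 \<phi> vs}"
    then obtain vs where vs: "length vs = n" "indep_mod Y2 \<phi> vs" by blast
    show "of_nat n \<le> mv 1 top \<phi>"
    proof (rule ccontr)
      assume lt: "\<not> of_nat n \<le> mv 1 top \<phi>"
      obtain k where k: "mv 1 top \<phi> = of_nat k" using lt by (cases rule: mv_top_cases[of \<phi>]) auto
      have "k < card {..<n}" using lt k by simp
      then obtain c where c: "\<exists>i\<in>{..<n}. c i \<noteq> 0"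
        "\<forall>j<k. (\<Sum>i<n. c i * cf (vs ! i) j 0) = 0"
        using nontrivial_linear_relation[of "{..<n}" k "\<lambda>i j. cf (vs ! i) j 0"] by auto
      define cs where "cs = map c [0..<n]"
      have cs: "length cs = n" "\<And>i. i < n \<Longrightarrow> cs ! i = c i" by (simp_all add: cs_def)
      have "(\<Sum>i<length vs. const2 (cs ! i) * vs ! i) \<in> ideal2 Y2 \<phi>"
        unfolding ideal2_Y2 k using c(2) cs vs(1) by simp
      hence "\<forall>i<length cs. cs ! i = 0" using vs cs unfolding indep_mod_def by blast
      thus False using c(1) cs by auto
    qed
  qed
next
  have le: "of_nat n \<le> imult Y2 \<phi>" if n: "of_nat n \<le> mv 1 top \<phi>" for n
  proof -
    define vs where "vs = map (\<lambda>i. X2 ^ i) [0..<n]"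
    have vs: "length vs = n" "\<And>i. i < n \<Longrightarrow> vs ! i = X2 ^ i" by (simp_all add: vs_def)
    have "indep_mod Y2 \<phi> vs"
      unfolding indep_mod_def
    proof (intro allI impI, elim conjE)
      fix cs :: "complex list" and k
      assume l: "length cs = length vs" and k: "k < length cs"
        and "(\<Sum>k<length vs. const2 (cs ! k) * vs ! k) \<in> ideal2 Y2 \<phi>"
      moreover have "of_nat k < mv 1 top \<phi>"
      proof -
        have "(of_nat k :: ennreal) < of_nat n" using k l vs(1) by simp
        thus ?thesis using n by (rule less_le_trans)
      qed
      ultimately have "cf (\<Sum>k<length vs. const2 (cs ! k) * vs ! k) k 0 = 0"
        unfolding ideal2_Y2 by blast
      moreover have "cf (\<Sum>k<length vs. const2 (cs ! k) * vs ! k) k 0 =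
          (\<Sum>i<n. if i = k then cs ! k else 0)"
        unfolding cf_sum cf_const2_mult vs(1)
      proof (intro sum.cong refl)
        fix i assume "i \<in> {..<n}"
        thus "cs ! i * cf (vs ! i) k 0 = (if i = k then cs ! k else 0)"
          using vs(2)[of i] cf_monomial[of i 0 k 0] by auto
      qed
      ultimately show "cs ! k = 0" using k l vs(1) by simp
    qed
    thus ?thesis unfolding imult_def using vs(1) by (intro SUP_upper) auto
  qed
  show "mv 1 top \<phi> \<le> imult Y2 \<phi>"
  proof (cases rule: mv_top_cases[of \<phi>])
    case 1
    have "imult Y2 \<phi> = top"
    proof (rule ccontr)
      assume "imult Y2 \<phi> \<noteq> top"
      then obtain n where "imult Y2 \<phi> < of_nat n" using ennreal_Ex_less_of_nat by (metis less_top)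
      thus False using le[of n] 1 by simp
    qed
    thus ?thesis by simp
  next
    case (2 k v g)
    show ?thesis unfolding 2(1) by (rule le) (simp only: 2(1) order_refl)
  qed
qed

section \<open>Coordinate invariance of the intersection multiplicity; smooth curves\<close>

lemma imult_commute: "imult \<psi> \<phi> = imult \<phi> \<psi>"
proof -
  have "ideal2 \<psi> \<phi> \<subseteq> ideal2 \<phi> \<psi>" for \<psi> \<phi>
    unfolding ideal2_def using add.commute by blast
  hence "ideal2 \<psi> \<phi> = ideal2 \<phi> \<psi>" by blast
  thus ?thesis by (simp add: imult_def indep_mod_def)
qed

text \<open>Substituting coordinates is a ring automorphism fixing constants, so it carries
  independent lists to independent lists. The inverse substitution gives the opposite
  inequality.\<close>

lemma imult_pcomp_le:
  assumes "coords a b"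
  shows "imult \<psi> \<phi> \<le> imult (pcomp \<psi> a b) (pcomp \<phi> a b)"
proof -
  obtain p q where pq: "coords p q" "pcomp a p q = X2" "pcomp b p q = Y2"
    "pcomp p a b = X2" "pcomp q a b = Y2"
    using coords_inverse[OF assms] .
  note mm = coords_mm[OF assms] coords_mm[OF pq(1)]
  have inv: "pcomp (pcomp z a b) p q = z" for z using pcomp_inverse mm pq by blast
  have "indep_mod (pcomp \<psi> a b) (pcomp \<phi> a b) (map (\<lambda>z. pcomp z a b) vs)"
    if ind: "indep_mod \<psi> \<phi> vs" for vs
    unfolding indep_mod_def length_map
  proof (intro allI impI, elim conjE)
    fix cs :: "complex list" and k
    assume l: "length cs = length vs" and k: "k < length cs"
      and "(\<Sum>k<length vs. const2 (cs ! k) * map (\<lambda>z. pcomp z a b) vs ! k)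
        \<in> ideal2 (pcomp \<psi> a b) (pcomp \<phi> a b)"
    then obtain A B where "(\<Sum>k<length vs. const2 (cs ! k) * map (\<lambda>z. pcomp z a b) vs ! k) =
        A * pcomp \<psi> a b + B * pcomp \<phi> a b" by (auto simp: ideal2_def)
    hence "pcomp (\<Sum>k<length vs. const2 (cs ! k) * vs ! k) a b = A * pcomp \<psi> a b + B * pcomp \<phi> a b"
      by (simp add: pcomp_sum pcomp_const2_mult_left)
    hence "pcomp (pcomp (\<Sum>k<length vs. const2 (cs ! k) * vs ! k) a b) p q =
        pcomp (A * pcomp \<psi> a b + B * pcomp \<phi> a b) p q" by simp
    hence "(\<Sum>k<length vs. const2 (cs ! k) * vs ! k) = pcomp A p q * \<psi> + pcomp B p q * \<phi>"
      using mm by (simp add: inv pcomp_add pcomp_mult)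
    hence "(\<Sum>k<length vs. const2 (cs ! k) * vs ! k) \<in> ideal2 \<psi> \<phi>" unfolding ideal2_def by blast
    thus "cs ! k = 0" using ind l k unfolding indep_mod_def by blast
  qed
  hence "{n. \<exists>vs. length vs = n \<and> indep_mod \<psi> \<phi> vs} \<subseteq>
      {n. \<exists>vs. length vs = n \<and> indep_mod (pcomp \<psi> a b) (pcomp \<phi> a b) vs}"
    using length_map by blast
  thus ?thesis unfolding imult_def by (rule SUP_subset_mono) simp
qed

lemma imult_pcomp:
  assumes "coords a b"
  shows "imult (pcomp \<psi> a b) (pcomp \<phi> a b) = imult \<psi> \<phi>"
proof (rule antisym[OF _ imult_pcomp_le[OF assms]])
  obtain p q where pq: "coords p q" "pcomp a p q = X2" "pcomp b p q = Y2"
    "pcomp p a b = X2" "pcomp q a b = Y2"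
    using coords_inverse[OF assms] .
  note mm = coords_mm[OF assms] coords_mm[OF pq(1)]
  have inv: "pcomp (pcomp z a b) p q = z" for z using pcomp_inverse mm pq by blast
  show "imult (pcomp \<psi> a b) (pcomp \<phi> a b) \<le> imult \<psi> \<phi>"
    using imult_pcomp_le[OF pq(1), of "pcomp \<psi> a b" "pcomp \<phi> a b"] by (simp add: inv)
qed

lemma mult2_coord:
  assumes "coords \<alpha> \<beta>"
  shows "mult2 \<beta> = 1"
  unfolding mult2_def
proof (rule Least_equality)
  have "cf \<beta> 0 1 \<noteq> 0 \<or> cf \<beta> 1 0 \<noteq> 0" using assms by (auto simp: coords_def)
  thus "\<exists>i j. i + j = 1 \<and> cf \<beta> i j \<noteq> 0"
    by (intro exI[of _ "if cf \<beta> 0 1 \<noteq> 0 then 0 else 1"] exI[of _ "if cf \<beta> 0 1 \<noteq> 0 then 1 else 0"]) auto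
next
  fix n assume "\<exists>i j. i + j = n \<and> cf \<beta> i j \<noteq> 0"
  thus "1 \<le> n" using coords_mm(2)[OF assms] by (cases n) (auto simp: mm_def)
qed

text \<open>A product of two non-units has order at least 2, whereas a coordinate has a nonzero
  linear part.\<close>

lemma is_curve_coord:
  assumes "coords \<alpha> \<beta>"
  shows "is_curve \<beta>"
proof -
  have lin: "cf \<beta> 0 1 \<noteq> 0 \<or> cf \<beta> 1 0 \<noteq> 0" using assms by (auto simp: coords_def)
  have m: "\<beta> \<in> mm" by (rule coords_mm(2)[OF assms])
  have "irreducible \<beta>"
  proof (rule irreducibleI)
    show "\<beta> \<noteq> 0" using lin by auto
    show "\<not> \<beta> dvd 1" using m by (simp add: ps2_unit_iff mm_def)
  next
    fix a b assume ab: "\<beta> = a * b"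
    show "a dvd 1 \<or> b dvd 1"
    proof (rule ccontr)
      assume "\<not> ?thesis"
      hence "a \<in> mpow 1" "b \<in> mpow 1" unfolding mm_eq_mpow[symmetric] by (auto simp: ps2_unit_iff mm_def)
      hence "\<beta> \<in> mpow (1 + 1)" unfolding ab by (rule mpow_mult)
      thus False using lin by (auto simp: mpow_def)
    qed
  qed
  thus ?thesis using m by (simp add: is_curve_def)
qed

lemma curve_val_coord:
  assumes "coords \<alpha> \<beta>"
  shows "curve_val \<beta> \<phi> = imult \<beta> \<phi>"
  by (simp add: curve_val_def mult2_coord[OF assms] divide_ennreal_def)

text \<open>The family \<open>M\<close> is \<open>mv 1 t\<close> transported to the coordinates
  \<open>(\<alpha>, \<beta>)\<close>. It parametrises the segment from the root of the tree up to
  the curve valuation; the last conjunct says that every valuation below the curve lies on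
  it.\<close>

lemma monomial_valuations:
  assumes "coords \<alpha> \<beta>"
  shows "\<exists>M. (\<forall>t\<ge>1. M t \<in> VT) \<and> (\<forall>t. M t \<alpha> = 1 \<and> M t \<beta> = t) \<and> mono M \<and> M top = curve_val \<beta> \<and>
    (\<forall>\<nu>\<in>VT. M (\<nu> \<beta>) \<le> \<nu> \<and> (\<nu> \<le> M top \<longrightarrow> \<nu> \<le> M (\<nu> \<beta>)))"
proof -
  obtain p q where pq: "coords p q" "pcomp \<alpha> p q = X2" "pcomp \<beta> p q = Y2"
    "pcomp p \<alpha> \<beta> = X2" "pcomp q \<alpha> \<beta> = Y2"
    using coords_inverse[OF assms] .
  note mm = coords_mm[OF assms] coords_mm[OF pq(1)]
  have inv: "pcomp (pcomp z \<alpha> \<beta>) p q = z" "pcomp (pcomp z p q) \<alpha> \<beta> = z" for z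
    using pcomp_inverse mm pq by blast+
  define M where "M t = (\<lambda>\<phi>. mv 1 t (pcomp \<phi> p q))" for t
  have top: "M top = curve_val \<beta>"
  proof
    fix \<phi>
    have "curve_val \<beta> \<phi> = imult (pcomp Y2 \<alpha> \<beta>) (pcomp (pcomp \<phi> p q) \<alpha> \<beta>)"
      using mm by (simp add: curve_val_coord[OF assms] inv pcomp_Y2)
    also have "\<dots> = M top \<phi>" by (simp add: imult_pcomp[OF assms] imult_Y2 M_def)
    finally show "M top \<phi> = curve_val \<beta> \<phi>" ..
  qed
  have VT: "(\<lambda>\<phi>. \<nu> (pcomp \<phi> \<alpha> \<beta>)) \<in> VT" if "\<nu> \<in> VT" for \<nu> by (rule val_pcomp_VT[OF that assms])
  have "M t \<in> VT" if "1 \<le> t" for t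
      unfolding M_def by (rule val_pcomp_VT[OF mv_VT[OF that] pq(1)])
  moreover have "M t \<alpha> = 1" "M t \<beta> = t" for t by (simp_all add: M_def pq mv_X2 mv_Y2)
  moreover have "mono M" by (auto simp: mono_def M_def le_fun_def intro: mv_mono)
  moreover have "M (\<nu> \<beta>) \<le> \<nu>" if "\<nu> \<in> VT" for \<nu>
    proof (rule le_funI)
      fix \<phi>
      have "M (\<nu> \<beta>) \<phi> \<le> mv (\<nu> \<alpha>) (\<nu> \<beta>) (pcomp \<phi> p q)"
        unfolding M_def using val_mm[OF that mm(1)] by (intro mv_mono) auto
      also have "\<dots> \<le> \<nu> \<phi>"
        using mv_le_val[OF VT[OF that], of "pcomp \<phi> p q"] mm by (simp add: inv pcomp_X2 pcomp_Y2)
      finally show "M (\<nu> \<beta>) \<phi> \<le> \<nu> \<phi>" .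
    qed
  moreover have "\<nu> \<le> M (\<nu> \<beta>)" if "\<nu> \<in> VT" "\<nu> \<le> M top" for \<nu>
    proof (rule le_funI)
      fix \<phi>
      have "(\<lambda>\<phi>. \<nu> (pcomp \<phi> \<alpha> \<beta>)) \<le> mv 1 top"
      proof (rule le_funI)
        fix z show "\<nu> (pcomp z \<alpha> \<beta>) \<le> mv 1 top z"
          using le_funD[OF that(2), of "pcomp z \<alpha> \<beta>"] by (simp add: M_def inv)
      qed
      from val_le_mv[OF VT[OF that(1)] this, of "pcomp \<phi> p q"]
      show "\<nu> \<phi> \<le> M (\<nu> \<beta>) \<phi>" using mm by (simp add: inv pcomp_Y2 M_def)
    qed
  ultimately show ?thesis using top by blast
qed

section \<open>Valuations in formal coordinates\<close>

lemma coords_mm_split: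
  assumes "coords \<alpha> \<beta>" "\<phi> \<in> mm"
  obtains r s where "\<phi> = \<alpha> * r + \<beta> * s"
proof -
  obtain p q where pq: "coords p q" "pcomp \<alpha> p q = X2" "pcomp \<beta> p q = Y2"
    "pcomp p \<alpha> \<beta> = X2" "pcomp q \<alpha> \<beta> = Y2"
    using coords_inverse[OF assms(1)] .
  note mm = coords_mm[OF assms(1)] coords_mm[OF pq(1)]
  have "pcomp \<phi> p q \<in> mpow (Suc 0)" using pcomp_mm[OF mm(3,4) assms(2)] by (simp add: mm_eq_mpow)
  then obtain r s where rs: "pcomp \<phi> p q = X2 * r + Y2 * s" by (rule ps2_split_X2_Y2)
  have "\<phi> = pcomp (pcomp \<phi> p q) \<alpha> \<beta>" using pcomp_inverse mm pq by simp
  also have "\<dots> = \<alpha> * pcomp r \<alpha> \<beta> + \<beta> * pcomp s \<alpha> \<beta>"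
    unfolding rs using mm by (simp add: pcomp_add pcomp_mult pcomp_X2 pcomp_Y2)
  finally show ?thesis by (rule that)
qed

lemma coords_mod_curve:
  assumes "coords \<alpha> \<beta>" "\<not> \<beta> dvd \<phi>"
  obtains k v g where "v dvd 1" "\<phi> = \<alpha> ^ k * v + \<beta> * g"
proof -
  obtain p q where pq: "coords p q" "pcomp \<alpha> p q = X2" "pcomp \<beta> p q = Y2"
    "pcomp p \<alpha> \<beta> = X2" "pcomp q \<alpha> \<beta> = Y2"
    using coords_inverse[OF assms(1)] .
  note mm = coords_mm[OF assms(1)] coords_mm[OF pq(1)]
  have inv: "\<phi> = pcomp (pcomp \<phi> p q) \<alpha> \<beta>" using pcomp_inverse mm pq by simp
  have "\<not> Y2 dvd pcomp \<phi> p q"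
  proof
    assume "Y2 dvd pcomp \<phi> p q"
    then obtain g where "pcomp \<phi> p q = Y2 * g" by (elim dvdE)
    hence "\<phi> = \<beta> * pcomp g \<alpha> \<beta>" using inv mm by (simp add: pcomp_mult pcomp_Y2)
    thus False using assms(2) by simp
  qed
  then obtain k v g where kvg: "v dvd 1" "pcomp \<phi> p q = X2 ^ k * v + Y2 * g" by (rule ps2_mod_Y2)
  have "\<phi> = \<alpha> ^ k * pcomp v \<alpha> \<beta> + \<beta> * pcomp g \<alpha> \<beta>"
    using inv unfolding kvg(2) using mm
    by (simp add: pcomp_add pcomp_mult pcomp_X2 pcomp_Y2 pcomp_power)
  moreover have "pcomp v \<alpha> \<beta> dvd 1"
  proof -
    have "cf (pcomp v \<alpha> \<beta>) 0 0 = cf v 0 0" by (simp add: cf_pcomp cf_1)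
    thus ?thesis using kvg(1) by (simp add: ps2_unit_iff)
  qed
  ultimately show ?thesis using that by blast
qed

text \<open>The coordinates generate the maximal ideal, so its minimal value 1 is attained at one of
  them.\<close>

lemma val_coords_min:
  assumes "\<nu> \<in> VT" "coords \<alpha> \<beta>"
  shows "min (\<nu> \<alpha>) (\<nu> \<beta>) = 1"
proof (rule antisym)
  obtain \<phi> where \<phi>: "\<phi> \<in> mm" "\<nu> \<phi> = 1" using assms(1) by (auto simp: VT_def is_valuation_def)
  obtain r s where rs: "\<phi> = \<alpha> * r + \<beta> * s" using coords_mm_split[OF assms(2) \<phi>(1)] .
  have "min (\<nu> \<alpha>) (\<nu> \<beta>) \<le> min (\<nu> (\<alpha> * r)) (\<nu> (\<beta> * s))"
    unfolding val_mult[OF assms(1)] by (intro min.mono) simp_all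
  also have "\<dots> \<le> 1" using val_add[OF assms(1), of "\<alpha> * r" "\<beta> * s"] \<phi>(2) by (simp add: rs)
  finally show "min (\<nu> \<alpha>) (\<nu> \<beta>) \<le> 1" .
  show "1 \<le> min (\<nu> \<alpha>) (\<nu> \<beta>)" using val_mm[OF assms(1)] coords_mm[OF assms(2)] by simp
qed

lemma curve_val_facts:
  assumes "coords \<alpha> \<beta>"
  shows "curve_val \<beta> \<in> VT" "curve_val \<beta> \<alpha> = 1" "curve_val \<beta> \<beta> = top"
proof -
  obtain M where M: "\<forall>t\<ge>1. M t \<in> VT" "\<forall>t. M t \<alpha> = 1 \<and> M t \<beta> = t" "M top = curve_val \<beta>"
    using monomial_valuations[OF assms] by blast
  show "curve_val \<beta> \<in> VT" "curve_val \<beta> \<alpha> = 1" "curve_val \<beta> \<beta> = top"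
    using M by (metis top_greatest)+
qed

text \<open>Normalisation forces \<open>\<nu> \<alpha> = 1\<close>; modulo \<open>\<beta>\<close> a
  series is a power of \<open>\<alpha>\<close> times a unit, so no freedom is left.\<close>

lemma val_eq_curve_val:
  assumes "\<nu> \<in> VT" "coords \<alpha> \<beta>" "\<nu> \<beta> = top"
  shows "\<nu> = curve_val \<beta>"
proof
  fix \<phi>
  note cv = curve_val_facts[OF assms(2)]
  have a1: "\<nu> \<alpha> = 1" using val_coords_min[OF assms(1,2)] assms(3) by simp
  show "\<nu> \<phi> = curve_val \<beta> \<phi>"
  proof (cases "\<beta> dvd \<phi>")
    case True
    thus ?thesis using val_dvd[OF assms(1) True] val_dvd[OF cv(1) True] assms(3) cv(3)
      by (simp add: top_unique)
  next
    case False
    then obtain k v g where kvg: "v dvd 1" "\<phi> = \<alpha> ^ k * v + \<beta> * g"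
      by (rule coords_mod_curve[OF assms(2)])
    have "\<nu> \<phi> = of_nat k"
      unfolding kvg(2) using kvg(1)
      by (intro val_mod_curve[of \<nu> \<alpha> k \<beta> v g]) (simp_all add: assms a1 of_nat_less_top)
    moreover have "curve_val \<beta> \<phi> = of_nat k"
      unfolding kvg(2) using kvg(1)
      by (intro val_mod_curve[of "curve_val \<beta>" \<alpha> k \<beta> v g]) (simp_all add: cv of_nat_less_top)
    ultimately show ?thesis by simp
  qed
qed

lemma curve_val_top_iff:
  assumes "coords \<alpha> \<beta>"
  shows "curve_val \<beta> \<phi> = top \<longleftrightarrow> \<beta> dvd \<phi>"
proof
  note cv = curve_val_facts[OF assms]
  assume t: "curve_val \<beta> \<phi> = top"
  show "\<beta> dvd \<phi>"
  proof (rule ccontr)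
    assume "\<not> ?thesis"
    then obtain k v g where kvg: "v dvd 1" "\<phi> = \<alpha> ^ k * v + \<beta> * g"
      by (rule coords_mod_curve[OF assms])
    have "curve_val \<beta> \<phi> = of_nat k"
      unfolding kvg(2) using kvg(1)
      by (intro val_mod_curve[of "curve_val \<beta>" \<alpha> k \<beta> v g]) (simp_all add: cv of_nat_less_top)
    thus False using t by simp
  qed
next
  assume "\<beta> dvd \<phi>"
  thus "curve_val \<beta> \<phi> = top"
    using val_dvd[OF curve_val_facts(1)[OF assms]] curve_val_facts(3)[OF assms]
    by (metis top_unique)
qed

lemma coords_mult_unit:
  assumes "coords \<alpha> \<beta>" "v dvd 1"
  shows "coords \<alpha> (\<beta> * v)"
proof -
  have v: "cf v 0 0 \<noteq> 0" using assms(2) by (simp add: ps2_unit_iff)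
  have z: "cf \<beta> 0 0 = 0" using coords_mm(2)[OF assms(1)] by (simp add: mm_def)
  have c: "cf (\<beta> * v) 1 0 = cf \<beta> 1 0 * cf v 0 0" "cf (\<beta> * v) 0 1 = cf \<beta> 0 1 * cf v 0 0"
    "cf (\<beta> * v) 0 0 = 0"
    using z by (simp_all add: cf_mult)
  have "cf \<alpha> 1 0 * cf (\<beta> * v) 0 1 - cf \<alpha> 0 1 * cf (\<beta> * v) 1 0 =
      (cf \<alpha> 1 0 * cf \<beta> 0 1 - cf \<alpha> 0 1 * cf \<beta> 1 0) * cf v 0 0"
    unfolding c by (simp add: algebra_simps)
  thus ?thesis using assms(1) v c(3) by (simp add: coords_def mm_def)
qed

text \<open>Equations of one curve differ by a unit. This identifies an irreducible
  \<open>\<psi>\<close> divisible by a coordinate with that coordinate at the level of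
  valuations.\<close>

lemma curve_val_mult_unit:
  assumes "coords \<alpha> \<beta>" "v dvd 1"
  shows "curve_val (\<beta> * v) = curve_val \<beta>"
proof (rule val_eq_curve_val[OF _ assms(1)])
  note co = coords_mult_unit[OF assms]
  show VT: "curve_val (\<beta> * v) \<in> VT" by (rule curve_val_facts(1)[OF co])
  show "curve_val (\<beta> * v) \<beta> = top"
    using curve_val_facts(3)[OF co] val_mult[OF VT, of \<beta> v] val_unit[OF VT assms(2)] by simp
qed

subsection \<open>Curve valuations are not quasimonomial\<close>

text \<open>The blow-up chart maps exponents injectively, so the coefficient at
  \<open>(i, j)\<close> reappears at \<open>(i + j, j)\<close>.\<close>

lemma pcomp_blow_up_eq_0:
  assumes "pcomp \<phi> X2 (X2 * Y2) = 0"
  shows "\<phi> = 0"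
proof (rule ps2_eqI)
  fix i j :: nat
  have e: "X2 ^ a * (X2 * Y2) ^ b = X2 ^ (a + b) * Y2 ^ b" for a b
    by (simp add: power_mult_distrib power_add mult.assoc)
  let ?n = "i + j + j"
  have "cf (pcomp \<phi> X2 (X2 * Y2)) (i + j) j =
      (\<Sum>a\<le>?n. \<Sum>b\<le>?n. if a = i then (if b = j then cf \<phi> i j else 0) else 0)"
    unfolding cf_pcomp e cf_monomial by (intro sum.cong) auto
  also have "\<dots> = (\<Sum>a\<le>?n. if a = i then cf \<phi> i j else 0)"
    by (intro sum.cong) auto
  also have "\<dots> = cf \<phi> i j" by simp
  finally show "cf \<phi> i j = cf 0 i j" using assms by simp
qed

lemma modif_injective:
  assumes "(P, Q) \<in> modif"
  shows "P \<in> mm \<and> Q \<in> mm \<and> (\<forall>\<phi>. pcomp \<phi> P Q = 0 \<longrightarrow> \<phi> = 0)"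
  using assms
proof (induction rule: modif.induct)
  case modif_id
  show ?case by (simp add: pcomp_id)
next
  case (modif_aut P Q g1 g2)
  have co: "coords g1 g2" using modif_aut by (simp add: coords_def)
  obtain p q where pq: "coords p q" "pcomp g1 p q = X2" "pcomp g2 p q = Y2"
    "pcomp p g1 g2 = X2" "pcomp q g1 g2 = Y2"
    using coords_inverse[OF co] .
  note mm = coords_mm[OF co] coords_mm[OF pq(1)]
  have "\<phi> = 0" if "pcomp \<phi> (pcomp P g1 g2) (pcomp Q g1 g2) = 0" for \<phi>
  proof -
    have "pcomp (pcomp \<phi> P Q) g1 g2 = 0"
      using that conjunct1[OF modif_aut.IH] conjunct1[OF conjunct2[OF modif_aut.IH]] mm
      by (simp add: pcomp_assoc)
    hence "pcomp (pcomp (pcomp \<phi> P Q) g1 g2) p q = 0" by simp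
    hence "pcomp \<phi> P Q = 0" using pcomp_inverse mm pq by simp
    thus ?thesis using modif_aut by blast
  qed
  moreover have "pcomp P g1 g2 \<in> mm" "pcomp Q g1 g2 \<in> mm"
    using modif_aut.IH mm pcomp_mm by blast+
  ultimately show ?case by blast
next
  case (modif_blow P Q)
  have m: "X2 * Y2 \<in> mm" by (simp add: mm_def cf_X2_mult)
  have "\<phi> = 0" if "pcomp \<phi> (pcomp P X2 (X2 * Y2)) (pcomp Q X2 (X2 * Y2)) = 0" for \<phi>
  proof -
    have "pcomp (pcomp \<phi> P Q) X2 (X2 * Y2) = 0"
      using that conjunct1[OF modif_blow.IH] conjunct1[OF conjunct2[OF modif_blow.IH]] m
      by (simp add: pcomp_assoc)
    thus ?thesis using pcomp_blow_up_eq_0 modif_blow by blast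
  qed
  moreover have "pcomp P X2 (X2 * Y2) \<in> mm" "pcomp Q X2 (X2 * Y2) \<in> mm"
    using modif_blow.IH m mm_X2 pcomp_mm by blast+
  ultimately show ?case by blast
qed

text \<open>Pulling back to a modification keeps a nonzero series nonzero, and real weights give a
  nonzero series a finite value.\<close>

lemma not_quasimonomial:
  assumes "\<nu> \<psi> = top" "\<psi> \<noteq> 0"
  shows "\<not> quasimonomial \<nu>"
proof
  assume "quasimonomial \<nu>"
  then obtain P Q s t where PQ: "(P, Q) \<in> modif" and \<nu>: "\<And>\<phi>. \<nu> \<phi> = monoval s t (pcomp \<phi> P Q)"
    unfolding quasimonomial_def by force
  have "pcomp \<psi> P Q \<noteq> 0" using modif_injective[OF PQ] assms(2) by blast
  then obtain i j where "cf (pcomp \<psi> P Q) i j \<noteq> 0" using ps2_eqI[of "pcomp \<psi> P Q" 0] by auto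
  hence "monoval s t (pcomp \<psi> P Q) \<le> ennreal (s * real i + t * real j)"
    unfolding monoval_def by (intro INF_lower2[of "(i, j)"]) auto
  hence "(top::ennreal) \<le> ennreal (s * real i + t * real j)" using \<nu>[of \<psi>] assms(1) by simp
  thus False by (simp add: top_unique)
qed

text \<open>A series divisible by all powers of a non-unit lies in every \<open>mpow n\<close> and
  is zero, so the extraction of factors stops.\<close>

lemma coord_power_factor:
  assumes "\<alpha> \<in> mm" "\<phi> \<noteq> 0"
  shows "\<exists>k g. \<phi> = \<alpha> ^ k * g \<and> \<not> \<alpha> dvd g"
proof (rule ccontr)
  assume no: "\<not> ?thesis"
  have dv: "\<exists>g. \<phi> = \<alpha> ^ n * g" for n
  proof (induction n)
    case (Suc n)
    then obtain g where g: "\<phi> = \<alpha> ^ n * g" by blast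
    then obtain g' where "g = \<alpha> * g'" using no by (metis dvdE)
    thus ?case using g by (intro exI[of _ g']) (simp add: ac_simps)
  qed (use assms in simp)
  have "\<phi> = 0"
  proof (rule mpow_imp_eq)
    fix n
    obtain g where "\<phi> = \<alpha> ^ n * g" using dv by blast
    thus "\<phi> - 0 \<in> mpow n" using mpow_mult_right[OF mpow_power[OF assms(1)]] by simp
  qed
  thus False using assms(2) by simp
qed

subsection \<open>The induced dynamics on valuations\<close>

text \<open>The germ stays in its original coordinates, to which \<open>cfv\<close> and
  \<open>fpush\<close> refer; the normal form enters only through pull-backs of
  \<open>\<alpha>\<close> and \<open>\<beta>\<close>.\<close>

locale invariant_coords =
  fixes f1 f2 \<alpha> \<beta> u w :: ps2
  assumes f_mm: "f1 \<in> mm" "f2 \<in> mm" and co: "coords \<alpha> \<beta>"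
    and pull_\<alpha>: "pcomp \<alpha> f1 f2 = \<alpha> * u" and u: "u dvd 1"
    and pull_\<beta>: "pcomp \<beta> f1 f2 = \<beta> * w" and w: "w \<in> mm"
begin

lemmas co' = coords_swap[OF co]

lemma val_pull_\<alpha>: "\<nu> \<in> VT \<Longrightarrow> \<nu> (pcomp \<alpha> f1 f2) = \<nu> \<alpha>"
  and val_pull_\<beta>: "\<nu> \<in> VT \<Longrightarrow> \<nu> (pcomp \<beta> f1 f2) = \<nu> \<beta> + \<nu> w"
  by (simp_all add: pull_\<alpha> pull_\<beta> val_mult val_unit u)

text \<open>The pull-back of the maximal ideal is generated by the pull-backs of any coordinate
  pair. Applied to \<open>(X2, Y2)\<close> and to \<open>(\<alpha>, \<beta>)\<close>, this makes
  \<open>cfv\<close> computable in either.\<close>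

lemma val_pull_ge:
  assumes "\<nu> \<in> VT" "coords a b" "\<phi> \<in> mm"
  shows "min (\<nu> (pcomp a f1 f2)) (\<nu> (pcomp b f1 f2)) \<le> \<nu> (pcomp \<phi> f1 f2)"
proof -
  obtain r s where rs: "\<phi> = a * r + b * s" using coords_mm_split[OF assms(2,3)] .
  have "min (\<nu> (pcomp a f1 f2)) (\<nu> (pcomp b f1 f2)) \<le>
      min (\<nu> (pcomp a f1 f2 * pcomp r f1 f2)) (\<nu> (pcomp b f1 f2 * pcomp s f1 f2))"
    unfolding val_mult[OF assms(1)] by (intro min.mono) simp_all
  also have "\<dots> \<le> \<nu> (pcomp \<phi> f1 f2)"
    unfolding rs pcomp_add pcomp_mult[OF f_mm] by (rule val_add[OF assms(1)])
  finally show ?thesis .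
qed

lemma cfv_eq:
  assumes "\<nu> \<in> VT"
  shows "cfv f1 f2 \<nu> = min (\<nu> \<alpha>) (\<nu> \<beta> + \<nu> w)"
proof (rule antisym)
  have m: "\<alpha> \<in> mm" "\<beta> \<in> mm" using coords_mm[OF co] .
  show "cfv f1 f2 \<nu> \<le> min (\<nu> \<alpha>) (\<nu> \<beta> + \<nu> w)"
    using val_pull_ge[OF assms coords_X2_Y2 m(1)] val_pull_ge[OF assms coords_X2_Y2 m(2)]
    by (simp add: cfv_def pcomp_X2[OF f_mm] pcomp_Y2[OF f_mm] val_pull_\<alpha>[OF assms] val_pull_\<beta>[OF assms])
  show "min (\<nu> \<alpha>) (\<nu> \<beta> + \<nu> w) \<le> cfv f1 f2 \<nu>"
    using val_pull_ge[OF assms co mm_X2] val_pull_ge[OF assms co mm_Y2]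
    by (simp add: cfv_def pcomp_X2[OF f_mm] pcomp_Y2[OF f_mm] val_pull_\<alpha>[OF assms] val_pull_\<beta>[OF assms])
qed

lemma cfv_ge_1: "\<nu> \<in> VT \<Longrightarrow> 1 \<le> cfv f1 f2 \<nu>"
  using f_mm by (simp add: cfv_def val_mm)

lemma fpush0_VT:
  assumes \<nu>: "\<nu> \<in> VT" and fin: "cfv f1 f2 \<nu> < top"
  shows "fpush0 f1 f2 \<nu> \<in> VT"
proof -
  define c where "c = cfv f1 f2 \<nu>"
  have c: "1 \<le> c" "c < top" using fin cfv_ge_1[OF \<nu>] by (simp_all add: c_def)
  have c0: "c \<noteq> 0" using c(1) by auto
  have e: "fpush0 f1 f2 \<nu> \<phi> = \<nu> (pcomp \<phi> f1 f2) / c" for \<phi> by (simp add: fpush0_def c_def)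
  have "min (fpush0 f1 f2 \<nu> \<phi>) (fpush0 f1 f2 \<nu> \<psi>) \<le> fpush0 f1 f2 \<nu> (\<phi> + \<psi>)" for \<phi> \<psi>
    unfolding e pcomp_add using val_add[OF \<nu>, of "pcomp \<phi> f1 f2" "pcomp \<psi> f1 f2"]
    by (auto simp: min_le_iff_disj intro: divide_right_mono_ennreal)
  moreover have "1 \<le> fpush0 f1 f2 \<nu> \<phi>" if "\<phi> \<in> mm" for \<phi>
  proof -
    have "c \<le> \<nu> (pcomp \<phi> f1 f2)"
      using val_pull_ge[OF \<nu> coords_X2_Y2 that] by (simp add: c_def cfv_def pcomp_X2[OF f_mm] pcomp_Y2[OF f_mm])
    hence "c / c \<le> \<nu> (pcomp \<phi> f1 f2) / c" by (rule divide_right_mono_ennreal)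
    thus ?thesis using c c0 by (simp add: e)
  qed
  moreover have "\<exists>\<phi>\<in>mm. fpush0 f1 f2 \<nu> \<phi> = 1"
  proof -
    \<comment> \<open>The pushed valuation is normalised because \<open>c\<close> is by definition
      attained at one component of the germ.\<close>
    have "\<nu> f1 = c \<or> \<nu> f2 = c" by (auto simp: c_def cfv_def min_def)
    hence "fpush0 f1 f2 \<nu> X2 = 1 \<or> fpush0 f1 f2 \<nu> Y2 = 1"
      using c c0 by (auto simp: e pcomp_X2[OF f_mm] pcomp_Y2[OF f_mm])
    thus ?thesis using mm_X2 mm_Y2 by blast
  qed
  ultimately show ?thesis
    unfolding VT_def is_valuation_def using c
    by (auto simp: e pcomp_mult[OF f_mm] pcomp_const2[OF f_mm] val_mult[OF \<nu>] val_zero[OF \<nu>]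
        val_const[OF \<nu>] add_divide_distrib_ennreal ennreal_top_divide)
qed

lemma fpush_finite:
  assumes "\<nu> \<in> VT" "cfv f1 f2 \<nu> < top"
  shows "fpush f1 f2 \<nu> \<in> VT" "fpush f1 f2 \<nu> \<alpha> = \<nu> \<alpha> / cfv f1 f2 \<nu>"
    "fpush f1 f2 \<nu> \<beta> = (\<nu> \<beta> + \<nu> w) / cfv f1 f2 \<nu>"
proof -
  have "fpush f1 f2 \<nu> = fpush0 f1 f2 \<nu>" using assms(2) by (simp add: fpush_def)
  thus "fpush f1 f2 \<nu> \<in> VT" "fpush f1 f2 \<nu> \<alpha> = \<nu> \<alpha> / cfv f1 f2 \<nu>"
    "fpush f1 f2 \<nu> \<beta> = (\<nu> \<beta> + \<nu> w) / cfv f1 f2 \<nu>"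
    using fpush0_VT[OF assms] val_pull_\<alpha>[OF assms(1)] val_pull_\<beta>[OF assms(1)]
    by (simp_all add: fpush0_def)
qed

lemma fixed_val_cases:
  assumes "fixed_val f1 f2 \<nu>"
  shows "\<nu> = curve_val \<alpha> \<or> \<nu> = curve_val \<beta>"
proof (cases "\<nu> \<alpha> = top")
  case True
  thus ?thesis using val_eq_curve_val[OF _ co'] assms by (simp add: fixed_val_def)
next
  case False
  have \<nu>: "\<nu> \<in> VT" "fpush f1 f2 \<nu> = \<nu>" using assms by (auto simp: fixed_val_def)
  define c where "c = cfv f1 f2 \<nu>"
  have ct: "c < top" using False by (simp add: c_def cfv_eq[OF \<nu>(1)] min_less_iff_disj less_top)
  have c0: "c \<noteq> 0" using cfv_ge_1[OF \<nu>(1)] by (auto simp: c_def)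
  note push = fpush_finite[OF \<nu>(1) ct[unfolded c_def], folded c_def, unfolded \<nu>(2)]
  have a1: "1 \<le> \<nu> \<alpha>" using val_mm[OF \<nu>(1) coords_mm(1)[OF co]] .
  \<comment> \<open>Fixedness at \<open>\<alpha>\<close>, whose value is finite and nonzero, can be
    cancelled to give \<open>c = 1\<close>.\<close>
  have "\<nu> \<alpha> * c = \<nu> \<alpha> / c * c" using push(2) by simp
  also have "\<dots> = \<nu> \<alpha> * 1" using c0 ct by (simp add: ennreal_divide_times)
  finally have c1: "c = 1" using False a1 unfolding ennreal_mult_cancel_left by auto
  \<comment> \<open>A finite value at \<open>\<beta>\<close> would allow cancellation down to
    \<open>\<nu> w = 0\<close>, impossible for a non-unit.\<close>
  have "\<nu> \<beta> = top"
  proof (rule ccontr)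
    assume "\<nu> \<beta> \<noteq> top"
    moreover have "\<nu> \<beta> + 0 = \<nu> \<beta> + \<nu> w" using push(3) by (simp add: c1 divide_ennreal_def)
    ultimately have "\<nu> w = 0" by (simp only: ennreal_add_left_cancel) auto
    thus False using val_mm[OF \<nu>(1) w] by simp
  qed
  thus ?thesis using val_eq_curve_val[OF \<nu>(1) co] by blast
qed

text \<open>It suffices to inspect the image at \<open>\<beta>\<close>, since the value
  \<open>top\<close> there determines a valuation.\<close>

lemma fixed_curve_val_\<beta>: "fixed_val f1 f2 (curve_val \<beta>)"
proof -
  note cv = curve_val_facts[OF co]
  have c: "cfv f1 f2 (curve_val \<beta>) = 1" by (simp add: cfv_eq cv)
  note push = fpush_finite[OF cv(1), unfolded c, simplified]
  have "fpush f1 f2 (curve_val \<beta>) \<beta> = top" using push(3) by (simp add: cv ennreal_top_divide)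
  from val_eq_curve_val[OF push(1) co this] show ?thesis using cv by (simp add: fixed_val_def)
qed

lemma fixed_curve_val_\<alpha>:
  assumes "\<not> \<alpha> dvd w"
  shows "fixed_val f1 f2 (curve_val \<alpha>)"
proof -
  note cv = curve_val_facts[OF co']
  have "curve_val \<alpha> w < top" using assms curve_val_top_iff[OF co', of w] by (simp add: less_top)
  hence c: "cfv f1 f2 (curve_val \<alpha>) < top" by (simp add: cfv_eq cv)
  note push = fpush_finite[OF cv(1) c]
  have "fpush f1 f2 (curve_val \<alpha>) \<alpha> = top" using push(2) c by (simp add: cv ennreal_top_divide)
  from val_eq_curve_val[OF push(1) co' this] show ?thesis using cv by (simp add: fixed_val_def)
qed

section \<open>Attraction at the fixed ends\<close>

lemma coords_nonzero: "\<alpha> \<noteq> 0" "\<beta> \<noteq> 0"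
  using co by (auto simp: coords_def)

text \<open>Along an orbit the value at \<open>\<alpha>\<close> never increases, so an orbit
  starting with a finite value there cannot converge to this end.\<close>

lemma not_eigenval_curve_val_\<alpha>: "\<not> eigenval f1 f2 (curve_val \<alpha>)"
proof
  note cv = curve_val_facts[OF co']
  assume ev: "eigenval f1 f2 (curve_val \<alpha>)"
  hence fixed: "fpush f1 f2 (curve_val \<alpha>) = curve_val \<alpha>" by (simp add: eigenval_def fixed_val_def)
  have "\<not> quasimonomial (curve_val \<alpha>)" by (rule not_quasimonomial[of "curve_val \<alpha>" \<alpha>, OF cv(3) coords_nonzero(1)])
  hence "attracting_end f1 f2 (curve_val \<alpha>)" using ev by (simp add: eigenval_def)
  then obtain \<nu>0 where \<nu>0: "fpush f1 f2 ` {\<mu> \<in> VT. \<nu>0 < vinf \<mu> (curve_val \<alpha>)} \<subset>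
      {\<mu> \<in> VT. \<nu>0 < vinf \<mu> (curve_val \<alpha>)}"
    "\<forall>\<mu>\<in>{\<mu> \<in> VT. \<nu>0 < vinf \<mu> (curve_val \<alpha>)}. \<forall>\<phi>. (\<lambda>n. (fpush f1 f2 ^^ n) \<mu> \<phi>) \<longlonglongrightarrow> curve_val \<alpha> \<phi>"
    unfolding attracting_end_def Let_def by (elim conjE bexE)
  define U where "U = {\<mu> \<in> VT. \<nu>0 < vinf \<mu> (curve_val \<alpha>)}"
  have UV: "U \<subseteq> VT" and sub: "fpush f1 f2 ` U \<subset> U" using \<nu>0(1) by (simp_all add: U_def)
  have conv: "(\<lambda>n. (fpush f1 f2 ^^ n) \<mu> \<phi>) \<longlonglongrightarrow> curve_val \<alpha> \<phi>" if "\<mu> \<in> U" for \<mu> \<phi>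
    by (rule spec[OF bspec[OF \<nu>0(2)[folded U_def] that]])
  \<comment> \<open>Strictness of the inclusion supplies a starting point other than the end itself:
    a fixed point in \<open>U\<close> would belong to the image.\<close>
  obtain \<mu> where \<mu>: "\<mu> \<in> U" "\<mu> \<notin> fpush f1 f2 ` U" using sub by blast
  have "\<mu> \<noteq> curve_val \<alpha>" using \<mu> fixed by (metis imageI)
  hence "\<mu> \<alpha> \<noteq> top" using val_eq_curve_val[OF _ co', of \<mu>] \<mu>(1) UV by blast
  hence fin: "\<mu> \<alpha> < top" by (simp add: less_top)
  have it: "(fpush f1 f2 ^^ n) \<mu> \<in> VT \<and> (fpush f1 f2 ^^ n) \<mu> \<alpha> \<le> \<mu> \<alpha>" for n
  proof (induction n)
    case 0
    show ?case using \<mu>(1) UV by auto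
  next
    case (Suc n)
    define \<nu> where "\<nu> = (fpush f1 f2 ^^ n) \<mu>"
    have \<nu>: "\<nu> \<in> VT" "\<nu> \<alpha> \<le> \<mu> \<alpha>" using Suc by (simp_all add: \<nu>_def)
    have c: "cfv f1 f2 \<nu> < top" using \<nu>(2) fin by (auto simp: cfv_eq[OF \<nu>(1)] min_less_iff_disj)
    have "\<nu> \<alpha> / cfv f1 f2 \<nu> \<le> \<nu> \<alpha>"
    proof (rule divide_le_posI_ennreal)
      show "0 < cfv f1 f2 \<nu>" using cfv_ge_1[OF \<nu>(1)] by (simp add: less_le_trans[OF zero_less_one])
      show "\<nu> \<alpha> \<le> cfv f1 f2 \<nu> * \<nu> \<alpha>"
        using mult_right_mono[OF cfv_ge_1[OF \<nu>(1)], of "\<nu> \<alpha>"] by simp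
    qed
    thus ?case using fpush_finite[OF \<nu>(1) c] \<nu>(2) by (simp add: \<nu>_def)
  qed
  have "top \<le> \<mu> \<alpha>"
    unfolding cv(3)[symmetric]
    by (rule LIMSEQ_le_const2[OF conv[OF \<mu>(1), of \<alpha>]]) (use it in blast)
  thus False using fin by simp
qed

lemma attracting_end_curve_val_\<beta>: "attracting_end f1 f2 (curve_val \<beta>)"
proof -
  note cv = curve_val_facts[OF co]
  obtain M where M: "(\<forall>t\<ge>1. M t \<in> VT) \<and> (\<forall>t. M t \<alpha> = 1 \<and> M t \<beta> = t) \<and> mono M \<and>
      M top = curve_val \<beta> \<and> (\<forall>\<nu>\<in>VT. M (\<nu> \<beta>) \<le> \<nu> \<and> (\<nu> \<le> M top \<longrightarrow> \<nu> \<le> M (\<nu> \<beta>)))"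
    using monomial_valuations[OF co] by (elim exE)
  have MV: "M t \<in> VT" if "1 \<le> t" for t using M that by blast
  have Mv: "M t \<alpha> = 1" "M t \<beta> = t" for t using M by blast+
  have mono: "mono M" and Mtop: "M top = curve_val \<beta>" using M by blast+
  have Mle: "M (\<nu> \<beta>) \<le> \<nu>" if "\<nu> \<in> VT" for \<nu> using M that by blast
  have leM: "\<nu> \<le> M (\<nu> \<beta>)" if "\<nu> \<in> VT" "\<nu> \<le> M top" for \<nu> using M that by blast
  have b1: "1 \<le> \<nu> \<beta>" if "\<nu> \<in> VT" for \<nu> using val_mm[OF that coords_mm(2)[OF co]] .
  \<comment> \<open>A common lower bound \<open>\<sigma>\<close> lies below the curve, hence below
    \<open>M (\<sigma> \<beta>)\<close>, and \<open>\<sigma> \<beta>\<close> is at most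
    \<open>\<mu> \<beta>\<close>.\<close>
  have vinf: "vinf \<mu> (curve_val \<beta>) = M (\<mu> \<beta>)" if \<mu>: "\<mu> \<in> VT" for \<mu>
    unfolding vinf_def
  proof (rule the_equality)
    have glb: "\<sigma> \<le> M (\<mu> \<beta>)" if "\<sigma> \<in> VT" "\<sigma> \<le> \<mu>" "\<sigma> \<le> curve_val \<beta>" for \<sigma>
    proof -
      have "\<sigma> \<le> M (\<sigma> \<beta>)" using leM that by (simp add: Mtop)
      also have "\<dots> \<le> M (\<mu> \<beta>)" by (rule monoD[OF mono le_funD[OF that(2)]])
      finally show ?thesis .
    qed
    have le: "M (\<mu> \<beta>) \<le> curve_val \<beta>" using monoD[OF mono top_greatest] by (simp add: Mtop[symmetric])
    show "M (\<mu> \<beta>) \<in> VT \<and> M (\<mu> \<beta>) \<le> \<mu> \<and> M (\<mu> \<beta>) \<le> curve_val \<beta> \<and>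
        (\<forall>\<sigma>\<in>VT. \<sigma> \<le> \<mu> \<and> \<sigma> \<le> curve_val \<beta> \<longrightarrow> \<sigma> \<le> M (\<mu> \<beta>))"
      using MV[OF b1[OF \<mu>]] Mle[OF \<mu>] le glb by blast
    fix \<rho> assume "\<rho> \<in> VT \<and> \<rho> \<le> \<mu> \<and> \<rho> \<le> curve_val \<beta> \<and>
        (\<forall>\<sigma>\<in>VT. \<sigma> \<le> \<mu> \<and> \<sigma> \<le> curve_val \<beta> \<longrightarrow> \<sigma> \<le> \<rho>)"
    thus "\<rho> = M (\<mu> \<beta>)" using glb MV[OF b1[OF \<mu>]] Mle[OF \<mu>] le by (intro antisym) blast+
  qed
  have M1: "M 1 < M t \<longleftrightarrow> 1 < t" if "1 \<le> t" for t
  proof -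
    have "M 1 \<le> M t" using monoD[OF mono that] .
    moreover have "M 1 = M t \<longleftrightarrow> 1 = t" using Mv(2) by metis
    ultimately show ?thesis using that by (simp add: less_le)
  qed
  \<comment> \<open>Choosing the root \<open>M 1\<close> as \<open>\<nu>0\<close> gives the largest
    candidate for the basin; \<open>\<nu> \<alpha> = 1\<close> and \<open>c = 1\<close> hold
    throughout it.\<close>
  define U where "U = {\<mu> \<in> VT. M 1 < vinf \<mu> (curve_val \<beta>)}"
  have U: "\<mu> \<in> U \<longleftrightarrow> \<mu> \<in> VT \<and> 1 < \<mu> \<beta>" for \<mu>
    using vinf[of \<mu>] M1[OF b1, of \<mu>] by (auto simp: U_def)
  have push: "fpush f1 f2 \<mu> \<in> VT \<and> fpush f1 f2 \<mu> \<beta> = \<mu> \<beta> + \<mu> w" if "\<mu> \<in> U" for \<mu>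
  proof -
    have \<mu>: "\<mu> \<in> VT" "1 < \<mu> \<beta>" using that by (auto simp: U)
    have "\<mu> \<alpha> = 1" using val_coords_min[OF \<mu>(1) co] \<mu>(2) by (auto simp: min_def split: if_splits)
    hence c: "cfv f1 f2 \<mu> = 1"
      using \<mu>(2) by (simp add: cfv_eq[OF \<mu>(1)] min_def less_imp_le add_increasing2)
    show ?thesis using fpush_finite[OF \<mu>(1), unfolded c] by (simp add: divide_ennreal_def)
  qed
  have gt2: "2 < fpush f1 f2 \<mu> \<beta>" if "\<mu> \<in> U" for \<mu>
  proof -
    have \<mu>: "\<mu> \<in> VT" "1 < \<mu> \<beta>" using that by (auto simp: U)
    have "(2::ennreal) = 1 + 1" by simp
    also have "\<dots> < 1 + \<mu> \<beta>" using \<mu>(2) by (simp only: ennreal_add_left_cancel_less) simp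
    also have "\<dots> \<le> \<mu> w + \<mu> \<beta>" by (rule add_right_mono[OF val_mm[OF \<mu>(1) w]])
    finally show ?thesis using push[OF that] by (simp add: add.commute)
  qed
  have "fpush f1 f2 ` U \<subset> U"
  proof
    show "fpush f1 f2 ` U \<subseteq> U"
    proof (rule image_subsetI)
      fix \<mu> assume "\<mu> \<in> U"
      have "(1::ennreal) < 2" by simp
      also note gt2[OF \<open>\<mu> \<in> U\<close>]
      finally show "fpush f1 f2 \<mu> \<in> U" using push[OF \<open>\<mu> \<in> U\<close>] by (simp add: U)
    qed
    \<comment> \<open>One step raises a value above 1 to a value above 2, so \<open>M 2\<close>
      witnesses that the inclusion is strict.\<close>
    have "M 2 \<in> U" using MV[of 2] by (simp add: U Mv)
    moreover have "M 2 \<notin> fpush f1 f2 ` U" using gt2 Mv(2)[of 2] by (metis imageE less_irrefl)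
    ultimately show "fpush f1 f2 ` U \<noteq> U" by blast
  qed
  moreover have "(\<lambda>n. (fpush f1 f2 ^^ n) \<mu> \<phi>) \<longlonglongrightarrow> curve_val \<beta> \<phi>" if \<mu>: "\<mu> \<in> U" for \<mu> \<phi>
  proof -
    define m where "m n = (fpush f1 f2 ^^ n) \<mu>" for n
    have mU: "m n \<in> U" for n
      by (induction n) (use \<mu> \<open>fpush f1 f2 ` U \<subset> U\<close> in \<open>auto simp: m_def\<close>)
    have mVT: "m n \<in> VT" for n using mU U by blast
    have mb: "of_nat n < m n \<beta>" for n
    proof (induction n)
      case 0
      have "0 < (1::ennreal)" by simp
      also have "1 < m 0 \<beta>" using mU U by blast
      finally show ?case by simp
    next
      case (Suc n)
      have "of_nat (Suc n) = 1 + (of_nat n :: ennreal)" by simp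
      also have "\<dots> < 1 + m n \<beta>" using Suc by (simp only: ennreal_add_left_cancel_less) simp
      also have "\<dots> \<le> m n w + m n \<beta>" by (rule add_right_mono[OF val_mm[OF mVT w]])
      also have "\<dots> = m (Suc n) \<beta>" using push[OF mU, of n] by (simp add: m_def add.commute)
      finally show ?case .
    qed
    show ?thesis
    proof (cases "\<beta> dvd \<phi>")
      case True
      have le: "of_nat n \<le> m n \<phi>" for n
        using mb[of n] val_dvd[OF mVT True, of n] by (meson less_imp_le order_trans)
      have "(\<lambda>n. m n \<phi>) \<longlonglongrightarrow> top"
      proof (rule tendsto_sandwich[OF _ _ of_nat_tendsto_top_ennreal tendsto_const])
        show "eventually (\<lambda>n. of_nat n \<le> m n \<phi>) sequentially" by (intro always_eventually allI le)
        show "eventually (\<lambda>n. m n \<phi> \<le> top) sequentially" by (intro always_eventually allI top_greatest)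
      qed
      moreover have "curve_val \<beta> \<phi> = top" using curve_val_top_iff[OF co] True by simp
      ultimately show ?thesis by (simp add: m_def)
    next
      case False
      then obtain k v g where kvg: "v dvd 1" "\<phi> = \<alpha> ^ k * v + \<beta> * g"
        by (rule coords_mod_curve[OF co])
      have cvk: "curve_val \<beta> \<phi> = of_nat k"
        unfolding kvg(2) using kvg(1)
        by (intro val_mod_curve[of "curve_val \<beta>" \<alpha> k \<beta> v g]) (simp_all add: cv of_nat_less_top)
      \<comment> \<open>Once the value at \<open>\<beta>\<close> exceeds \<open>k\<close>, the
        iterates agree with the limit at \<open>\<phi>\<close>; convergence there is eventual
        equality.\<close>
      have "m n \<phi> = of_nat k" if "k \<le> n" for n
      proof -
        have "m n \<alpha> = 1"
          using val_coords_min[OF mVT co, of n] mU[of n] U by (auto simp: min_def split: if_splits)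
        moreover have "of_nat k < m n \<beta>"
          using that mb[of n] by (meson of_nat_le_iff le_less_trans)
        ultimately show ?thesis
          unfolding kvg(2) using kvg(1) mVT by (intro val_mod_curve[of "m n" \<alpha> k \<beta> v g])
      qed
      hence "eventually (\<lambda>n. m n \<phi> = curve_val \<beta> \<phi>) sequentially"
        unfolding cvk eventually_sequentially by blast
      thus ?thesis unfolding m_def by (rule tendsto_eventually)
    qed
  qed
  moreover have "is_end (curve_val \<beta>)"
    unfolding is_end_def
  proof (intro conjI notI)
    assume "\<exists>\<mu>\<in>VT. curve_val \<beta> < \<mu>"
    then obtain \<mu> where \<mu>: "\<mu> \<in> VT" "curve_val \<beta> < \<mu>" by blast
    have "\<mu> \<beta> = top" using le_funD[OF less_imp_le[OF \<mu>(2)], of \<beta>] cv(3) by (simp add: top_unique)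
    hence "\<mu> = curve_val \<beta>" by (rule val_eq_curve_val[OF \<mu>(1) co])
    thus False using \<mu>(2) by simp
  qed (rule cv(1))
  moreover have "M 1 \<in> VT" "M 1 < curve_val \<beta>" using MV M1[of top] by (simp_all add: Mtop)
  ultimately show ?thesis
    unfolding attracting_end_def Let_def U_def[symmetric]
    by (intro conjI bexI[of _ "M 1"]) (simp_all add: U_def)
qed

text \<open>A contracted curve has infinite intersection with both components of the germ. These
  share the factor \<open>\<alpha>\<close>, and the cofactors \<open>p\<close> and \<open>q\<close>
  are not both non-units, which leaves only \<open>\<alpha> = 0\<close>.\<close>

lemma contracted_iff:
  assumes dvd: "\<alpha> dvd w"
  shows "contracted f1 f2 \<nu> \<longleftrightarrow> \<nu> = curve_val \<alpha>"
proof
  have "\<alpha> dvd f1" "\<alpha> dvd f2"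
  proof -
    have "\<alpha> dvd pcomp \<phi> f1 f2" if m: "\<phi> \<in> mm" for \<phi>
    proof -
      obtain r s where "\<phi> = \<alpha> * r + \<beta> * s" using coords_mm_split[OF co m] .
      hence "pcomp \<phi> f1 f2 = \<alpha> * (u * pcomp r f1 f2) + w * (\<beta> * pcomp s f1 f2)"
        by (simp add: pcomp_add pcomp_mult[OF f_mm] pull_\<alpha> pull_\<beta> ac_simps)
      thus ?thesis using dvd by simp
    qed
    from this[OF mm_X2] this[OF mm_Y2] show "\<alpha> dvd f1" "\<alpha> dvd f2"
      by (simp_all add: pcomp_X2[OF f_mm] pcomp_Y2[OF f_mm])
  qed
  then obtain p q where f: "f1 = \<alpha> * p" "f2 = \<alpha> * q" by (elim dvdE)
  {
    assume "\<nu> = curve_val \<alpha>"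
    moreover have "curve_val \<alpha> f1 = top" "curve_val \<alpha> f2 = top"
      using curve_val_top_iff[OF co'] f by simp_all
    ultimately show "contracted f1 f2 \<nu>"
      using is_curve_coord[OF co'] by (auto simp: contracted_def is_curve_val_def cfv_def)
  }
  assume "contracted f1 f2 \<nu>"
  then obtain \<psi> where \<psi>: "is_curve \<psi>" "\<nu> = curve_val \<psi>" "cfv f1 f2 (curve_val \<psi>) = top"
    by (auto simp: contracted_def is_curve_val_def)
  have irr: "irreducible \<psi>" and \<psi>m: "\<psi> \<in> mm" using \<psi>(1) by (auto simp: is_curve_def)
  \<comment> \<open>Needed for the quotient defining \<open>curve_val\<close>: division of a nonzero
    number by 0 in \<open>ennreal\<close> would yield \<open>top\<close> even for a finite
    intersection.\<close>
  have "mult2 \<psi> \<noteq> 0"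
  proof
    assume "mult2 \<psi> = 0"
    moreover have "\<exists>n. \<exists>i j. i + j = n \<and> cf \<psi> i j \<noteq> 0"
      using irr ps2_eqI[of \<psi> 0] by (auto simp: irreducible_def)
    from LeastI_ex[OF this] have "\<exists>i j. i + j = mult2 \<psi> \<and> cf \<psi> i j \<noteq> 0" by (simp add: mult2_def)
    ultimately show False using \<psi>m by (simp add: mm_def)
  qed
  moreover have "top \<le> curve_val \<psi> f1" "top \<le> curve_val \<psi> f2"
    unfolding \<psi>(3)[symmetric] cfv_def by simp_all
  ultimately have tops: "imult \<psi> f1 = top" "imult \<psi> f2 = top"
    unfolding curve_val_def top_unique ennreal_divide_eq_top_iff by auto
  \<comment> \<open>The series \<open>\<alpha> u\<close> lies in the ideal of \<open>f1\<close> and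
    \<open>f2\<close>; cancelling \<open>\<alpha>\<close> puts the unit \<open>u\<close> into the
    ideal of \<open>p\<close> and \<open>q\<close>.\<close>
  have "p dvd 1 \<or> q dvd 1"
  proof -
    obtain r s where rs: "\<alpha> = X2 * r + Y2 * s"
      using coords_mm_split[OF coords_X2_Y2 coords_mm(1)[OF co]] .
    have lin: "f1 * x + f2 * y = \<alpha> * (p * x + q * y)" for x y
      by (simp add: f distrib_left mult.assoc)
    have "\<alpha> * u = f1 * pcomp r f1 f2 + f2 * pcomp s f1 f2"
      unfolding pull_\<alpha>[symmetric]
      by (subst rs) (simp add: pcomp_add pcomp_mult[OF f_mm] pcomp_X2[OF f_mm] pcomp_Y2[OF f_mm])
    also have "\<dots> = \<alpha> * (p * pcomp r f1 f2 + q * pcomp s f1 f2)"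
      by (rule lin)
    finally have ue: "u = p * pcomp r f1 f2 + q * pcomp s f1 f2" using coords_nonzero by simp
    have "cf u 0 0 = cf p 0 0 * cf (pcomp r f1 f2) 0 0 + cf q 0 0 * cf (pcomp s f1 f2) 0 0"
      unfolding ue by (simp add: cf_mult)
    thus ?thesis using u by (auto simp: ps2_unit_iff)
  qed
  \<comment> \<open>One component is \<open>\<alpha>\<close> times a unit. Symmetry of the
    intersection multiplicity turns its infinite intersection with \<open>\<psi>\<close> into
    divisibility of \<open>\<psi>\<close> by \<open>\<alpha>\<close>.\<close>
  then obtain v where v: "v dvd 1" "imult \<psi> (\<alpha> * v) = top" using tops f by metis
  have "curve_val (\<alpha> * v) \<psi> = top"
    using v by (simp add: curve_val_coord[OF coords_mult_unit[OF co' v(1)]] imult_commute)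
  hence "curve_val \<alpha> \<psi> = top" by (simp add: curve_val_mult_unit[OF co' v(1)])
  then obtain s where s: "\<psi> = \<alpha> * s" using curve_val_top_iff[OF co'] by (metis dvdE)
  have "\<not> \<alpha> dvd 1" using coords_mm(1)[OF co] by (simp add: ps2_unit_iff mm_def)
  hence "s dvd 1" using irreducibleD[OF irr s] by blast
  thus "\<nu> = curve_val \<alpha>" unfolding \<psi>(2) s by (rule curve_val_mult_unit[OF co'])
qed

text \<open>Along the segment towards \<open>curve_val \<alpha>\<close> the normalising factor is the weight of \<open>\<alpha>\<close>, so
  in the limit only the order of vanishing along \<open>\<alpha> = 0\<close> of the pulled back series survives.\<close>

lemma not_fixed_curve_val_\<alpha>:
  assumes dvd: "\<alpha> dvd w"
  shows "\<not> fixed_val f1 f2 (curve_val \<alpha>)"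
proof -
  note cv = curve_val_facts[OF co']
  obtain M where M: "(\<forall>t\<ge>1. M t \<in> VT) \<and> (\<forall>t. M t \<beta> = 1 \<and> M t \<alpha> = t) \<and> mono M \<and>
      M top = curve_val \<alpha> \<and> (\<forall>\<nu>\<in>VT. M (\<nu> \<alpha>) \<le> \<nu> \<and> (\<nu> \<le> M top \<longrightarrow> \<nu> \<le> M (\<nu> \<alpha>)))"
    using monomial_valuations[OF co'] by (elim exE)
  have MV: "M t \<in> VT" if "1 \<le> t" for t using M that by blast
  have Mv: "M t \<beta> = 1" "M t \<alpha> = t" for t using M by blast+
  have mono: "mono M" and Mtop: "M top = curve_val \<alpha>" using M by blast+
  have Mle: "M (\<nu> \<alpha>) \<le> \<nu>" if "\<nu> \<in> VT" for \<nu> using M that by blast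
  have leM: "\<nu> \<le> M (\<nu> \<alpha>)" if "\<nu> \<in> VT" "\<nu> \<le> curve_val \<alpha>" for \<nu> using M that by metis
  have a1: "1 \<le> \<nu> \<alpha>" if "\<nu> \<in> VT" for \<nu> using val_mm[OF that coords_mm(1)[OF co]] .
  have Mlt: "M t < curve_val \<alpha>" if "t < top" for t
  proof -
    have "M t \<le> curve_val \<alpha>" unfolding Mtop[symmetric] by (rule monoD[OF mono top_greatest])
    moreover have "M t \<noteq> curve_val \<alpha>" using Mv(2)[of t] cv(3) that by auto
    ultimately show ?thesis by (simp add: less_le)
  qed
  have seg: "\<nu> = M (\<nu> \<alpha>) \<and> \<nu> \<alpha> < top" if "\<nu> \<in> VT" "\<nu> < curve_val \<alpha>" for \<nu>
  proof
    show "\<nu> = M (\<nu> \<alpha>)" using leM[OF that(1) less_imp_le[OF that(2)]] Mle[OF that(1)] by (rule antisym)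
    have "\<nu> \<alpha> \<noteq> top" using val_eq_curve_val[OF that(1) co'] that(2) by blast
    thus "\<nu> \<alpha> < top" by (simp add: less_top)
  qed
  \<comment> \<open>Every valuation strictly below the curve is \<open>M r\<close> for a finite
    weight \<open>r\<close>, so approaching the curve amounts to \<open>r\<close> tending to
    infinity.\<close>
  define F where "F = filtermap (\<lambda>r. M (ennreal r)) at_top"
  have "seg_filter (curve_val \<alpha>) = F"
  proof (rule antisym)
    show "seg_filter (curve_val \<alpha>) \<le> F"
    proof (rule filter_leI)
      fix P assume "eventually P F"
      then obtain N where N: "\<And>r. r \<ge> N \<Longrightarrow> P (M (ennreal r))"
        unfolding F_def eventually_filtermap eventually_at_top_linorder by blast
      define s where "s = max 1 N"
      have s1: "1 \<le> ennreal s" by (simp add: s_def)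
      have "P \<nu>" if "\<nu> \<in> VT" "M (ennreal s) \<le> \<nu>" "\<nu> < curve_val \<alpha>" for \<nu>
      proof -
        have "ennreal s \<le> \<nu> \<alpha>" using le_funD[OF that(2), of \<alpha>] by (simp add: Mv)
        moreover have e: "\<nu> \<alpha> = ennreal (enn2real (\<nu> \<alpha>))" using seg[OF that(1,3)] by simp
        ultimately have "s \<le> enn2real (\<nu> \<alpha>)"
          by (metis enn2real_nonneg ennreal_le_iff)
        hence "P (M (ennreal (enn2real (\<nu> \<alpha>))))" by (intro N) (simp add: s_def)
        thus ?thesis using seg[OF that(1,3)] e by simp
      qed
      hence "eventually P (principal {\<nu> \<in> VT. M (ennreal s) \<le> \<nu> \<and> \<nu> < curve_val \<alpha>})"
        by (simp add: eventually_principal)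
      moreover have "seg_filter (curve_val \<alpha>) \<le> principal {\<nu> \<in> VT. M (ennreal s) \<le> \<nu> \<and> \<nu> < curve_val \<alpha>}"
        unfolding seg_filter_def by (rule INF_lower) (simp add: MV[OF s1] Mlt)
      ultimately show "eventually P (seg_filter (curve_val \<alpha>))" by (rule filter_leD[rotated])
    qed
    show "F \<le> seg_filter (curve_val \<alpha>)"
      unfolding seg_filter_def
    proof (rule INF_greatest)
      fix \<nu>0 assume "\<nu>0 \<in> {\<nu> \<in> VT. \<nu> < curve_val \<alpha>}"
      hence \<nu>0: "\<nu>0 \<in> VT" "\<nu>0 < curve_val \<alpha>" by auto
      have "M (ennreal r) \<in> {\<nu> \<in> VT. \<nu>0 \<le> \<nu> \<and> \<nu> < curve_val \<alpha>}"
        if r: "r \<ge> max 1 (enn2real (\<nu>0 \<alpha>))" for r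
      proof -
        have "\<nu>0 \<alpha> = ennreal (enn2real (\<nu>0 \<alpha>))" using seg[OF \<nu>0] by simp
        also have "\<dots> \<le> ennreal r" using r by (simp add: ennreal_leI)
        finally have "M (\<nu>0 \<alpha>) \<le> M (ennreal r)" by (rule monoD[OF mono])
        hence "\<nu>0 \<le> M (ennreal r)" using leM[OF \<nu>0(1) less_imp_le[OF \<nu>0(2)]] by (rule order_trans[rotated])
        thus ?thesis using MV[of "ennreal r"] Mlt[of "ennreal r"] r by simp
      qed
      thus "F \<le> principal {\<nu> \<in> VT. \<nu>0 \<le> \<nu> \<and> \<nu> < curve_val \<alpha>}"
        unfolding F_def le_principal eventually_filtermap eventually_at_top_linorder by blast
    qed
  qed
  \<comment> \<open>Divisibility of \<open>w\<close> by \<open>\<alpha>\<close> gives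
    \<open>w\<close> at least the value \<open>r\<close> of \<open>\<alpha>\<close>, so the minimum
    is taken at \<open>\<alpha>\<close>.\<close>
  have cfvM: "cfv f1 f2 (M (ennreal r)) = ennreal r" if "r \<ge> 1" for r
  proof -
    have V: "M (ennreal r) \<in> VT" using MV that by simp
    have "ennreal r \<le> M (ennreal r) w" using val_dvd[OF V dvd] by (simp add: Mv)
    hence "ennreal r \<le> M (ennreal r) \<beta> + M (ennreal r) w" by (simp add: add_increasing)
    thus ?thesis by (simp add: cfv_eq[OF V] Mv min_def)
  qed
  \<comment> \<open>The \<open>THE\<close> in \<open>fpush\<close> says nothing unless all series
    have a limit along the segment; existence is proved for each one and the limits are collected
    into \<open>L\<close>.\<close>
  have ex: "\<exists>l. ((\<lambda>r. fpush0 f1 f2 (M (ennreal r)) \<phi>) \<longlongrightarrow> l) at_top" for \<phi>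
  proof (cases "pcomp \<phi> f1 f2 = 0")
    case True
    have "fpush0 f1 f2 (M (ennreal r)) \<phi> = top" if "r \<ge> 1" for r
      using that MV[of "ennreal r"] by (simp add: fpush0_def True val_zero cfvM ennreal_top_divide)
    hence "eventually (\<lambda>r. fpush0 f1 f2 (M (ennreal r)) \<phi> = top) at_top"
      unfolding eventually_at_top_linorder by blast
    thus ?thesis by (intro exI[of _ top] tendsto_eventually)
  next
    case False
    \<comment> \<open>The values of \<open>g\<close> on the segment stay below its finite value
      \<open>G\<close> at the curve, so after division they contribute at most
      \<open>G / r\<close>.\<close>
    obtain k g where kg: "pcomp \<phi> f1 f2 = \<alpha> ^ k * g" "\<not> \<alpha> dvd g"
      using coord_power_factor[OF coords_mm(1)[OF co] False] by blast
    define G where "G = enn2real (curve_val \<alpha> g)"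
    have "curve_val \<alpha> g < top" using kg(2) curve_val_top_iff[OF co', of g] by (simp add: less_top)
    hence G: "curve_val \<alpha> g = ennreal G" by (simp add: G_def)
    have G0: "G \<ge> 0" by (simp add: G_def)
    have bounds: "ennreal (real k) \<le> fpush0 f1 f2 (M (ennreal r)) \<phi> \<and>
        fpush0 f1 f2 (M (ennreal r)) \<phi> \<le> ennreal (real k + G / r)" if r: "r \<ge> 1" for r
    proof -
      have V: "M (ennreal r) \<in> VT" using MV r by simp
      have kr: "of_nat k * ennreal r / ennreal r = ennreal (real k)"
        using r by (simp add: ennreal_mult_divide_eq ennreal_of_nat_eq_real_of_nat)
      have "fpush0 f1 f2 (M (ennreal r)) \<phi> = (of_nat k * ennreal r + M (ennreal r) g) / ennreal r"
        using V r by (simp add: fpush0_def kg(1) val_mult val_power cfvM Mv)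
      hence e: "fpush0 f1 f2 (M (ennreal r)) \<phi> = ennreal (real k) + M (ennreal r) g / ennreal r"
        by (simp add: add_divide_distrib_ennreal kr)
      have "M (ennreal r) g \<le> ennreal G"
        unfolding G[symmetric] Mtop[symmetric] by (rule le_funD[OF monoD[OF mono top_greatest]])
      hence "M (ennreal r) g / ennreal r \<le> ennreal G / ennreal r" by (rule divide_right_mono_ennreal)
      also have "\<dots> = ennreal (G / r)" using r G0 by (simp add: divide_ennreal)
      finally have "fpush0 f1 f2 (M (ennreal r)) \<phi> \<le> ennreal (real k) + ennreal (G / r)"
        unfolding e by (rule add_left_mono)
      also have "\<dots> = ennreal (real k + G / r)" using r G0 by simp
      finally show ?thesis unfolding e by simp
    qed
    have "((\<lambda>r::real. G / r) \<longlongrightarrow> 0) at_top"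
      by (intro tendsto_divide_0[OF tendsto_const] filterlim_at_top_imp_at_infinity filterlim_ident)
    hence lim: "((\<lambda>r. ennreal (real k + G / r)) \<longlongrightarrow> ennreal (real k + 0)) at_top"
      by (intro tendsto_ennrealI tendsto_add tendsto_const)
    have "((\<lambda>r. fpush0 f1 f2 (M (ennreal r)) \<phi>) \<longlongrightarrow> ennreal (real k)) at_top"
    proof (rule tendsto_sandwich[OF _ _ tendsto_const lim[simplified]])
      show "eventually (\<lambda>r. ennreal (real k) \<le> fpush0 f1 f2 (M (ennreal r)) \<phi>) at_top"
        "eventually (\<lambda>r. fpush0 f1 f2 (M (ennreal r)) \<phi> \<le> ennreal (real k + G / r)) at_top"
        unfolding eventually_at_top_linorder using bounds by blast+
    qed
    thus ?thesis by (rule exI)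
  qed
  have tF: "((\<lambda>\<nu>. fpush0 f1 f2 \<nu> \<phi>) \<longlongrightarrow> l) F \<longleftrightarrow> ((\<lambda>r. fpush0 f1 f2 (M (ennreal r)) \<phi>) \<longlongrightarrow> l) at_top" for \<phi> l
    unfolding F_def filterlim_filtermap ..
  have "\<forall>\<phi>. \<exists>l. ((\<lambda>\<nu>. fpush0 f1 f2 \<nu> \<phi>) \<longlongrightarrow> l) F" using ex unfolding tF by (rule allI)
  from choice[OF this] obtain L where L: "\<forall>\<phi>. ((\<lambda>\<nu>. fpush0 f1 f2 \<nu> \<phi>) \<longlongrightarrow> L \<phi>) F" ..
  have Fbot: "F \<noteq> bot" unfolding F_def by (simp add: filtermap_bot_iff)
  have "cfv f1 f2 (curve_val \<alpha>) = top"
    using dvd curve_val_top_iff[OF co'] by (simp add: cfv_eq[OF cv(1)] cv)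
  hence "fpush f1 f2 (curve_val \<alpha>) = (THE \<mu>. \<forall>\<phi>. ((\<lambda>\<nu>. fpush0 f1 f2 \<nu> \<phi>) \<longlongrightarrow> \<mu> \<phi>) F)"
    unfolding fpush_def \<open>seg_filter (curve_val \<alpha>) = F\<close> by simp
  also have "\<dots> = L"
  proof (rule the_equality)
    show "\<forall>\<phi>. ((\<lambda>\<nu>. fpush0 f1 f2 \<nu> \<phi>) \<longlongrightarrow> L \<phi>) F" by (rule L)
    fix \<mu> assume "\<forall>\<phi>. ((\<lambda>\<nu>. fpush0 f1 f2 \<nu> \<phi>) \<longlongrightarrow> \<mu> \<phi>) F"
    thus "\<mu> = L" using tendsto_unique[OF Fbot] L by (intro ext) blast
  qed
  finally have push: "fpush f1 f2 (curve_val \<alpha>) = L" .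
  \<comment> \<open>The value at \<open>\<alpha>\<close> separates the limit from the curve
    valuation: it is 1 for the former and \<open>top\<close> for the latter.\<close>
  have "fpush0 f1 f2 (M (ennreal r)) \<alpha> = 1" if "r \<ge> 1" for r
    using that MV[of "ennreal r"] by (simp add: fpush0_def val_pull_\<alpha> cfvM Mv)
  hence "eventually (\<lambda>r. fpush0 f1 f2 (M (ennreal r)) \<alpha> = 1) at_top"
    unfolding eventually_at_top_linorder by blast
  hence "((\<lambda>\<nu>. fpush0 f1 f2 \<nu> \<alpha>) \<longlongrightarrow> 1) F" unfolding tF by (rule tendsto_eventually)
  hence "L \<alpha> = 1" by (rule tendsto_unique[OF Fbot spec[OF L]])
  thus ?thesis using push cv(3) by (auto simp: fixed_val_def)
qed

text \<open>The inequality between the two alternatives is exclusive or. Its decision point is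
  whether \<open>f\<close> collapses the curve \<open>\<alpha> = 0\<close>, on which it acts by
  \<open>\<beta> \<mapsto> \<beta> w\<close>.\<close>

lemma eigenval_dichotomy:
  "is_curve \<beta> \<and> mult2 \<beta> = 1 \<and> {\<nu>. eigenval f1 f2 \<nu>} = {curve_val \<beta>} \<and>
     (({\<nu>. fixed_val f1 f2 \<nu>} = {curve_val \<beta>} \<and>
        (\<exists>D. is_curve D \<and> mult2 D = 1 \<and> {\<nu>. contracted f1 f2 \<nu>} = {curve_val D} \<and>
             imult \<beta> D = 1))
      \<noteq>
      (\<exists>D. is_curve D \<and> mult2 D = 1 \<and> curve_val D \<noteq> curve_val \<beta> \<and>
           {\<nu>. fixed_val f1 f2 \<nu>} = {curve_val \<beta>, curve_val D} \<and> imult \<beta> D = 1))"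
proof (intro conjI)
  show "is_curve \<beta>" "mult2 \<beta> = 1" by (rule is_curve_coord[OF co], rule mult2_coord[OF co])
  have "eigenval f1 f2 \<nu> \<longleftrightarrow> \<nu> = curve_val \<beta>" for \<nu>
    using fixed_val_cases[of \<nu>] not_eigenval_curve_val_\<alpha> fixed_curve_val_\<beta> attracting_end_curve_val_\<beta>
    unfolding eigenval_def by blast
  thus "{\<nu>. eigenval f1 f2 \<nu>} = {curve_val \<beta>}" by auto
  \<comment> \<open>Transversality is the normalisation of the curve valuation of
    \<open>\<beta>\<close> at the other coordinate.\<close>
  have im: "imult \<beta> \<alpha> = 1" using curve_val_facts(2)[OF co] by (simp add: curve_val_coord[OF co])
  have ne: "curve_val \<alpha> \<noteq> curve_val \<beta>"
    using curve_val_facts(3)[OF co] curve_val_facts(2)[OF co'] by auto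
  note D = is_curve_coord[OF co'] mult2_coord[OF co']
  let ?Fix = "{\<nu>. fixed_val f1 f2 \<nu>}"
  show "(?Fix = {curve_val \<beta>} \<and>
        (\<exists>D. is_curve D \<and> mult2 D = 1 \<and> {\<nu>. contracted f1 f2 \<nu>} = {curve_val D} \<and> imult \<beta> D = 1))
      \<noteq> (\<exists>D. is_curve D \<and> mult2 D = 1 \<and> curve_val D \<noteq> curve_val \<beta> \<and>
           ?Fix = {curve_val \<beta>, curve_val D} \<and> imult \<beta> D = 1)" (is "?A \<noteq> ?B")
  proof (cases "\<alpha> dvd w")
    case True
    have F: "?Fix = {curve_val \<beta>}"
      using fixed_val_cases fixed_curve_val_\<beta> not_fixed_curve_val_\<alpha>[OF True] by blast
    have "{\<nu>. contracted f1 f2 \<nu>} = {curve_val \<alpha>}" using contracted_iff[OF True] by auto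
    hence A: ?A using F D im by blast
    have "\<not> ?B"
    proof
      assume ?B
      then obtain D where "curve_val D \<noteq> curve_val \<beta>" "?Fix = {curve_val \<beta>, curve_val D}" by blast
      thus False unfolding F by blast
    qed
    thus ?thesis using A by blast
  next
    case False
    have F: "?Fix = {curve_val \<beta>, curve_val \<alpha>}"
      using fixed_val_cases fixed_curve_val_\<beta> fixed_curve_val_\<alpha>[OF False] by blast
    have B: ?B using F D im ne by blast
    have "\<not> ?A"
    proof
      assume ?A
      hence "?Fix = {curve_val \<beta>}" by blast
      thus False unfolding F using ne by blast
    qed
    thus ?thesis using B by blast
  qed
qed

end

theorem theorem2:
  fixes f1 f2 :: ps2
  assumes "holo_germ f1 f2" and "dominant f1 f2" and "semi_superattracting f1 f2"
  shows "\<exists>C. is_curve C \<and> mult2 C = 1 \<and> {\<nu>. eigenval f1 f2 \<nu>} = {curve_val C} \<and>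
     (({\<nu>. fixed_val f1 f2 \<nu>} = {curve_val C} \<and>
        (\<exists>D. is_curve D \<and> mult2 D = 1 \<and> {\<nu>. contracted f1 f2 \<nu>} = {curve_val D} \<and>
             imult C D = 1))
      \<noteq>
      (\<exists>D. is_curve D \<and> mult2 D = 1 \<and> curve_val D \<noteq> curve_val C \<and>
           {\<nu>. fixed_val f1 f2 \<nu>} = {curve_val C, curve_val D} \<and> imult C D = 1))"
proof -
  have f: "f1 \<in> mm" "f2 \<in> mm" using assms(1) by (auto simp: holo_germ_def)
  obtain \<alpha> \<beta> u w where nf: "coords \<alpha> \<beta>" "pcomp \<alpha> f1 f2 = \<alpha> * u" "cf u 0 0 \<noteq> 0"
    "pcomp \<beta> f1 f2 = \<beta> * w" "w \<in> mm"
    using semi_superattracting_normal_form[OF f assms(3)] by blast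
  interpret invariant_coords f1 f2 \<alpha> \<beta> u w
    by (rule invariant_coords.intro[OF f nf(1,2) ps2_is_unit[OF nf(3)] nf(4,5)])
  show ?thesis by (rule exI[of _ \<beta>]) (rule eigenval_dichotomy)
qed

end
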